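(* Let $\mathcal{A}$ be a real (linear or affine) hyperplane arrangement with associated oriented system $(\Gamma,\sim)$. For any topological cover $r:S'\rightarrow Sal(\mathcal{A})$ of the Salvetti complex of $\mathcal{A}$ there exists a cover of oriented systems $\rho:(\Theta,\sim)\rightarrow(\Gamma,\sim)$ such that the homotopy colimit $\mathrm{hocolim}\,\mathscr{D}_\rho$ of the associated diagram of spaces $\mathscr{D}_\rho$ is homotopy equivalent to $S'$. Moreover, the order complex $W_\rho=\Delta(\mathrm{Plim}\,\mathscr{D}_\rho)$ of the poset limit of $\mathscr{D}_\rho$, with the map $\Lambda_\rho:W_\rho\to W\cong Sal(\mathcal{A})$, is isomorphic to $r:S'\to Sal(\mathcal{A})$ as a covering space of $Sal(\mathcal{A})$.
   Context: **Arrangements.** $\mathcal{A}$ is a finite set of linear or affine hyperplanes in $\mathbb{R}^d$. $\mathcal{F}=\mathcal{F}(\mathcal{A})$ is its face poset: the set of all relatively open polyhedral cells of the stratification of $\mathbb{R}^d$ induced by $\mathcal{A}$, ordered by $F_1\ge F_2 \iff \overline{F_1}\subseteq\overline{F_2}$. The chambers $\mathcal{C}(\mathcal{A})$ (components of $\mathbb{R}^d\setminus\bigcup\mathcal{A}$) are the minimal elements. $|F|$ is the affine hull of $F$, and $\mathcal{A}_{|F|}=\{H\in\mathcal{A}: |F|\subseteq H\}$. For a face $F$ and chamber $C$, $C_F$ is the unique chamber of $\mathcal{A}$ whose closure contains $F$ and which lies in the same chamber of $\mathcal{A}_{|F|}$ as $C$. **Salvetti complex.** Choose a point $w(F)$ in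 every face $F$ and put $w(F,C)=w(F)\oplus[w(F)-w(C_F)]\in\mathbb{R}^d\oplus\mathbb{R}^d=\mathbb{C}^d$ (it depends only on $F$ and $C_F$). $Sal(\mathcal{A})$ is the simplicial complex with vertices $w(F,C)$, $F\in\mathcal{F}$, $C\in\mathcal{C}(\mathcal{A})$, in which the convex hull of $w(F_0,C_0),\dots,w(F_k,C_k)$ is a simplex iff (up to ordering) $F_0>\dots>F_k$ is a chain in $\mathcal{F}$ and $(C_0)_{F_i}=(C_i)_{F_i}$ for all $i$. **Oriented systems.** In an oriented graph (edges are ordered pairs of vertices), a path is a sequence of edges with exponents $\pm1$ (traversed forward or backward), consecutive in the obvious sense; it is positive if all exponents are $+1$. An oriented system is an oriented graph together with an equivalence relation $\sim$ on its paths such that: $\alpha\sim\beta$ implies equal beginnings and equal ends; $\alpha\alpha^{-1}\sim begin(\alpha)$ (constant path); $\alpha\sim\beta$ implies $\alpha^{-1}\sim\beta^{-1}$; $\alpha\sim\beta$ implies $\gamma_1\alpha\gamma_2\sim\gamma_1\beta\gamma_2$ whenever composable. All graphs and all covering spaces are assumed connected. The oriented system $(\Gamma,\sim)$ of $\mathcal{A}$ has vertex set $\mathcal{C}(\mathcal{A})$, an edge $(A,B)$ for every ordered pair of adjacent chambers (separated by exactly one hyperplane), and $\sim$ is generated by identifying any two positive paths with the same beginning and end that both have minimal length among positive paths joining these vertices. A cover $\rho:(\Theta,\sim)\to(\Gamma,\sim)$ is a morphism of oriented graphs such that (1) for each vertex $v$ of $\Theta$ and each path $\alpha$ in $\Gamma$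 with $begin(\alpha)=\rho(v)$ there is a unique path $\hat\alpha_v$ in $\Theta$ beginning at $v$ with $\rho(\hat\alpha_v)=\alpha$; (2) $\alpha\sim\beta$ and $begin(\alpha)=begin(\beta)=\rho(v)$ imply $\hat\alpha_v\sim\hat\beta_v$. For a vertex $v$ of $\Theta$ with $\rho(v)=A$, $\hat\gamma_v(A\to B)$ denotes the lift at $v$ of a positive minimal path from $A$ to $B$ (unique up to $\sim$; its end is well defined). **The diagram.** A diagram of spaces over a poset $\mathcal{P}$ is a covariant functor $\mathcal{P}\to Top$, where $\mathcal{P}$ is regarded as a category with an arrow $p\to q$ iff $p\ge q$. Given a cover $\rho$, $\mathscr{D}_\rho:\mathcal{F}\to Top$ has discrete spaces $\mathscr{D}_\rho(F)=\{v\in V(\Theta):\rho(v)\le F\}$ and maps, for $F_1>F_2$, $v\mapsto end(\hat\gamma_v(\rho(v)\to\rho(v)_{F_2}))$. **Homotopy colimit.** For a diagram $\mathscr{D}$ over $\mathcal{P}$ with spaces $D_p$ and maps $f_{p>q}$, $\mathrm{hocolim}\,\mathscr{D}=\bigsqcup_{p} D_p\times\Delta(\mathcal{P}_{\le p})/\!\sim$, where for $p>q$ each point $(x,t)\in D_p\times\Delta(\mathcal{P}_{\le q})\subseteq D_p\times\Delta(\mathcal{P}_{\le p})$ is identified with $(f_{p>q}(x),t)\in D_q\times\Delta(\mathcal{P}_{\le q})$. $\Delta(\cdot)$ denotes the order complex. **Poset limit.** $\mathrm{Plim}\,\mathscr{D}_\rho$ is the set of pairs $(F,v)$ with $F\in\mathcal{F}$,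 $v\in\mathscr{D}_\rho(F)$, ordered by $(F_1,v_1)\ge(F_2,v_2)$ iff $F_1\ge F_2$ and $v_2=end(\hat\gamma_{v_1}(\rho(v_1)\to\rho(v_1)_{F_2}))$. Put $W_\rho=\Delta(\mathrm{Plim}\,\mathscr{D}_\rho)$ and $W=W_{id}$ for the identity cover of $(\Gamma,\sim)$. $W$ is identified with $Sal(\mathcal{A})$ through the simplicial isomorphism $(F,C)\mapsto w(F,C)$, and $\Lambda_\rho:W_\rho\to W$ is the simplicial map $(F,v)\mapsto(F,\rho(v))$. *)

theory Defs
  imports "HOL-Analysis.Analysis"
begin

section \<open>Hyperplane arrangements\<close>

text \<open>The ambient space is an arbitrary Euclidean space; linear hyperplanes are the case \<open>b = 0\<close>.\<close>

definition hyperplane_arrangement :: "'a::euclidean_space set set \<Rightarrow> bool" where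
  "hyperplane_arrangement \<A> \<longleftrightarrow>
     finite \<A> \<and> (\<forall>H\<in>\<A>. \<exists>a b. a \<noteq> 0 \<and> H = {x. a \<bullet> x = b})"

definition chambers :: "'a::euclidean_space set set \<Rightarrow> 'a set set" where
  "chambers \<A> = components (UNIV - \<Union>\<A>)"

text \<open>
  The open stratum of a flat \<open>\<Inter>\<B>\<close> (with \<open>\<Inter>{}\<close> the whole space) is the flat minus the hyperplanes
  that do not contain it; the faces are the connected components of the open strata. An empty
  intersection has no components, so it contributes nothing.
\<close>

definition faces :: "'a::euclidean_space set set \<Rightarrow> 'a set set" where
  "faces \<A> = (\<Union>\<B>\<in>Pow \<A>. components (\<Inter>\<B> - \<Union>{H\<in>\<A>. \<not> \<Inter>\<B> \<subseteq> H}))"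

text \<open>Larger faces in this order have smaller closures: the chambers are the minimal elements.\<close>

definition face_ge :: "'a::euclidean_space set \<Rightarrow> 'a set \<Rightarrow> bool" where
  "face_ge F G \<longleftrightarrow> closure F \<subseteq> closure G"

definition localization :: "'a::euclidean_space set set \<Rightarrow> 'a set \<Rightarrow> 'a set set" where
  "localization \<A> F = {H\<in>\<A>. affine hull F \<subseteq> H}"

text \<open>\<open>chamber_at \<A> F C\<close> is the chamber written \<open>C\<close> with index \<open>F\<close>.\<close>

definition chamber_at :: "'a::euclidean_space set set \<Rightarrow> 'a set \<Rightarrow> 'a set \<Rightarrow> 'a set" where
  "chamber_at \<A> F C =
     (THE D. D \<in> chambers \<A> \<and> F \<subseteq> closure D \<and>
             (\<exists>K\<in>chambers (localization \<A> F). C \<subseteq> K \<and> D \<subseteq> K))"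

definition separates :: "'a::euclidean_space set \<Rightarrow> 'a set \<Rightarrow> 'a set \<Rightarrow> bool" where
  "separates H C D \<longleftrightarrow> \<not> (\<exists>K\<in>chambers {H}. C \<subseteq> K \<and> D \<subseteq> K)"

definition adjacent :: "'a::euclidean_space set set \<Rightarrow> 'a set \<Rightarrow> 'a set \<Rightarrow> bool" where
  "adjacent \<A> C D \<longleftrightarrow> card {H\<in>\<A>. separates H C D} = 1"


section \<open>The Salvetti complex\<close>

text \<open>A pair in \<open>'a \<times> 'a\<close> consists of the real and the imaginary part of a point of the
  complexification; \<open>w\<close> is the chosen system of points in the faces.\<close>

definition sal_vertex ::
    "'a::euclidean_space set set \<Rightarrow> ('a set \<Rightarrow> 'a) \<Rightarrow> 'a set \<Rightarrow> 'a set \<Rightarrow> 'a \<times> 'a" where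
  "sal_vertex \<A> w F C = (w F, w F - w (chamber_at \<A> F C))"

definition sal_simplices ::
    "'a::euclidean_space set set \<Rightarrow> ('a set \<Rightarrow> 'a) \<Rightarrow> ('a \<times> 'a) set set" where
  "sal_simplices \<A> w =
     {convex hull ((\<lambda>i. sal_vertex \<A> w (F i) (C i)) ` {..k}) | (k::nat) F C.
        (\<forall>i\<le>k. F i \<in> faces \<A> \<and> C i \<in> chambers \<A>) \<and>
        (\<forall>i<k. face_ge (F i) (F (Suc i)) \<and> F i \<noteq> F (Suc i)) \<and>
        (\<forall>i\<le>k. chamber_at \<A> (F i) (C 0) = chamber_at \<A> (F i) (C i))}"

text \<open>The complex is finite, so its polyhedron carries the subspace topology.\<close>

definition Sal :: "'a::euclidean_space set set \<Rightarrow> ('a set \<Rightarrow> 'a) \<Rightarrow> ('a \<times> 'a) set" where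
  "Sal \<A> w = \<Union>(sal_simplices \<A> w)"


section \<open>Oriented systems\<close>

text \<open>
  A path is its beginning together with a list of signed edges, \<open>True\<close> standing for the exponent
  \<open>+1\<close> and \<open>False\<close> for \<open>-1\<close>. The pair \<open>(v, [])\<close> is the constant path at \<open>v\<close>.
\<close>

type_synonym 'v opath = "'v \<times> (('v \<times> 'v) \<times> bool) list"

fun step_src :: "('v \<times> 'v) \<times> bool \<Rightarrow> 'v" where
  "step_src ((a, b), s) = (if s then a else b)"

fun step_tgt :: "('v \<times> 'v) \<times> bool \<Rightarrow> 'v" where
  "step_tgt ((a, b), s) = (if s then b else a)"

definition p_begin :: "'v opath \<Rightarrow> 'v" where
  "p_begin \<alpha> = fst \<alpha>"

definition p_end :: "'v opath \<Rightarrow> 'v" where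
  "p_end \<alpha> = (if snd \<alpha> = [] then fst \<alpha> else step_tgt (last (snd \<alpha>)))"

definition p_comp :: "'v opath \<Rightarrow> 'v opath \<Rightarrow> 'v opath" where
  "p_comp \<alpha> \<beta> = (fst \<alpha>, snd \<alpha> @ snd \<beta>)"

definition p_inv :: "'v opath \<Rightarrow> 'v opath" where
  "p_inv \<alpha> = (p_end \<alpha>, rev (map (\<lambda>(e, s). (e, \<not> s)) (snd \<alpha>)))"

definition p_map :: "('v \<Rightarrow> 'u) \<Rightarrow> 'v opath \<Rightarrow> 'u opath" where
  "p_map f \<alpha> = (f (fst \<alpha>), map (map_prod (map_prod f f) id) (snd \<alpha>))"

definition positive :: "'v opath \<Rightarrow> bool" where
  "positive \<alpha> \<longleftrightarrow> (\<forall>s\<in>set (snd \<alpha>). snd s)"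

definition p_length :: "'v opath \<Rightarrow> nat" where
  "p_length \<alpha> = length (snd \<alpha>)"

definition paths :: "'v set \<Rightarrow> ('v \<times> 'v) set \<Rightarrow> 'v opath set" where
  "paths V E = {(v, ss). v \<in> V \<and> fst ` set ss \<subseteq> E \<and>
     (ss \<noteq> [] \<longrightarrow> step_src (hd ss) = v) \<and>
     (\<forall>i. Suc i < length ss \<longrightarrow> step_tgt (ss ! i) = step_src (ss ! Suc i))}"

record 'v osys =
  verts :: "'v set"
  edges :: "('v \<times> 'v) set"
  prel :: "('v opath \<times> 'v opath) set"

abbreviation os_paths :: "'v osys \<Rightarrow> 'v opath set" where
  "os_paths \<Theta> \<equiv> paths (verts \<Theta>) (edges \<Theta>)"

text \<open>Graphs are required to be connected (as undirected graphs) and nonempty.\<close>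

definition connected_graph :: "'v set \<Rightarrow> ('v \<times> 'v) set \<Rightarrow> bool" where
  "connected_graph V E \<longleftrightarrow> V \<noteq> {} \<and>
     (\<forall>u\<in>V. \<forall>v\<in>V. \<exists>\<alpha>\<in>paths V E. p_begin \<alpha> = u \<and> p_end \<alpha> = v)"

definition oriented_system :: "'v osys \<Rightarrow> bool" where
  "oriented_system \<Theta> \<longleftrightarrow>
     edges \<Theta> \<subseteq> verts \<Theta> \<times> verts \<Theta> \<and>
     connected_graph (verts \<Theta>) (edges \<Theta>) \<and>
     equiv (os_paths \<Theta>) (prel \<Theta>) \<and>
     (\<forall>(\<alpha>, \<beta>)\<in>prel \<Theta>. p_begin \<alpha> = p_begin \<beta> \<and> p_end \<alpha> = p_end \<beta>) \<and>
     (\<forall>\<alpha>\<in>os_paths \<Theta>. (p_comp \<alpha> (p_inv \<alpha>), (p_begin \<alpha>, [])) \<in> prel \<Theta>) \<and>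
     (\<forall>(\<alpha>, \<beta>)\<in>prel \<Theta>. (p_inv \<alpha>, p_inv \<beta>) \<in> prel \<Theta>) \<and>
     (\<forall>(\<alpha>, \<beta>)\<in>prel \<Theta>. \<forall>\<gamma>\<in>os_paths \<Theta>. \<forall>\<delta>\<in>os_paths \<Theta>.
        p_end \<gamma> = p_begin \<alpha> \<and> p_end \<alpha> = p_begin \<delta> \<longrightarrow>
        (p_comp (p_comp \<gamma> \<alpha>) \<delta>, p_comp (p_comp \<gamma> \<beta>) \<delta>) \<in> prel \<Theta>)"

text \<open>The least relation on paths satisfying the axioms of an oriented system and containing
  \<open>B\<close>.\<close>

inductive_set generated_rel ::
    "'v set \<Rightarrow> ('v \<times> 'v) set \<Rightarrow> ('v opath \<times> 'v opath) set \<Rightarrow> ('v opath \<times> 'v opath) set"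
  for V :: "'v set" and E :: "('v \<times> 'v) set" and B :: "('v opath \<times> 'v opath) set" where
  base: "(\<alpha>, \<beta>) \<in> B \<Longrightarrow> (\<alpha>, \<beta>) \<in> generated_rel V E B"
| refl: "\<alpha> \<in> paths V E \<Longrightarrow> (\<alpha>, \<alpha>) \<in> generated_rel V E B"
| sym: "(\<alpha>, \<beta>) \<in> generated_rel V E B \<Longrightarrow> (\<beta>, \<alpha>) \<in> generated_rel V E B"
| trans: "\<lbrakk>(\<alpha>, \<beta>) \<in> generated_rel V E B; (\<beta>, \<gamma>) \<in> generated_rel V E B\<rbrakk>
    \<Longrightarrow> (\<alpha>, \<gamma>) \<in> generated_rel V E B"
| cancel: "\<alpha> \<in> paths V E \<Longrightarrow> (p_comp \<alpha> (p_inv \<alpha>), (p_begin \<alpha>, [])) \<in> generated_rel V E B"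
| inv: "(\<alpha>, \<beta>) \<in> generated_rel V E B \<Longrightarrow> (p_inv \<alpha>, p_inv \<beta>) \<in> generated_rel V E B"
| ctxt: "\<lbrakk>(\<alpha>, \<beta>) \<in> generated_rel V E B; \<gamma> \<in> paths V E; \<delta> \<in> paths V E;
      p_end \<gamma> = p_begin \<alpha>; p_end \<alpha> = p_begin \<delta>\<rbrakk>
    \<Longrightarrow> (p_comp (p_comp \<gamma> \<alpha>) \<delta>, p_comp (p_comp \<gamma> \<beta>) \<delta>) \<in> generated_rel V E B"

definition min_positive_paths :: "'v set \<Rightarrow> ('v \<times> 'v) set \<Rightarrow> 'v \<Rightarrow> 'v \<Rightarrow> 'v opath set" where
  "min_positive_paths V E a b =
     (let P = {\<alpha>\<in>paths V E. positive \<alpha> \<and> p_begin \<alpha> = a \<and> p_end \<alpha> = b}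
      in {\<alpha>\<in>P. \<forall>\<beta>\<in>P. p_length \<alpha> \<le> p_length \<beta>})"

definition chamber_edges :: "'a::euclidean_space set set \<Rightarrow> ('a set \<times> 'a set) set" where
  "chamber_edges \<A> = {(C, D). C \<in> chambers \<A> \<and> D \<in> chambers \<A> \<and> adjacent \<A> C D}"

definition arrangement_system :: "'a::euclidean_space set set \<Rightarrow> 'a set osys" where
  "arrangement_system \<A> =
     \<lparr>verts = chambers \<A>,
      edges = chamber_edges \<A>,
      prel = generated_rel (chambers \<A>) (chamber_edges \<A>)
        (\<Union>C D. min_positive_paths (chambers \<A>) (chamber_edges \<A>) C D \<times>
               min_positive_paths (chambers \<A>) (chamber_edges \<A>) C D)\<rparr>"

definition graph_morphism :: "'v osys \<Rightarrow> 'u osys \<Rightarrow> ('v \<Rightarrow> 'u) \<Rightarrow> bool" where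
  "graph_morphism \<Theta> \<Gamma> \<rho> \<longleftrightarrow>
     \<rho> ` verts \<Theta> \<subseteq> verts \<Gamma> \<and> (\<forall>(u, v)\<in>edges \<Theta>. (\<rho> u, \<rho> v) \<in> edges \<Gamma>)"

definition is_lift :: "'v osys \<Rightarrow> ('v \<Rightarrow> 'u) \<Rightarrow> 'v \<Rightarrow> 'u opath \<Rightarrow> 'v opath \<Rightarrow> bool" where
  "is_lift \<Theta> \<rho> v \<alpha> \<alpha>' \<longleftrightarrow> \<alpha>' \<in> os_paths \<Theta> \<and> p_begin \<alpha>' = v \<and> p_map \<rho> \<alpha>' = \<alpha>"

definition lift :: "'v osys \<Rightarrow> ('v \<Rightarrow> 'u) \<Rightarrow> 'v \<Rightarrow> 'u opath \<Rightarrow> 'v opath" where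
  "lift \<Theta> \<rho> v \<alpha> = (THE \<alpha>'. is_lift \<Theta> \<rho> v \<alpha> \<alpha>')"

definition os_cover :: "'v osys \<Rightarrow> 'u osys \<Rightarrow> ('v \<Rightarrow> 'u) \<Rightarrow> bool" where
  "os_cover \<Theta> \<Gamma> \<rho> \<longleftrightarrow>
     oriented_system \<Theta> \<and> oriented_system \<Gamma> \<and> graph_morphism \<Theta> \<Gamma> \<rho> \<and>
     (\<forall>v\<in>verts \<Theta>. \<forall>\<alpha>\<in>os_paths \<Gamma>. p_begin \<alpha> = \<rho> v \<longrightarrow> (\<exists>!\<alpha>'. is_lift \<Theta> \<rho> v \<alpha> \<alpha>')) \<and>
     (\<forall>v\<in>verts \<Theta>. \<forall>(\<alpha>, \<beta>)\<in>prel \<Gamma>. p_begin \<alpha> = \<rho> v \<and> p_begin \<beta> = \<rho> v \<longrightarrow>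
        (lift \<Theta> \<rho> v \<alpha>, lift \<Theta> \<rho> v \<beta>) \<in> prel \<Theta>)"


section \<open>Simplicial complexes and their realizations\<close>

definition simplex_points :: "'v set \<Rightarrow> ('v \<Rightarrow> real) set" where
  "simplex_points \<sigma> =
     {t. (\<forall>x. 0 \<le> t x) \<and> (\<forall>x. x \<notin> \<sigma> \<longrightarrow> t x = 0) \<and> (\<Sum>x\<in>\<sigma>. t x) = 1}"

text \<open>
  The realization of an abstract complex (given by its nonempty finite simplices) in barycentric
  coordinates, with the weak topology. A subcomplex is realized by a subset.
\<close>

definition realization :: "'v set set \<Rightarrow> ('v \<Rightarrow> real) topology" where
  "realization K = topology (\<lambda>U. U \<subseteq> \<Union>(simplex_points ` K) \<and>
     (\<forall>\<sigma>\<in>K. openin (subtopology (powertop_real UNIV) (simplex_points \<sigma>)) (U \<inter> simplex_points \<sigma>)))"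

lemma openin_realization:
  "openin (realization K) U \<longleftrightarrow> U \<subseteq> \<Union>(simplex_points ` K) \<and>
     (\<forall>\<sigma>\<in>K. openin (subtopology (powertop_real UNIV) (simplex_points \<sigma>)) (U \<inter> simplex_points \<sigma>))"
proof -
  let ?T = "\<lambda>\<sigma>. subtopology (powertop_real UNIV) (simplex_points \<sigma>)"
  let ?P = "\<lambda>U. U \<subseteq> \<Union>(simplex_points ` K) \<and> (\<forall>\<sigma>\<in>K. openin (?T \<sigma>) (U \<inter> simplex_points \<sigma>))"
  have inter: "?P (S \<inter> T)" if S: "?P S" and T: "?P T" for S T
  proof (intro conjI ballI)
    show "S \<inter> T \<subseteq> \<Union>(simplex_points ` K)"
      using S by auto
    fix \<sigma> assume "\<sigma> \<in> K"
    then have "openin (?T \<sigma>) ((S \<inter> simplex_points \<sigma>) \<inter> (T \<inter> simplex_points \<sigma>))"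
      using S T by (intro openin_Int[of _ "S \<inter> simplex_points \<sigma>"]) simp_all
    moreover have "(S \<inter> simplex_points \<sigma>) \<inter> (T \<inter> simplex_points \<sigma>) = S \<inter> T \<inter> simplex_points \<sigma>"
      by auto
    ultimately show "openin (?T \<sigma>) (S \<inter> T \<inter> simplex_points \<sigma>)"
      by simp
  qed
  have union: "?P (\<Union>\<K>)" if \<K>: "\<forall>S\<in>\<K>. ?P S" for \<K>
  proof (intro conjI ballI)
    show "\<Union>\<K> \<subseteq> \<Union>(simplex_points ` K)"
      using \<K> by (intro Union_least) simp
    fix \<sigma> assume "\<sigma> \<in> K"
    then have "openin (?T \<sigma>) (\<Union>((\<lambda>S. S \<inter> simplex_points \<sigma>) ` \<K>))"
      using \<K> by (intro openin_Union) auto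
    moreover have "\<Union>((\<lambda>S. S \<inter> simplex_points \<sigma>) ` \<K>) = \<Union>\<K> \<inter> simplex_points \<sigma>"
      by auto
    ultimately show "openin (?T \<sigma>) (\<Union>\<K> \<inter> simplex_points \<sigma>)"
      by simp
  qed
  have "istopology ?P"
    unfolding istopology_def using inter union by presburger
  then show ?thesis
    unfolding realization_def by (simp only: topology_inverse')
qed

lemma topspace_realization: "topspace (realization K) = \<Union>(simplex_points ` K)"
proof (rule subset_antisym)
  have "openin (realization K) (topspace (realization K))"
    by (rule openin_topspace)
  then show "topspace (realization K) \<subseteq> \<Union>(simplex_points ` K)"
    unfolding openin_realization by (rule conjunct1)
  have "openin (subtopology (powertop_real UNIV) (simplex_points \<sigma>))
      (\<Union>(simplex_points ` K) \<inter> simplex_points \<sigma>)" if "\<sigma> \<in> K" for \<sigma>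
  proof -
    have "\<Union>(simplex_points ` K) \<inter> simplex_points \<sigma> =
        topspace (subtopology (powertop_real UNIV) (simplex_points \<sigma>))"
      using that by auto
    then show ?thesis
      by (simp only: openin_topspace)
  qed
  then have "openin (realization K) (\<Union>(simplex_points ` K))"
    unfolding openin_realization by (intro conjI ballI order_refl)
  then show "\<Union>(simplex_points ` K) \<subseteq> topspace (realization K)"
    by (rule openin_subset)
qed

definition order_complex :: "'p set \<Rightarrow> ('p \<Rightarrow> 'p \<Rightarrow> bool) \<Rightarrow> 'p set set" where
  "order_complex P ge =
     {\<sigma>. \<sigma> \<subseteq> P \<and> finite \<sigma> \<and> \<sigma> \<noteq> {} \<and> (\<forall>x\<in>\<sigma>. \<forall>y\<in>\<sigma>. ge x y \<or> ge y x)}"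

abbreviation \<Delta> :: "'p set \<Rightarrow> ('p \<Rightarrow> 'p \<Rightarrow> bool) \<Rightarrow> ('p \<Rightarrow> real) topology" where
  "\<Delta> P ge \<equiv> realization (order_complex P ge)"

text \<open>The map of realizations induced by a map of vertices.\<close>

definition simplicial_map :: "('v \<Rightarrow> 'u) \<Rightarrow> ('v \<Rightarrow> real) \<Rightarrow> 'u \<Rightarrow> real" where
  "simplicial_map f t = (\<lambda>y. \<Sum>x | t x \<noteq> 0 \<and> f x = y. t x)"


section \<open>Homotopy colimits of diagrams over posets\<close>

definition quotient_topology :: "'x topology \<Rightarrow> ('x \<times> 'x) set \<Rightarrow> 'x set topology" where
  "quotient_topology X R = topology (\<lambda>U. U \<subseteq> topspace X // R \<and> openin X (\<Union>U))"

lemma openin_quotient_topology: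
  assumes "equiv (topspace X) R"
  shows "openin (quotient_topology X R) U \<longleftrightarrow> U \<subseteq> topspace X // R \<and> openin X (\<Union>U)"
proof -
  let ?P = "\<lambda>U. U \<subseteq> topspace X // R \<and> openin X (\<Union>U)"
  have inter: "?P (S \<inter> T)" if S: "?P S" and T: "?P T" for S T
  proof
    show "S \<inter> T \<subseteq> topspace X // R"
      using S by auto
    have "x \<in> \<Union>(S \<inter> T)" if "a \<in> S" "x \<in> a" "b \<in> T" "x \<in> b" for x a b
    proof -
      have "a \<in> topspace X // R" "b \<in> topspace X // R"
        using S T that by auto
      then have "a = b \<or> a \<inter> b = {}"
        by (rule quotient_disj[OF assms])
      then have "a = b"
        using that by auto
      then show ?thesis
        using that by auto
    qed
    then have "\<Union>(S \<inter> T) = \<Union>S \<inter> \<Union>T"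
      by auto
    then show "openin X (\<Union>(S \<inter> T))"
      using S T by (simp add: openin_Int)
  qed
  have union: "?P (\<Union>\<K>)" if \<K>: "\<forall>S\<in>\<K>. ?P S" for \<K>
  proof
    show "\<Union>\<K> \<subseteq> topspace X // R"
      using \<K> by (intro Union_least) simp
    have "openin X (\<Union>(Union ` \<K>))"
      using \<K> by (intro openin_Union) auto
    moreover have "\<Union>(Union ` \<K>) = \<Union>(\<Union>\<K>)"
      by auto
    ultimately show "openin X (\<Union>(\<Union>\<K>))"
      by simp
  qed
  have "istopology ?P"
    unfolding istopology_def using inter union by presburger
  then show ?thesis
    unfolding quotient_topology_def by (simp only: topology_inverse')
qed

lemma equiv_generated: "equiv T ((G \<union> G\<inverse>)\<^sup>* \<inter> T \<times> T)"
proof (rule equivI)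
  show "(G \<union> G\<inverse>)\<^sup>* \<inter> T \<times> T \<subseteq> T \<times> T"
    by (rule Int_lower2)
  show "refl_on T ((G \<union> G\<inverse>)\<^sup>* \<inter> T \<times> T)"
    by (auto simp: refl_on_def)
  have "sym ((G \<union> G\<inverse>)\<^sup>*)"
    by (intro sym_rtrancl sym_Un_converse)
  then show "sym ((G \<union> G\<inverse>)\<^sup>* \<inter> T \<times> T)"
    by (auto simp: sym_def)
  show "trans ((G \<union> G\<inverse>)\<^sup>* \<inter> T \<times> T)"
    by (intro trans_Int trans_rtrancl) (auto simp: trans_def)
qed

text \<open>
  A diagram over a poset \<open>(P, ge)\<close> is given by spaces \<open>D p\<close> and maps \<open>f p q\<close> from \<open>D p\<close> to \<open>D q\<close>
  whenever \<open>p > q\<close>. A point of the disjoint union is \<open>(p, x, t)\<close>.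
\<close>

definition hocolim_sum ::
    "'p set \<Rightarrow> ('p \<Rightarrow> 'p \<Rightarrow> bool) \<Rightarrow> ('p \<Rightarrow> 'x topology) \<Rightarrow> ('p \<times> 'x \<times> ('p \<Rightarrow> real)) topology" where
  "hocolim_sum P ge D = sum_topology (\<lambda>p. prod_topology (D p) (\<Delta> {q\<in>P. ge p q} ge)) P"

definition hocolim_glue ::
    "'p set \<Rightarrow> ('p \<Rightarrow> 'p \<Rightarrow> bool) \<Rightarrow> ('p \<Rightarrow> 'x topology) \<Rightarrow> ('p \<Rightarrow> 'p \<Rightarrow> 'x \<Rightarrow> 'x)
      \<Rightarrow> (('p \<times> 'x \<times> ('p \<Rightarrow> real)) \<times> ('p \<times> 'x \<times> ('p \<Rightarrow> real))) set" where
  "hocolim_glue P ge D f =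
     {((p, x, t), (q, f p q x, t)) | p q x t. p \<in> P \<and> q \<in> P \<and> ge p q \<and> p \<noteq> q \<and>
        x \<in> topspace (D p) \<and> t \<in> topspace (\<Delta> {s\<in>P. ge q s} ge)}"

definition hocolim ::
    "'p set \<Rightarrow> ('p \<Rightarrow> 'p \<Rightarrow> bool) \<Rightarrow> ('p \<Rightarrow> 'x topology) \<Rightarrow> ('p \<Rightarrow> 'p \<Rightarrow> 'x \<Rightarrow> 'x)
      \<Rightarrow> ('p \<times> 'x \<times> ('p \<Rightarrow> real)) set topology" where
  "hocolim P ge D f =
     (let X = hocolim_sum P ge D; G = hocolim_glue P ge D f
      in quotient_topology X ((G \<union> G\<inverse>)\<^sup>* \<inter> topspace X \<times> topspace X))"


section \<open>The diagram and the poset limit of a cover\<close>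

text \<open>
  \<open>transport \<A> \<Theta> \<rho> F v\<close> is the end of the lift at \<open>v\<close> of a positive minimal path from \<open>\<rho> v\<close> to
  \<open>chamber_at \<A> F (\<rho> v)\<close>. For a cover it does not depend on the choice of that path, since any two
  choices are equivalent and so have equivalent lifts.
\<close>

definition transport ::
    "'a::euclidean_space set set \<Rightarrow> 'v osys \<Rightarrow> ('v \<Rightarrow> 'a set) \<Rightarrow> 'a set \<Rightarrow> 'v \<Rightarrow> 'v" where
  "transport \<A> \<Theta> \<rho> F v =
     p_end (lift \<Theta> \<rho> v
       (SOME \<gamma>. \<gamma> \<in> min_positive_paths (chambers \<A>) (chamber_edges \<A>) (\<rho> v) (chamber_at \<A> F (\<rho> v))))"

definition diagram_space :: "'v osys \<Rightarrow> ('v \<Rightarrow> 'a::euclidean_space set) \<Rightarrow> 'a set \<Rightarrow> 'v topology" where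
  "diagram_space \<Theta> \<rho> F = discrete_topology {v\<in>verts \<Theta>. face_ge F (\<rho> v)}"

definition diagram_map ::
    "'a::euclidean_space set set \<Rightarrow> 'v osys \<Rightarrow> ('v \<Rightarrow> 'a set) \<Rightarrow> 'a set \<Rightarrow> 'a set \<Rightarrow> 'v \<Rightarrow> 'v" where
  "diagram_map \<A> \<Theta> \<rho> F\<^sub>1 F\<^sub>2 = transport \<A> \<Theta> \<rho> F\<^sub>2"

definition hocolim_diagram ::
    "'a::euclidean_space set set \<Rightarrow> 'v osys \<Rightarrow> ('v \<Rightarrow> 'a set)
      \<Rightarrow> ('a set \<times> 'v \<times> ('a set \<Rightarrow> real)) set topology" where
  "hocolim_diagram \<A> \<Theta> \<rho> =
     hocolim (faces \<A>) face_ge (diagram_space \<Theta> \<rho>) (diagram_map \<A> \<Theta> \<rho>)"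

definition Plim ::
    "'a::euclidean_space set set \<Rightarrow> 'v osys \<Rightarrow> ('v \<Rightarrow> 'a set) \<Rightarrow> ('a set \<times> 'v) set" where
  "Plim \<A> \<Theta> \<rho> = {(F, v). F \<in> faces \<A> \<and> v \<in> topspace (diagram_space \<Theta> \<rho> F)}"

definition Plim_ge ::
    "'a::euclidean_space set set \<Rightarrow> 'v osys \<Rightarrow> ('v \<Rightarrow> 'a set)
      \<Rightarrow> 'a set \<times> 'v \<Rightarrow> 'a set \<times> 'v \<Rightarrow> bool" where
  "Plim_ge \<A> \<Theta> \<rho> = (\<lambda>(F\<^sub>1, v\<^sub>1) (F\<^sub>2, v\<^sub>2). face_ge F\<^sub>1 F\<^sub>2 \<and> v\<^sub>2 = transport \<A> \<Theta> \<rho> F\<^sub>2 v\<^sub>1)"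

definition W_cover ::
    "'a::euclidean_space set set \<Rightarrow> 'v osys \<Rightarrow> ('v \<Rightarrow> 'a set) \<Rightarrow> ('a set \<times> 'v \<Rightarrow> real) topology" where
  "W_cover \<A> \<Theta> \<rho> = \<Delta> (Plim \<A> \<Theta> \<rho>) (Plim_ge \<A> \<Theta> \<rho>)"

definition \<Lambda>_map ::
    "('v \<Rightarrow> 'a set) \<Rightarrow> ('a::euclidean_space set \<times> 'v \<Rightarrow> real) \<Rightarrow> 'a set \<times> 'a set \<Rightarrow> real" where
  "\<Lambda>_map \<rho> = simplicial_map (\<lambda>(F, v). (F, \<rho> v))"

text \<open>
  The identification of \<open>W\<close>, that is \<open>W_cover \<A> (arrangement_system \<A>) id\<close>, with \<open>Sal \<A> w\<close>: the
  affine extension of \<open>(F, C) \<mapsto> sal_vertex \<A> w F C\<close>.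
\<close>

definition W_to_Sal ::
    "'a::euclidean_space set set \<Rightarrow> ('a set \<Rightarrow> 'a) \<Rightarrow> ('a set \<times> 'a set \<Rightarrow> real) \<Rightarrow> 'a \<times> 'a" where
  "W_to_Sal \<A> w t = (\<Sum>x | t x \<noteq> 0. t x *\<^sub>R sal_vertex \<A> w (fst x) (snd x))"

definition isomorphic_over :: "'x topology \<Rightarrow> ('x \<Rightarrow> 'b) \<Rightarrow> 'y topology \<Rightarrow> ('y \<Rightarrow> 'b) \<Rightarrow> bool" where
  "isomorphic_over X p Y q \<longleftrightarrow>
     (\<exists>h. homeomorphic_map X Y h \<and> (\<forall>x\<in>topspace X. q (h x) = p x))"

end

theory Submission
  imports Defs
begin

text \<open>
  The vertices of the cover are the points of \<open>S'\<close> over the vertices \<open>w(C, C)\<close>, \<open>C\<close> a chamber, and an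
  edge is the lift of the edge path \<open>C, (G, C), D\<close> through the common facet \<open>G\<close> of two adjacent chambers.
  For a fixed chamber \<open>C\<close> the elements \<open>(F, C\<^sub>F)\<close> form a copy of the face poset inside the poset of
  vertices of the Salvetti complex. The face poset is simply connected, so a point of \<open>S'\<close> over \<open>w(C, C)\<close>
  extends to a parallel family of points over all \<open>w(F, C\<^sub>F)\<close>. A minimal positive path starting at \<open>C\<close> only
  crosses hyperplanes that still have \<open>C\<close> on the side of departure, so its lift stays in this family; hence
  the end of the lift depends only on the end of the path. This yields the cover of oriented systems and
  identifies the poset limit with the poset of points of \<open>S'\<close> over vertices. Lifting simplices through
  these points triangulates \<open>S'\<close>. Finally, a chain in the poset limit is determined by its top element and
  its image in the face poset, which makes the homotopy colimit homeomorphic to the order complex.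
\<close>

section \<open>Sections of coverings over convex sets\<close>

text \<open>\<open>Sal\<close> is defined as a union of convex hulls, and nothing in that definition
  says that two simplices meet in a common face. Points of the complex have to determine their
  carriers and barycentric coordinates before \<open>S'\<close> can be compared with an abstract
  complex; this is derived from the signs of the real and imaginary parts of a point. A second
  obstacle is topological. \<open>S'\<close> has its own topology, while the order complex upstairs
  has the weak topology and may have infinitely many simplices. Continuity of the comparison map can
  be tested on single simplices, but openness cannot; it rests on the finiteness of the complex
  downstairs and on the local inverses of \<open>r\<close>. The copy of the face poset depends on
  the chamber \<open>C\<close>, so no single local system governs the whole cover: transport from a
  vertex uses the copy of its own chamber. Orientation decides which copy an edge belongs to. The
  vertex \<open>(G, C)\<close> on the edge from \<open>C\<close> to \<open>D\<close> lies in the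
  copy of a base chamber exactly when that chamber is on the side of \<open>C\<close>.\<close>

definition is_section :: "'s::topological_space set \<Rightarrow> ('s \<Rightarrow> 'b::topological_space) \<Rightarrow> 'b set \<Rightarrow> ('b \<Rightarrow> 's) \<Rightarrow> bool" where
  "is_section S' r K g \<longleftrightarrow> continuous_on K g \<and> g ` K \<subseteq> S' \<and> (\<forall>x\<in>K. r (g x) = x)"

lemma is_section_subset: "is_section S' r K g \<Longrightarrow> L \<subseteq> K \<Longrightarrow> is_section S' r L g"
  unfolding is_section_def by (meson continuous_on_subset image_mono order_trans subsetD)

lemma is_section_in: "is_section S' r K g \<Longrightarrow> x \<in> K \<Longrightarrow> g x \<in> S'"
  unfolding is_section_def by blast

lemma is_section_inv: "is_section S' r K g \<Longrightarrow> x \<in> K \<Longrightarrow> r (g x) = x"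
  unfolding is_section_def by blast

text \<open>Agreement of two sections is locally constant: near a point both values stay in fixed
  sheets, and these are either the same sheet, where \<open>r\<close> is injective, or disjoint.
  Connectedness of \<open>K\<close> does the rest.\<close>

lemma section_unique:
  assumes cov: "covering_space S' r B"
    and g1: "is_section S' r K g1" and g2: "is_section S' r K g2"
    and "connected K" "a \<in> K" "g1 a = g2 a" "x \<in> K"
  shows "g1 x = g2 x"
proof -
  have "K \<subseteq> B"
    using g1 covering_space_imp_surjective[OF cov] unfolding is_section_def by (metis image_eqI image_subset_iff subsetI)
  have loc: "\<exists>N. openin (top_of_set K) N \<and> y \<in> N \<and> (\<forall>z\<in>N. (g1 z = g2 z) = (g1 y = g2 y))"
    if "y \<in> K" for y
  proof -
    have "y \<in> B" using that \<open>K \<subseteq> B\<close> by auto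
    then obtain T v where T: "y \<in> T" "\<Union>v = S' \<inter> r -` T" "\<forall>u\<in>v. openin (top_of_set S') u"
      "pairwise disjnt v" "\<forall>u\<in>v. \<exists>q. homeomorphism u T r q"
      using cov unfolding covering_space_def by meson
    have "g1 y \<in> \<Union>v" "g2 y \<in> \<Union>v"
      using that g1 g2 T(1,2) unfolding is_section_def by auto
    then obtain u1 u2 where u: "u1 \<in> v" "g1 y \<in> u1" "u2 \<in> v" "g2 y \<in> u2" by auto
    define N where "N = (K \<inter> g1 -` u1) \<inter> (K \<inter> g2 -` u2)"
    have "openin (top_of_set K) (K \<inter> g1 -` u1)" "openin (top_of_set K) (K \<inter> g2 -` u2)"
      using g1 g2 T(3) u unfolding is_section_def
      by (meson continuous_openin_preimage image_subset_iff_funcset)+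
    then have op: "openin (top_of_set K) N" unfolding N_def by (rule openin_Int)
    have "y \<in> N" using that u unfolding N_def by auto
    moreover have "(g1 z = g2 z) = (g1 y = g2 y)" if "z \<in> N" for z
    proof (cases "u1 = u2")
      case True
      have eq: "g1 z' = g2 z'" if "z' \<in> N" for z'
      proof -
        have "g1 z' \<in> u1" "g2 z' \<in> u1" "r (g1 z') = r (g2 z')"
          using that True g1 g2 unfolding N_def is_section_def by auto
        moreover obtain q where "homeomorphism u1 T r q" using T(5) u by auto
        ultimately show ?thesis by (metis homeomorphism_apply1)
      qed
      show ?thesis using eq[OF that] eq[OF \<open>y \<in> N\<close>] by simp
    next
      case False
      then have "disjnt u1 u2" using T(4) u by (auto simp: pairwise_def)
      then show ?thesis using that u unfolding N_def disjnt_def by auto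
    qed
    ultimately show ?thesis using op by blast
  qed
  have "(g1 x = g2 x) = (g1 a = g2 a)"
    using connected_induction_simple[OF \<open>connected K\<close> \<open>a \<in> K\<close> \<open>x \<in> K\<close>, of "\<lambda>x. g1 x = g2 x"] loc
      \<open>g1 a = g2 a\<close> by (metis (full_types))
  then show ?thesis using assms by simp
qed

text \<open>The two parts of \<open>L\<close> meet in a convex, hence connected, set, so sections
  that agree at one of its points agree on all of it and can be pasted along closed sets. If the
  parts do not meet, the intermediate value theorem puts \<open>L\<close> inside one of
  them.\<close>

lemma section_extend_glue:
  fixes L :: "'b::euclidean_space set"
  assumes cov: "covering_space S' r B"
    and "convex L"
    and P1: "\<And>s. s \<in> S' \<Longrightarrow> r s \<in> L \<inter> {x. x \<bullet> i \<le> c} \<Longrightarrow> \<exists>g. is_section S' r (L \<inter> {x. x \<bullet> i \<le> c}) g \<and> g (r s) = s"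
    and P2: "\<And>s. s \<in> S' \<Longrightarrow> r s \<in> L \<inter> {x. x \<bullet> i \<ge> c} \<Longrightarrow> \<exists>g. is_section S' r (L \<inter> {x. x \<bullet> i \<ge> c}) g \<and> g (r s) = s"
    and s: "s \<in> S'" "r s \<in> L"
  shows "\<exists>g. is_section S' r L g \<and> g (r s) = s"
proof -
  let ?L1 = "L \<inter> {x. x \<bullet> i \<le> c}" and ?L2 = "L \<inter> {x. x \<bullet> i \<ge> c}"
  have cl1: "closedin (top_of_set L) ?L1" and cl2: "closedin (top_of_set L) ?L2"
    by (auto intro!: closedin_closed_Int closed_halfspace_component_le closed_halfspace_component_ge
        simp: inner_commute[of _ i] closed_halfspace_le closed_halfspace_ge)
  have conv: "convex (?L1 \<inter> ?L2)"
    using \<open>convex L\<close> convex_halfspace_le[of i c] convex_halfspace_ge[of c i]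
    by (simp add: convex_Int inner_commute[of _ i])
  have un: "?L1 \<union> ?L2 = L" by auto
  have glue: "is_section S' r L (\<lambda>x. if x \<in> ?L1 then g1 x else g2 x)"
    if g: "is_section S' r ?L1 g1" "is_section S' r ?L2 g2" "z \<in> ?L1 \<inter> ?L2" "g1 z = g2 z" for g1 g2 z
  proof -
    have "g1 x = g2 x" if "x \<in> ?L1 \<inter> ?L2" for x
      using section_unique[OF cov _ _ convex_connected[OF conv], of g1 g2 z x] g that
        is_section_subset[OF g(1), of "?L1 \<inter> ?L2"] is_section_subset[OF g(2), of "?L1 \<inter> ?L2"] by blast
    moreover have "closedin (top_of_set (?L1 \<union> ?L2)) ?L1" "closedin (top_of_set (?L1 \<union> ?L2)) ?L2"
      by (simp_all only: un cl1 cl2)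
    ultimately have "continuous_on (?L1 \<union> ?L2) (\<lambda>x. if x \<in> ?L1 then g1 x else g2 x)"
      using g(1,2) unfolding is_section_def
      by (intro continuous_on_cases_local) blast+
    then show ?thesis using g(1,2) unfolding un is_section_def by auto
  qed
  show ?thesis
  proof (cases "?L1 \<inter> ?L2 = {}")
    case True
    have "L = ?L1 \<or> L = ?L2"
    proof (rule ccontr)
      assume "\<not> ?thesis"
      then obtain x y where xy: "x \<in> L" "y \<in> L" "i \<bullet> x < c" "c < i \<bullet> y"
        by (force simp: inner_commute[of _ i])
      then have "\<exists>z\<in>L. i \<bullet> z = c"
        using connected_ivt_hyperplane[OF convex_connected[OF \<open>convex L\<close>] xy(1,2), of i c] by auto
      then show False using True by (auto simp: inner_commute[of _ i])
    qed
    then show ?thesis using P1[OF s(1)] P2[OF s(1)] s(2) by metis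
  next
    case False
    then obtain z where z: "z \<in> ?L1 \<inter> ?L2" by auto
    consider "r s \<in> ?L1" | "r s \<in> ?L2" using s(2) un by auto
    then show ?thesis
    proof cases
      case 1
      then obtain g1 where g1: "is_section S' r ?L1 g1" "g1 (r s) = s" using P1 s by blast
      have "g1 z \<in> S'" "r (g1 z) = z" using g1(1) z unfolding is_section_def by blast+
      then obtain g2 where g2: "is_section S' r ?L2 g2" "g2 z = g1 z" using P2[of "g1 z"] z by auto
      have "is_section S' r L (\<lambda>x. if x \<in> ?L1 then g1 x else g2 x)"
        by (rule glue[OF g1(1) g2(1) z g2(2)[symmetric]])
      moreover have "(if r s \<in> ?L1 then g1 (r s) else g2 (r s)) = s" using 1 g1(2) by (simp only: if_True)
      ultimately show ?thesis by blast
    next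
      case 2
      then obtain g2 where g2: "is_section S' r ?L2 g2" "g2 (r s) = s" using P2 s by blast
      have "g2 z \<in> S'" "r (g2 z) = z" using g2(1) z unfolding is_section_def by blast+
      then obtain g1 where g1: "is_section S' r ?L1 g1" "g1 z = g2 z" using P1[of "g2 z"] z by auto
      have *: "g1 x = g2 x" if "x \<in> ?L1 \<inter> ?L2" for x
        using section_unique[OF cov _ _ convex_connected[OF conv], of g1 g2 z x] g1 g2 z that
          is_section_subset[OF g1(1), of "?L1 \<inter> ?L2"] is_section_subset[OF g2(1), of "?L1 \<inter> ?L2"] by blast
      have "is_section S' r L (\<lambda>x. if x \<in> ?L1 then g1 x else g2 x)"
        by (rule glue[OF g1(1) g2(1) z g1(2)])
      moreover have "(if r s \<in> ?L1 then g1 (r s) else g2 (r s)) = s"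
        using 2 g2(2) *[of "r s"] by (cases "r s \<in> ?L1") (simp_all only: if_True if_False Int_iff simp_thms)
      ultimately show ?thesis by blast
    qed
  qed
qed

text \<open>A box around \<open>K\<close> is cut by coordinate hyperplanes until each piece of
  \<open>K\<close> is smaller than the Lebesgue number of a cover by evenly covered sets; the
  sections over the pieces are then glued back. The starting point \<open>s\<close> is kept
  arbitrary in the induction because gluing restarts the second part at a new point.\<close>

lemma section_exists:
  fixes K :: "'b::euclidean_space set"
  assumes cov: "covering_space S' r B" and "K \<subseteq> B" and "compact K" and "convex K"
    and s: "s \<in> S'" "r s \<in> K"
  shows "\<exists>g. is_section S' r K g \<and> g (r s) = s"
proof -
  define ev where "ev T \<longleftrightarrow> openin (top_of_set B) T \<and> (\<exists>v. \<Union>v = S' \<inter> r -` T \<and> (\<forall>u\<in>v. \<exists>q. homeomorphism u T r q))" for T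
  have ev: "\<exists>g. is_section S' r T g \<and> g (r s) = s" if T: "ev T" "s \<in> S'" "r s \<in> T" for T s
  proof -
    obtain v where v: "\<Union>v = S' \<inter> r -` T" "\<forall>u\<in>v. \<exists>q. homeomorphism u T r q"
      using T unfolding ev_def by blast
    then obtain u where u: "u \<in> v" "s \<in> u" using T by blast
    then obtain q where q: "homeomorphism u T r q" using v by blast
    have "u \<subseteq> S'" using u v by blast
    then have "is_section S' r T q" using q unfolding is_section_def homeomorphism_def by auto
    moreover have "q (r s) = s" using q u by (meson homeomorphism_apply1)
    ultimately show ?thesis by blast
  qed
  have "\<exists>T. ev T \<and> x \<in> T" if "x \<in> K" for x
    using cov \<open>K \<subseteq> B\<close> that unfolding covering_space_def ev_def by (meson subsetD)
  then have "\<forall>x\<in>K. \<exists>O'. open O' \<and> x \<in> O' \<and> ev (B \<inter> O')"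
    unfolding ev_def openin_open by (metis IntE)
  from bchoice[OF this] obtain Op where Op: "\<forall>x\<in>K. open (Op x) \<and> x \<in> Op x \<and> ev (B \<inter> Op x)"
    by blast
  have "Op ` K \<noteq> {}" "K \<subseteq> \<Union>(Op ` K)" "\<And>O'. O' \<in> Op ` K \<Longrightarrow> open O'"
    using s(2) Op by auto
  then obtain \<delta> where \<delta>: "\<delta> > 0" "\<And>T. T \<subseteq> K \<Longrightarrow> diameter T < \<delta> \<Longrightarrow> \<exists>O'\<in>Op ` K. T \<subseteq> O'"
    using Lebesgue_number_lemma[OF \<open>compact K\<close>, of "Op ` K"] by metis
  \<comment> \<open>A set inside a box with all sides at most \<open>\<eta>\<close> has diameter at
    most \<open>DIM('b) * \<eta> = \<delta> / 2\<close> by the l1 bound, which stays strictly below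
    \<open>\<delta>\<close>.\<close>
  define \<eta> where "\<eta> = \<delta> / (2 * DIM('b))"
  have "\<eta> > 0" using \<delta>(1) unfolding \<eta>_def by simp
  (* Slicing off a slab of thickness eta from a side longer than eta decreases this measure. *)
  define m where "m a b = (\<Sum>i\<in>Basis. nat \<lceil>((b::'b) \<bullet> i - a \<bullet> i) / \<eta>\<rceil>)" for a b
  have ex: "\<exists>g. is_section S' r L g \<and> g (r s) = s"
    if "convex L" "L \<subseteq> K" "L \<subseteq> cbox a b" "s \<in> S'" "r s \<in> L" for L a b s
    using that
  proof (induction "m a b" arbitrary: L a b s rule: less_induct)
    case less
    have ne: "r s \<in> cbox a b" using less.prems by auto
    show ?case
    proof (cases "\<exists>i\<in>Basis. b \<bullet> i - a \<bullet> i > \<eta>")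
      case False
      have "dist x y \<le> \<delta> / 2" if "x \<in> L" "y \<in> L" for x y
      proof -
        have "dist x y \<le> (\<Sum>i\<in>Basis. \<bar>(x - y) \<bullet> i\<bar>)"
          unfolding dist_norm by (rule norm_le_l1)
        also have "\<dots> \<le> (\<Sum>i\<in>(Basis::'b set). \<eta>)"
        proof (rule sum_mono)
          fix i :: 'b assume i: "i \<in> Basis"
          have "x \<in> cbox a b" "y \<in> cbox a b" using that less.prems by auto
          then have "a \<bullet> i \<le> x \<bullet> i" "x \<bullet> i \<le> b \<bullet> i" "a \<bullet> i \<le> y \<bullet> i" "y \<bullet> i \<le> b \<bullet> i"
            using i by (auto simp: mem_box)
          moreover have "b \<bullet> i - a \<bullet> i \<le> \<eta>" using False i by force
          ultimately show "\<bar>(x - y) \<bullet> i\<bar> \<le> \<eta>" by (simp add: inner_diff_left)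
        qed
        also have "\<dots> = \<delta> / 2" by (simp add: \<eta>_def)
        finally show ?thesis .
      qed
      then have "diameter L \<le> \<delta> / 2" using less.prems(5) \<delta>(1) by (intro diameter_le) (auto simp: dist_norm)
      then have "diameter L < \<delta>" using \<delta>(1) by linarith
      then obtain x where x: "x \<in> K" "L \<subseteq> Op x" using \<delta>(2)[OF less.prems(2)] by blast
      then have "r s \<in> B \<inter> Op x" "L \<subseteq> B \<inter> Op x" using less.prems \<open>K \<subseteq> B\<close> by auto
      then obtain g where "is_section S' r (B \<inter> Op x) g" "g (r s) = s"
        using ev[of "B \<inter> Op x" s] bspec[OF Op x(1)] less.prems(4) by blast
      then show ?thesis using is_section_subset \<open>L \<subseteq> B \<inter> Op x\<close> by blast
    next
      case True
      then obtain i where i: "i \<in> Basis" "b \<bullet> i - a \<bullet> i > \<eta>" by auto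
      define c where "c = a \<bullet> i + \<eta>"
      define b' where "b' = b + (c - b \<bullet> i) *\<^sub>R i"
      define a' where "a' = a + (c - a \<bullet> i) *\<^sub>R i"
      have b': "b' \<bullet> j = (if j = i then c else b \<bullet> j)" if "j \<in> Basis" for j
        using that i unfolding b'_def by (auto simp: inner_add_left inner_Basis)
      have a': "a' \<bullet> j = (if j = i then c else a \<bullet> j)" if "j \<in> Basis" for j
        using that i unfolding a'_def by (auto simp: inner_add_left inner_Basis)
      \<comment> \<open>In direction \<open>i\<close> the old box contributes at least 2. The slab
        contributes exactly 1 and the rest exactly one less than before, so both measures
        drop.\<close>
      have "1 < (b \<bullet> i - a \<bullet> i) / \<eta>" using i \<open>\<eta> > 0\<close> by (simp add: field_simps)
      then have two: "2 \<le> \<lceil>(b \<bullet> i - a \<bullet> i) / \<eta>\<rceil>" by linarith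
      have "(c - a \<bullet> i) / \<eta> = 1" using \<open>\<eta> > 0\<close> unfolding c_def by simp
      then have m1: "m a b' < m a b"
        unfolding m_def using i two
        by (intro sum_strict_mono_ex1) (auto simp: b' real_nat_ceiling_ge intro!: bexI[of _ i])
      have e2: "(b \<bullet> i - c) / \<eta> = (b \<bullet> i - a \<bullet> i) / \<eta> - 1" using \<open>\<eta> > 0\<close> unfolding c_def by (simp add: field_simps)
      have m2: "m a' b < m a b"
        unfolding m_def using i two
        by (intro sum_strict_mono_ex1) (auto simp: a' e2 real_nat_ceiling_ge intro!: bexI[of _ i] order_trans[OF _ le_of_int_ceiling])
      have L1: "L \<inter> {x. x \<bullet> i \<le> c} \<subseteq> cbox a b'"
        using less.prems(3) by (auto simp: mem_box b' subset_iff)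
      have L2: "L \<inter> {x. x \<bullet> i \<ge> c} \<subseteq> cbox a' b"
        using less.prems(3) by (auto simp: mem_box a' subset_iff)
      have c1: "convex (L \<inter> {x. x \<bullet> i \<le> c})" and c2: "convex (L \<inter> {x. x \<bullet> i \<ge> c})"
        using less.prems(1) convex_halfspace_le[of i c] convex_halfspace_ge[of c i]
        by (simp_all add: convex_Int inner_commute[of _ i])
      show ?thesis
      proof (rule section_extend_glue[OF cov less.prems(1), of i c])
        fix s assume "s \<in> S'" "r s \<in> L \<inter> {x. x \<bullet> i \<le> c}"
        then show "\<exists>g. is_section S' r (L \<inter> {x. x \<bullet> i \<le> c}) g \<and> g (r s) = s"
          using less.prems(2) by (intro less.hyps[OF m1 c1 _ L1]) blast+
      next
        fix s assume "s \<in> S'" "r s \<in> L \<inter> {x. x \<bullet> i \<ge> c}"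
        then show "\<exists>g. is_section S' r (L \<inter> {x. x \<bullet> i \<ge> c}) g \<and> g (r s) = s"
          using less.prems(2) by (intro less.hyps[OF m2 c2 _ L2]) blast+
      qed (use less.prems in auto)
    qed
  qed
  obtain a where "K \<subseteq> cbox (-a) a"
    using bounded_subset_cbox_symmetric[OF compact_imp_bounded[OF \<open>compact K\<close>]] .
  then show ?thesis using ex[OF \<open>convex K\<close> order_refl _ s] by blast
qed

section \<open>Lifting a polyhedron along a covering\<close>

lemma powertop_real_euclidean: "powertop_real UNIV = (euclidean :: ('a \<Rightarrow> real) topology)"
  using euclidean_product_topology by metis

lemma simplex_points_outside: "t \<in> simplex_points \<sigma> \<Longrightarrow> x \<notin> \<sigma> \<Longrightarrow> t x = 0"
  unfolding simplex_points_def by blast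

lemma simplex_points_carrier:
  assumes "t \<in> simplex_points \<sigma>" "finite \<sigma>"
  shows "{x. t x \<noteq> 0} \<subseteq> \<sigma>" "{x. t x \<noteq> 0} \<noteq> {}" "t \<in> simplex_points {x. t x \<noteq> 0}"
proof -
  show *: "{x. t x \<noteq> 0} \<subseteq> \<sigma>" using assms unfolding simplex_points_def by auto
  have "sum t {x. t x \<noteq> 0} = sum t \<sigma>"
    using assms * by (intro sum.mono_neutral_left) auto
  then show "t \<in> simplex_points {x. t x \<noteq> 0}" "{x. t x \<noteq> 0} \<noteq> {}"
    using assms unfolding simplex_points_def by (auto simp del: Collect_empty_eq)
qed

lemma vertex_in_simplex_points:
  assumes "finite \<sigma>" "a \<in> \<sigma>"
  shows "(\<lambda>x. if x = a then 1 else 0) \<in> simplex_points \<sigma>"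
  using assms unfolding simplex_points_def by auto

lemma continuous_on_apply: "continuous_on S (\<lambda>t. t x)"
  by (rule continuous_on_subset[OF continuous_on_product_coordinates]) simp

text \<open>A closed subset of a Tychonoff cube: nonnegative coordinates with sum 1 are at most 1,
  and the coordinates outside \<open>\<sigma>\<close> are forced to vanish.\<close>

lemma compact_simplex_points:
  assumes "finite \<sigma>"
  shows "compact (simplex_points \<sigma>)"
proof -
  have "compactin (powertop_real UNIV) (PiE UNIV (\<lambda>x::'a. {0..1::real}))"
    by (simp add: compactin_PiE)
  then have c: "compact (PiE UNIV (\<lambda>x::'a. {0..1::real}))"
    by (simp add: powertop_real_euclidean)
  have "simplex_points \<sigma> = (PiE UNIV (\<lambda>x::'a. {0..1::real})) \<inter>
     ((\<Inter>x\<in>-\<sigma>. {t. t x = 0}) \<inter> {t. (\<Sum>x\<in>\<sigma>. t x) = 1})"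
    (is "_ = ?R")
  proof (intro set_eqI iffI)
    fix t assume t: "t \<in> simplex_points \<sigma>"
    have "t x \<le> 1" for x
      using t assms sum_nonneg_leq_bound[of \<sigma> t 1 x] by (cases "x \<in> \<sigma>") (auto simp: simplex_points_def)
    then show "t \<in> ?R" using t unfolding simplex_points_def by auto
  next
    fix t assume "t \<in> ?R"
    then show "t \<in> simplex_points \<sigma>" unfolding simplex_points_def by (auto simp: PiE_iff)
  qed
  moreover have "closed {t :: 'a \<Rightarrow> real. t x = 0}" for x
    using closed_Collect_eq[of "\<lambda>t. t x" "\<lambda>_. 0"] by (simp add: continuous_on_apply)
  moreover have "closed {t :: 'a \<Rightarrow> real. (\<Sum>x\<in>\<sigma>. t x) = 1}"
    using closed_Collect_eq[of "\<lambda>t. \<Sum>x\<in>\<sigma>. t x" "\<lambda>_. 1"]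
      continuous_on_sum[of \<sigma> UNIV "\<lambda>x t. t x"] continuous_on_apply continuous_on_const by simp
  ultimately show ?thesis using c by (simp add: compact_Int_closed closed_Int closed_INT)
qed

text \<open>The image is convex and contains every \<open>f a\<close> as the value at a vertex, so
  minimality of the hull gives the inclusion that is not a plain convex combination.\<close>

lemma simplex_points_combination:
  fixes f :: "'a \<Rightarrow> 'b::real_vector"
  assumes "finite \<sigma>"
  shows "(\<lambda>t. \<Sum>x\<in>\<sigma>. t x *\<^sub>R f x) ` simplex_points \<sigma> = convex hull (f ` \<sigma>)"
proof
  show "(\<lambda>t. \<Sum>x\<in>\<sigma>. t x *\<^sub>R f x) ` simplex_points \<sigma> \<subseteq> convex hull (f ` \<sigma>)"
  proof clarify
    fix t assume "t \<in> simplex_points \<sigma>"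
    then show "(\<Sum>x\<in>\<sigma>. t x *\<^sub>R f x) \<in> convex hull (f ` \<sigma>)"
      unfolding simplex_points_def using assms by (intro convex_sum) (auto intro: hull_inc)
  qed
  show "convex hull (f ` \<sigma>) \<subseteq> (\<lambda>t. \<Sum>x\<in>\<sigma>. t x *\<^sub>R f x) ` simplex_points \<sigma>"
  proof (rule hull_minimal)
    show "f ` \<sigma> \<subseteq> (\<lambda>t. \<Sum>x\<in>\<sigma>. t x *\<^sub>R f x) ` simplex_points \<sigma>"
    proof clarify
      fix a assume "a \<in> \<sigma>"
      have "(\<Sum>x\<in>\<sigma>. (if x = a then 1 else 0) *\<^sub>R f x) = (\<Sum>x\<in>\<sigma>. if x = a then f x else 0)"
        by (intro sum.cong) auto
      also have "\<dots> = f a" using \<open>a \<in> \<sigma>\<close> assms by simp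
      finally show "f a \<in> (\<lambda>t. \<Sum>x\<in>\<sigma>. t x *\<^sub>R f x) ` simplex_points \<sigma>"
        by (intro image_eqI[OF _ vertex_in_simplex_points[OF assms \<open>a \<in> \<sigma>\<close>]]) simp
    qed
    show "convex ((\<lambda>t. \<Sum>x\<in>\<sigma>. t x *\<^sub>R f x) ` simplex_points \<sigma>)"
    proof (rule convexI, clarify)
      fix u v :: real and s t assume uv: "0 \<le> u" "0 \<le> v" "u + v = 1"
        and st: "s \<in> simplex_points \<sigma>" "t \<in> simplex_points \<sigma>"
      have "(\<lambda>x. u * s x + v * t x) \<in> simplex_points \<sigma>"
        using uv st unfolding simplex_points_def
        by (auto simp: sum.distrib simp flip: sum_distrib_left)
      moreover have "u *\<^sub>R (\<Sum>x\<in>\<sigma>. s x *\<^sub>R f x) + v *\<^sub>R (\<Sum>x\<in>\<sigma>. t x *\<^sub>R f x) = (\<Sum>x\<in>\<sigma>. (u * s x + v * t x) *\<^sub>R f x)"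
        by (simp add: scaleR_sum_right sum.distrib scaleR_add_left)
      ultimately show "u *\<^sub>R (\<Sum>x\<in>\<sigma>. s x *\<^sub>R f x) + v *\<^sub>R (\<Sum>x\<in>\<sigma>. t x *\<^sub>R f x)
          \<in> (\<lambda>t. \<Sum>x\<in>\<sigma>. t x *\<^sub>R f x) ` simplex_points \<sigma>"
        by (intro image_eqI)
    qed
  qed
qed

lemma openin_realization_iff:
  "openin (realization K) U \<longleftrightarrow> U \<subseteq> \<Union>(simplex_points ` K) \<and>
     (\<forall>\<sigma>\<in>K. openin (top_of_set (simplex_points \<sigma>)) (U \<inter> simplex_points \<sigma>))"
  unfolding openin_realization powertop_real_euclidean ..

text \<open>The universal property of the weak topology.\<close>

lemma continuous_map_realization:
  assumes "\<And>\<sigma>. \<sigma> \<in> K \<Longrightarrow> continuous_map (top_of_set (simplex_points \<sigma>)) Y f"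
  shows "continuous_map (realization K) Y f"
  unfolding continuous_map
proof (intro conjI allI impI)
  show "f ` topspace (realization K) \<subseteq> topspace Y"
    unfolding topspace_realization using assms continuous_map_image_subset_topspace by fastforce
  fix U assume U: "openin Y U"
  show "openin (realization K) {x \<in> topspace (realization K). f x \<in> U}"
    unfolding openin_realization_iff topspace_realization
  proof (intro conjI ballI)
    fix \<sigma> assume \<sigma>: "\<sigma> \<in> K"
    have "{x \<in> \<Union>(simplex_points ` K). f x \<in> U} \<inter> simplex_points \<sigma> = {x \<in> simplex_points \<sigma>. f x \<in> U}"
      using \<sigma> by auto
    then show "openin (top_of_set (simplex_points \<sigma>)) ({x \<in> \<Union>(simplex_points ` K). f x \<in> U} \<inter> simplex_points \<sigma>)"
      using openin_continuous_map_preimage[OF assms[OF \<sigma>] U] by simp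
  qed auto
qed

text \<open>A triangulated covering in the abstract: \<open>vt\<close> embeds the complex
  \<open>K\<close> as \<open>B\<close>, and \<open>L\<close> is a complex whose simplices correspond
  to the sections of \<open>r\<close> over simplices of \<open>K\<close>, with \<open>pt\<close>
  recording the values of such a section at the vertices. Finiteness is asked of \<open>K\<close>
  alone; \<open>L\<close> grows with the fibres of \<open>r\<close>.\<close>

locale lifted_complex =
  fixes S' :: "'s::topological_space set" and r :: "'s \<Rightarrow> 'b::euclidean_space" and B :: "'b set"
    and K :: "'p set set" and vt :: "'p \<Rightarrow> 'b"
    and L :: "'e set set" and pr :: "'e \<Rightarrow> 'p" and pt :: "'e \<Rightarrow> 's"
  assumes covering: "covering_space S' r B"
    and finite_K: "finite K"
    and finite_simplex: "\<sigma> \<in> K \<Longrightarrow> finite \<sigma>"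
    and polyhedron: "B = (\<Union>\<sigma>\<in>K. convex hull (vt ` \<sigma>))"
    and embedded: "\<lbrakk>\<sigma> \<in> K; \<tau> \<in> K; t \<in> simplex_points \<sigma>; u \<in> simplex_points \<tau>;
      (\<Sum>x\<in>\<sigma>. t x *\<^sub>R vt x) = (\<Sum>x\<in>\<tau>. u x *\<^sub>R vt x)\<rbrakk> \<Longrightarrow> t = u"
    and finite_lifted: "\<upsilon> \<in> L \<Longrightarrow> finite \<upsilon>"
    and pr_lifted: "\<upsilon> \<in> L \<Longrightarrow> pr ` \<upsilon> \<in> K"
    and section_lifted: "\<upsilon> \<in> L \<Longrightarrow>
      \<exists>g. is_section S' r (convex hull (vt ` pr ` \<upsilon>)) g \<and> (\<forall>e\<in>\<upsilon>. g (vt (pr e)) = pt e)"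
    and lifted_exists: "\<lbrakk>\<tau> \<in> K; is_section S' r (convex hull (vt ` \<tau>)) g\<rbrakk> \<Longrightarrow>
      \<exists>\<upsilon>\<in>L. pr ` \<upsilon> = \<tau> \<and> (\<forall>e\<in>\<upsilon>. pt e = g (vt (pr e)))"
    and lifted_subset: "\<lbrakk>\<upsilon> \<in> L; \<phi> \<subseteq> \<upsilon>; \<phi> \<noteq> {}\<rbrakk> \<Longrightarrow> \<phi> \<in> L"
    and pt_inj: "\<lbrakk>e \<in> \<Union>L; e' \<in> \<Union>L; pr e = pr e'; pt e = pt e'\<rbrakk> \<Longrightarrow> e = e'"
begin

definition base_point :: "('e \<Rightarrow> real) \<Rightarrow> 'b" where
  "base_point t = (\<Sum>e | t e \<noteq> 0. t e *\<^sub>R vt (pr e))"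

definition section_of :: "'e set \<Rightarrow> 'b \<Rightarrow> 's" where
  "section_of \<sigma> = (SOME g. is_section S' r (convex hull (vt ` pr ` \<sigma>)) g \<and> (\<forall>e\<in>\<sigma>. g (vt (pr e)) = pt e))"

text \<open>The carrier is a simplex determined by \<open>t\<close> itself, so no simplex around
  \<open>t\<close> has to be chosen; \<open>lifted_point_eq\<close> shows that larger simplices give
  the same point.\<close>

definition lifted_point :: "('e \<Rightarrow> real) \<Rightarrow> 's" where
  "lifted_point t = section_of {e. t e \<noteq> 0} (base_point t)"

lemma section_of:
  assumes "\<sigma> \<in> L"
  shows "is_section S' r (convex hull (vt ` pr ` \<sigma>)) (section_of \<sigma>)"
    and "e \<in> \<sigma> \<Longrightarrow> section_of \<sigma> (vt (pr e)) = pt e"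
  using someI_ex[OF section_lifted[OF assms]] unfolding section_of_def by auto

lemma base_point_eq:
  assumes "finite \<sigma>" "t \<in> simplex_points \<sigma>"
  shows "base_point t = (\<Sum>e\<in>\<sigma>. t e *\<^sub>R vt (pr e))"
  unfolding base_point_def using assms simplex_points_carrier(1)[OF assms(2,1)]
  by (intro sum.mono_neutral_left) auto

lemma base_point_image:
  assumes "\<sigma> \<in> L"
  shows "base_point ` simplex_points \<sigma> = convex hull (vt ` pr ` \<sigma>)"
proof -
  have "base_point ` simplex_points \<sigma> = (\<lambda>t. \<Sum>e\<in>\<sigma>. t e *\<^sub>R vt (pr e)) ` simplex_points \<sigma>"
    using base_point_eq finite_lifted[OF assms] by (intro image_cong) auto
  then show ?thesis
    using simplex_points_combination[OF finite_lifted[OF assms], of "vt \<circ> pr"] by (simp add: image_comp)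
qed

lemma continuous_base_point:
  assumes "\<sigma> \<in> L"
  shows "continuous_on (simplex_points \<sigma>) base_point"
proof -
  have "continuous_on (simplex_points \<sigma>) (\<lambda>t. \<Sum>e\<in>\<sigma>. t e *\<^sub>R vt (pr e))"
    by (intro continuous_on_sum continuous_on_scaleR continuous_on_const continuous_on_apply)
  then show ?thesis
    using continuous_on_cong base_point_eq finite_lifted[OF assms] by (metis (no_types, lifting))
qed

lemma carrier_lifted:
  assumes "\<sigma> \<in> L" "t \<in> simplex_points \<sigma>"
  shows "{e. t e \<noteq> 0} \<in> L"
  using lifted_subset[OF assms(1)] simplex_points_carrier[OF assms(2) finite_lifted[OF assms(1)]] by blast

lemma connected_hull: "connected (convex hull X)" for X :: "'b set"
  by (simp add: convex_connected)

text \<open>The section over the carrier and the restriction of \<open>g\<close> to it share the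
  value \<open>pt e\<close> at a vertex, and the hull of the carrier is connected.\<close>

lemma lifted_point_eq:
  assumes "\<sigma> \<in> L" "t \<in> simplex_points \<sigma>"
    and g: "is_section S' r (convex hull (vt ` pr ` \<sigma>)) g" "\<And>e. e \<in> \<sigma> \<Longrightarrow> g (vt (pr e)) = pt e"
  shows "lifted_point t = g (base_point t)"
proof -
  let ?c = "{e. t e \<noteq> 0}"
  note c = simplex_points_carrier[OF assms(2) finite_lifted[OF assms(1)]]
  note cL = carrier_lifted[OF assms(1,2)]
  obtain e where e: "e \<in> ?c" using c(2) by blast
  have "convex hull (vt ` pr ` ?c) \<subseteq> convex hull (vt ` pr ` \<sigma>)"
    using c(1) by (intro hull_mono image_mono)
  then have g': "is_section S' r (convex hull (vt ` pr ` ?c)) g" using g(1) is_section_subset by blast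
  have "section_of ?c (base_point t) = g (base_point t)"
  proof (rule section_unique[OF covering section_of(1)[OF cL] g' connected_hull])
    show "vt (pr e) \<in> convex hull (vt ` pr ` ?c)" using e by (auto intro: hull_inc)
    show "section_of ?c (vt (pr e)) = g (vt (pr e))" using section_of(2)[OF cL e] g(2) e c(1) by auto
    show "base_point t \<in> convex hull (vt ` pr ` ?c)" using base_point_image[OF cL] c(3) by blast
  qed
  then show ?thesis unfolding lifted_point_def .
qed

lemma lifted_point_section:
  assumes "\<sigma> \<in> L" "t \<in> simplex_points \<sigma>"
  shows "lifted_point t = section_of \<sigma> (base_point t)"
  using lifted_point_eq[OF assms section_of[OF assms(1)]] .

lemma r_lifted_point:
  assumes "\<sigma> \<in> L" "t \<in> simplex_points \<sigma>"
  shows "lifted_point t \<in> S'" "r (lifted_point t) = base_point t"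
  using section_of(1)[OF assms(1)] base_point_image[OF assms(1)] assms(2)
  unfolding lifted_point_section[OF assms] is_section_def by blast+

lemma pr_inj_on:
  assumes "\<sigma> \<in> L"
  shows "inj_on pr \<sigma>"
proof (rule inj_onI)
  fix e e' assume "e \<in> \<sigma>" "e' \<in> \<sigma>" "pr e = pr e'"
  then show "e = e'" using pt_inj[of e e'] section_of(2)[OF assms] assms by (metis Union_iff)
qed

text \<open>\<open>pr\<close> is injective on a simplex, so weights move down unchanged. This brings
  points of \<open>L\<close> into the form to which \<open>embedded\<close> applies.\<close>

lemma pushforward:
  assumes "\<sigma> \<in> L" "t \<in> simplex_points \<sigma>"
  obtains T where "T \<in> simplex_points (pr ` \<sigma>)" "\<And>e. e \<in> \<sigma> \<Longrightarrow> T (pr e) = t e"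
    "(\<Sum>x\<in>pr ` \<sigma>. T x *\<^sub>R vt x) = base_point t"
proof
  define T where "T x = (if x \<in> pr ` \<sigma> then t (inv_into \<sigma> pr x) else 0)" for x
  show T: "T (pr e) = t e" if "e \<in> \<sigma>" for e
    using that pr_inj_on[OF assms(1)] unfolding T_def by simp
  show "(\<Sum>x\<in>pr ` \<sigma>. T x *\<^sub>R vt x) = base_point t"
    using T unfolding base_point_eq[OF finite_lifted[OF assms(1)] assms(2)]
    by (subst sum.reindex[OF pr_inj_on[OF assms(1)]]) simp
  have "sum T (pr ` \<sigma>) = 1"
    using T assms(2) by (subst sum.reindex[OF pr_inj_on[OF assms(1)]]) (simp add: simplex_points_def)
  then show "T \<in> simplex_points (pr ` \<sigma>)"
    using assms(2) unfolding simplex_points_def T_def by auto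
qed

text \<open>Equal lifts have equal base points, so \<open>embedded\<close> identifies the weights
  and carriers downstairs. The two sections then agree at the base point, hence over the whole
  simplex, and \<open>pt_inj\<close> identifies the carriers upstairs.\<close>

lemma lifted_point_inj: "inj_on lifted_point (topspace (realization L))"
proof (rule inj_onI)
  fix t u assume "t \<in> topspace (realization L)" "u \<in> topspace (realization L)"
    and eq: "lifted_point t = lifted_point u"
  then obtain \<sigma>0 \<tau>0 where *: "\<sigma>0 \<in> L" "t \<in> simplex_points \<sigma>0" "\<tau>0 \<in> L" "u \<in> simplex_points \<tau>0"
    unfolding topspace_realization by auto
  define \<sigma> \<tau> where "\<sigma> = {e. t e \<noteq> 0}" "\<tau> = {e. u e \<noteq> 0}"
  have \<sigma>: "\<sigma> \<in> L" "t \<in> simplex_points \<sigma>" and \<tau>: "\<tau> \<in> L" "u \<in> simplex_points \<tau>"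
    using *(1,3) carrier_lifted *(2,4) simplex_points_carrier(3)[OF *(2)] simplex_points_carrier(3)[OF *(4)] finite_lifted
    unfolding \<sigma>_\<tau>_def by auto
  have bp: "base_point t = base_point u" using eq r_lifted_point(2) \<sigma> \<tau> by metis
  obtain T where T: "T \<in> simplex_points (pr ` \<sigma>)" "\<And>e. e \<in> \<sigma> \<Longrightarrow> T (pr e) = t e"
    "(\<Sum>x\<in>pr ` \<sigma>. T x *\<^sub>R vt x) = base_point t"
    using pushforward[OF \<sigma>] by blast
  obtain U where U: "U \<in> simplex_points (pr ` \<tau>)" "\<And>e. e \<in> \<tau> \<Longrightarrow> U (pr e) = u e"
    "(\<Sum>x\<in>pr ` \<tau>. U x *\<^sub>R vt x) = base_point u"
    using pushforward[OF \<tau>] by blast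
  have TU: "T = U"
    using embedded[OF pr_lifted[OF \<sigma>(1)] pr_lifted[OF \<tau>(1)] T(1) U(1)] T(3) U(3) bp by simp
  have supT: "x \<in> pr ` \<sigma> \<longleftrightarrow> T x \<noteq> 0" for x
    using T(1,2) unfolding simplex_points_def \<sigma>_\<tau>_def by auto
  have supU: "x \<in> pr ` \<tau> \<longleftrightarrow> U x \<noteq> 0" for x
    using U(1,2) unfolding simplex_points_def \<sigma>_\<tau>_def by auto
  have pr: "pr ` \<sigma> = pr ` \<tau>" using supT supU TU by blast
  have "base_point t \<in> convex hull (vt ` pr ` \<sigma>)" using base_point_image[OF \<sigma>(1)] \<sigma>(2) by blast
  moreover have "section_of \<sigma> (base_point t) = section_of \<tau> (base_point t)"
    using eq lifted_point_section \<sigma> \<tau> bp by simp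
  moreover have "is_section S' r (convex hull (vt ` pr ` \<sigma>)) (section_of \<tau>)"
    using section_of(1)[OF \<tau>(1)] pr by simp
  ultimately have g: "section_of \<sigma> x = section_of \<tau> x" if "x \<in> convex hull (vt ` pr ` \<sigma>)" for x
    using section_unique[OF covering section_of(1)[OF \<sigma>(1)] _ connected_hull] that by blast
  have same: "e = e'" if "e \<in> \<sigma>" "e' \<in> \<tau>" "pr e = pr e'" for e e'
  proof -
    have "vt (pr e) \<in> convex hull (vt ` pr ` \<sigma>)" using that(1) by (auto intro: hull_inc)
    then have "pt e = pt e'" using g section_of(2) \<sigma> \<tau> that by metis
    then show ?thesis using pt_inj \<sigma>(1) \<tau>(1) that by blast
  qed
  show "t = u"
  proof
    fix e
    have "e \<in> \<sigma> \<longleftrightarrow> e \<in> \<tau>"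
    proof
      assume "e \<in> \<sigma>"
      then obtain e' where "e' \<in> \<tau>" "pr e = pr e'" using pr by (metis imageE imageI)
      then show "e \<in> \<tau>" using same[of e e'] \<open>e \<in> \<sigma>\<close> by simp
    next
      assume "e \<in> \<tau>"
      then obtain e' where "e' \<in> \<sigma>" "pr e' = pr e" using pr by (metis imageE imageI)
      then show "e \<in> \<sigma>" using same[of e' e] \<open>e \<in> \<tau>\<close> by simp
    qed
    then show "t e = u e" using T(2)[of e] U(2)[of e] TU unfolding \<sigma>_\<tau>_def by (cases "e \<in> \<sigma>") auto
  qed
qed

text \<open>The hull of a simplex is compact and convex, so a section through \<open>s\<close>
  exists over it, and \<open>lifted_exists\<close> realizes this section by a simplex of
  \<open>L\<close>.\<close>

lemma lift_through:
  assumes s: "s \<in> S'" and "\<tau> \<in> K" "r s \<in> convex hull (vt ` \<tau>)"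
  obtains g \<sigma> where "is_section S' r (convex hull (vt ` \<tau>)) g" "g (r s) = s" "\<sigma> \<in> L" "pr ` \<sigma> = \<tau>"
    "\<forall>t\<in>simplex_points \<sigma>. lifted_point t = g (base_point t)"
proof -
  have "convex hull (vt ` \<tau>) \<subseteq> B" using polyhedron assms by auto
  moreover have "compact (convex hull (vt ` \<tau>))"
    using finite_simplex[OF \<open>\<tau> \<in> K\<close>] by (simp add: compact_convex_hull finite_imp_compact)
  ultimately obtain g where g: "is_section S' r (convex hull (vt ` \<tau>)) g" "g (r s) = s"
    using section_exists[OF covering _ _ convex_convex_hull s assms(3)] by blast
  obtain \<sigma> where \<sigma>: "\<sigma> \<in> L" "pr ` \<sigma> = \<tau>" "\<And>e. e \<in> \<sigma> \<Longrightarrow> pt e = g (vt (pr e))"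
    using lifted_exists[OF assms(2) g(1)] by blast
  have "lifted_point t = g (base_point t)" if "t \<in> simplex_points \<sigma>" for t
    using lifted_point_eq[OF \<sigma>(1) that, of g] g(1) \<sigma> by simp
  then show thesis using that g \<sigma> by blast
qed

lemma lifted_point_surj: "lifted_point ` topspace (realization L) = S'"
proof
  show "lifted_point ` topspace (realization L) \<subseteq> S'"
    unfolding topspace_realization using r_lifted_point(1) by auto
  show "S' \<subseteq> lifted_point ` topspace (realization L)"
  proof
    fix s assume s: "s \<in> S'"
    have "r s \<in> B" using s covering_space_imp_surjective[OF covering] by blast
    then obtain \<tau> where \<tau>: "\<tau> \<in> K" "r s \<in> convex hull (vt ` \<tau>)" using polyhedron by auto
    obtain g \<sigma> where "is_section S' r (convex hull (vt ` \<tau>)) g"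
      and *: "g (r s) = s" "\<sigma> \<in> L" "pr ` \<sigma> = \<tau>"
        "\<forall>t\<in>simplex_points \<sigma>. lifted_point t = g (base_point t)"
      using lift_through[OF s \<tau>] by blast
    have "r s \<in> base_point ` simplex_points \<sigma>" unfolding base_point_image[OF *(2)] *(3) by (rule \<tau>(2))
    then obtain t where t: "t \<in> simplex_points \<sigma>" "r s = base_point t" by blast
    then have "lifted_point t = s" using *(1) bspec[OF *(4) t(1)] by simp
    then show "s \<in> lifted_point ` topspace (realization L)"
      unfolding topspace_realization using t *(2) by blast
  qed
qed

lemma continuous_lifted_point: "continuous_map (realization L) (top_of_set S') lifted_point"
proof (rule continuous_map_realization)
  fix \<sigma> assume \<sigma>: "\<sigma> \<in> L"
  have "continuous_on (simplex_points \<sigma>) (section_of \<sigma> \<circ> base_point)"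
    using continuous_base_point[OF \<sigma>] section_of(1)[OF \<sigma>] base_point_image[OF \<sigma>] unfolding is_section_def
    by (intro continuous_on_compose) auto
  then have "continuous_on (simplex_points \<sigma>) lifted_point"
    using continuous_on_cong lifted_point_section[OF \<sigma>] by (metis (no_types, lifting) comp_apply)
  then show "continuous_map (top_of_set (simplex_points \<sigma>)) (top_of_set S') lifted_point"
    using r_lifted_point(1)[OF \<sigma>] by (simp add: image_subset_iff Pi_iff)
qed

text \<open>
  Near \<open>r s\<close> the local inverse of \<open>r\<close> through \<open>s\<close> agrees with the sections through \<open>s\<close> over the simplices
  that contain \<open>r s\<close>; in each simplex the points whose lift leaves \<open>V\<close> or the image of \<open>U\<close> form a closed
  set, and only finitely many such sets have to be avoided.
\<close>

lemma lifted_point_open: "open_map (realization L) (top_of_set S') lifted_point"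
  unfolding open_map_def
proof (intro allI impI)
  fix U assume U: "openin (realization L) U"
  show "openin (top_of_set S') (lifted_point ` U)"
  proof (subst openin_subopen, intro ballI)
    fix s assume "s \<in> lifted_point ` U"
    then obtain t where t: "t \<in> U" "s = lifted_point t" by auto
    have tL: "t \<in> topspace (realization L)" using openin_subset[OF U] t by auto
    have sS: "s \<in> S'" using tL t lifted_point_surj by auto
    obtain V T q where V: "s \<in> V" "openin (top_of_set S') V" "r s \<in> T" "openin (top_of_set B) T"
      "homeomorphism V T r q"
      using covering_space_local_homeomorphism[OF covering sS] .
    define K0 where "K0 = {\<tau> \<in> K. r s \<in> convex hull (vt ` \<tau>)}"
    have "\<exists>N. closed N \<and> r s \<notin> N \<and> (\<forall>y\<in>convex hull (vt ` \<tau>) - N. \<exists>s'\<in>V \<inter> lifted_point ` U. r s' = y)"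
      if \<tau>: "\<tau> \<in> K" for \<tau>
    proof (cases "r s \<in> convex hull (vt ` \<tau>)")
      case False
      have "closed (convex hull (vt ` \<tau>))"
        using finite_simplex[OF \<tau>] by (simp add: compact_convex_hull finite_imp_compact compact_imp_closed)
      then show ?thesis using False by blast
    next
      case True
      obtain g \<sigma> where g: "is_section S' r (convex hull (vt ` \<tau>)) g" "g (r s) = s" "\<sigma> \<in> L" "pr ` \<sigma> = \<tau>"
        "\<forall>t\<in>simplex_points \<sigma>. lifted_point t = g (base_point t)"
        using lift_through[OF sS \<tau> True] by blast
      let ?H = "convex hull (vt ` \<tau>)"
      have H: "compact ?H" using finite_simplex[OF \<tau>] by (simp add: compact_convex_hull finite_imp_compact)
      have im: "base_point ` simplex_points \<sigma> = ?H" using base_point_image[OF g(3)] g(4) by simp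
      define Z where "Z = base_point ` (simplex_points \<sigma> - U)"
      have "openin (top_of_set (simplex_points \<sigma>)) (U \<inter> simplex_points \<sigma>)"
        using U g(3) unfolding openin_realization_iff by blast
      then have "closedin (top_of_set (simplex_points \<sigma>)) (simplex_points \<sigma> - (U \<inter> simplex_points \<sigma>))"
        using closedin_diff[OF closedin_topspace, of "top_of_set (simplex_points \<sigma>)"] by simp
      then have "closedin (top_of_set (simplex_points \<sigma>)) (simplex_points \<sigma> - U)"
        by (simp add: Diff_Int)
      then have "compact (simplex_points \<sigma> - U)"
        using closedin_compact compact_simplex_points finite_lifted[OF g(3)] by blast
      then have "compact Z" unfolding Z_def
        using continuous_on_subset[OF continuous_base_point[OF g(3)]] by (intro compact_continuous_image) auto
      \<comment> \<open>A point of the simplex over \<open>r s\<close> is lifted by \<open>g\<close>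
        to \<open>s\<close>, which is also the lift of \<open>t\<close>. Injectivity makes it equal
        to \<open>t\<close>, a point of \<open>U\<close>.\<close>
      have "r s \<notin> Z"
      proof
        assume "r s \<in> Z"
        then obtain z where z: "z \<in> simplex_points \<sigma>" "z \<notin> U" "r s = base_point z" unfolding Z_def by auto
        then have "lifted_point z = lifted_point t" using g t by metis
        moreover have "z \<in> topspace (realization L)" using z g(3) unfolding topspace_realization by auto
        ultimately show False using lifted_point_inj tL z t by (metis inj_onD)
      qed
      have "openin (top_of_set ?H) (?H \<inter> g -` V)"
        using g(1) V(2) unfolding is_section_def by (meson continuous_openin_preimage image_subset_iff_funcset)
      then have "closedin (top_of_set ?H) (?H - (?H \<inter> g -` V))" using closedin_diff[OF closedin_topspace, of "top_of_set ?H"] by simp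
      then have "compact (?H - (?H \<inter> g -` V))" using closedin_compact H by blast
      then have "closed (Z \<union> (?H - (?H \<inter> g -` V)))" using \<open>compact Z\<close> by (simp add: closed_Un compact_imp_closed)
      moreover have "r s \<notin> Z \<union> (?H - (?H \<inter> g -` V))" using \<open>r s \<notin> Z\<close> g(2) V(1) True by auto
      moreover have "\<exists>s'\<in>V \<inter> lifted_point ` U. r s' = y" if y: "y \<in> ?H - (Z \<union> (?H - (?H \<inter> g -` V)))" for y
      proof -
        have "g y \<in> V" "r (g y) = y" using y is_section_inv[OF g(1)] by auto
        moreover obtain z where z: "z \<in> simplex_points \<sigma>" "y = base_point z" using y im by blast
        moreover have "z \<in> U" using y z unfolding Z_def by blast
        ultimately show ?thesis using imageI[of z U lifted_point] bspec[OF g(5) z(1)] by (intro bexI[of _ "g y"]) auto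
      qed
      ultimately show ?thesis by blast
    qed
    then have "\<forall>\<tau>\<in>K. \<exists>N. closed N \<and> r s \<notin> N \<and>
      (\<forall>y\<in>convex hull (vt ` \<tau>) - N. \<exists>s'\<in>V \<inter> lifted_point ` U. r s' = y)"
      by blast
    from bchoice[OF this] obtain N where N: "\<forall>\<tau>\<in>K. closed (N \<tau>) \<and> r s \<notin> N \<tau> \<and>
      (\<forall>y\<in>convex hull (vt ` \<tau>) - N \<tau>. \<exists>s'\<in>V \<inter> lifted_point ` U. r s' = y)"
      by blast
    define W where "W = T \<inter> - (\<Union>\<tau>\<in>K. N \<tau>)"
    have "closed (\<Union>\<tau>\<in>K. N \<tau>)" using N finite_K by (intro closed_UN) auto
    then have W: "openin (top_of_set B) W" unfolding W_def using V(4) by (intro openin_Int_open) (simp_all only: open_Compl)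
    define V' where "V' = V \<inter> (S' \<inter> r -` W)"
    have "openin (top_of_set S') (S' \<inter> r -` W)"
      using continuous_openin_preimage[OF covering_space_imp_continuous[OF covering] _ W]
        covering_space_imp_surjective[OF covering] by blast
    then have "openin (top_of_set S') V'" unfolding V'_def using V(2) by (rule openin_Int[rotated])
    moreover have "s \<in> V'" unfolding V'_def W_def using V(1,3) N sS by blast
    moreover have "V' \<subseteq> lifted_point ` U"
    proof
      fix x assume x: "x \<in> V'"
      then have "r x \<in> W" "x \<in> V" unfolding V'_def by auto
      then have "r x \<in> B" using W openin_imp_subset by blast
      then obtain \<tau> where \<tau>: "\<tau> \<in> K" "r x \<in> convex hull (vt ` \<tau>)" using polyhedron by auto
      then obtain s' where s': "s' \<in> V" "s' \<in> lifted_point ` U" "r s' = r x"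
        using bspec[OF N \<tau>(1)] \<tau>(1) \<open>r x \<in> W\<close> unfolding W_def by (metis Compl_iff DiffI IntE UN_I)
      \<comment> \<open>\<open>x\<close> and \<open>s'\<close> both lie in \<open>V\<close> over the
        same point, and \<open>r\<close> is injective on \<open>V\<close>.\<close>
      have "s' = q (r s')" by (rule homeomorphism_apply1[OF V(5) s'(1), symmetric])
      also have "\<dots> = x" unfolding s'(3) by (rule homeomorphism_apply1[OF V(5) \<open>x \<in> V\<close>])
      finally show "x \<in> lifted_point ` U" using s'(2) by (rule subst)
    qed
    ultimately show "\<exists>T. openin (top_of_set S') T \<and> s \<in> T \<and> T \<subseteq> lifted_point ` U" by blast
  qed
qed

lemma lifted_point_homeomorphic: "homeomorphic_map (realization L) (top_of_set S') lifted_point"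
proof (rule bijective_open_imp_homeomorphic_map)
  show "lifted_point ` topspace (realization L) = topspace (top_of_set S')"
    unfolding lifted_point_surj topspace_euclidean_subtopology ..
qed (rule continuous_lifted_point lifted_point_open lifted_point_inj)+

end

section \<open>Homotopy colimits of diagrams of discrete spaces\<close>

text \<open>The map induced by \<open>f\<close> on classes is again a quotient map, and since the
  classes of \<open>R\<close> are the fibres of \<open>f\<close> it is injective; an injective
  quotient map is a homeomorphism.\<close>

lemma quotient_topology_homeomorphic:
  assumes R: "equiv (topspace X) R" and f: "quotient_map X Y f"
    and ker: "\<And>x y. x \<in> topspace X \<Longrightarrow> y \<in> topspace X \<Longrightarrow> (x, y) \<in> R \<longleftrightarrow> f x = f y"
  shows "quotient_topology X R homeomorphic_space Y"
proof -
  have fX: "f ` topspace X = topspace Y"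
    and fo: "\<And>U. U \<subseteq> topspace Y \<Longrightarrow> openin X {x \<in> topspace X. f x \<in> U} = openin Y U"
    using f unfolding quotient_map_def by blast+
  have un: "\<Union>(topspace X // R) = topspace X" by (rule Union_quotient[OF R])
  have top: "topspace (quotient_topology X R) = topspace X // R"
  proof
    show "topspace (quotient_topology X R) \<subseteq> topspace X // R"
      using openin_quotient_topology[OF R] openin_topspace by blast
    have "openin (quotient_topology X R) (topspace X // R)"
      using openin_quotient_topology[OF R, of "topspace X // R"] un by simp
    then show "topspace X // R \<subseteq> topspace (quotient_topology X R)" by (rule openin_subset)
  qed
  define F where "F c = f (SOME x. x \<in> c)" for c
  have F: "F c = f x" if c: "c \<in> topspace X // R" "x \<in> c" for c x
  proof -
    have "(SOME x. x \<in> c) \<in> c" using that(2) by (rule someI)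
    moreover have "c \<subseteq> topspace X" using un c by blast
    moreover have "(SOME x. x \<in> c, x) \<in> R"
      using quotient_eq_iff[OF R c(1) c(1) calculation(1) c(2)] by simp
    ultimately show ?thesis using ker that unfolding F_def by blast
  qed
  have cls: "\<exists>x. x \<in> c \<and> x \<in> topspace X" if "c \<in> topspace X // R" for c
    using in_quotient_imp_non_empty[OF R that] un that by blast
  have inX: "R `` {x} \<in> topspace X // R" "x \<in> R `` {x}" if "x \<in> topspace X" for x
    by (rule quotientI[OF that], rule equiv_class_self[OF R that])
  have FX: "F ` (topspace X // R) = topspace Y"
  proof
    show "F ` (topspace X // R) \<subseteq> topspace Y"
    proof clarify
      fix c assume c: "c \<in> topspace X // R"
      then obtain x where "x \<in> c" "x \<in> topspace X" using cls by blast
      then show "F c \<in> topspace Y" using F[OF c] fX by auto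
    qed
    show "topspace Y \<subseteq> F ` (topspace X // R)"
    proof
      fix y assume "y \<in> topspace Y"
      then obtain x where "x \<in> topspace X" "y = f x" using fX by blast
      then show "y \<in> F ` (topspace X // R)"
        using inX[of x] F[of "R `` {x}" x] by (intro image_eqI[of _ _ "R `` {x}"]) simp_all
    qed
  qed
  have qF: "quotient_map (quotient_topology X R) Y F"
    unfolding quotient_map_def top
  proof (intro conjI allI impI FX)
    fix U assume U: "U \<subseteq> topspace Y"
    have "\<Union>{c \<in> topspace X // R. F c \<in> U} = {x \<in> topspace X. f x \<in> U}"
    proof (intro set_eqI iffI)
      fix x assume "x \<in> \<Union>{c \<in> topspace X // R. F c \<in> U}"
      then obtain c where "c \<in> topspace X // R" "F c \<in> U" "x \<in> c" by blast
      then show "x \<in> {x \<in> topspace X. f x \<in> U}" using F[of c x] un by auto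
    next
      fix x assume "x \<in> {x \<in> topspace X. f x \<in> U}"
      then show "x \<in> \<Union>{c \<in> topspace X // R. F c \<in> U}" using inX[of x] F[of "R `` {x}" x] by auto
    qed
    then show "openin (quotient_topology X R) {c \<in> topspace X // R. F c \<in> U} = openin Y U"
      using openin_quotient_topology[OF R] fo[OF U] by auto
  qed
  have "inj_on F (topspace X // R)"
  proof (rule inj_onI)
    fix c d assume cd: "c \<in> topspace X // R" "d \<in> topspace X // R" "F c = F d"
    obtain x where x: "x \<in> c" "x \<in> topspace X" using cls[OF cd(1)] by blast
    obtain y where y: "y \<in> d" "y \<in> topspace X" using cls[OF cd(2)] by blast
    have "(x, y) \<in> R" using ker[OF x(2) y(2)] F[OF cd(1) x(1)] F[OF cd(2) y(1)] cd(3) by simp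
    then show "c = d" using quotient_eq_iff[OF R cd(1,2) x(1) y(1)] by simp
  qed
  then have "homeomorphic_map (quotient_topology X R) Y F"
    unfolding homeomorphic_map_def using qF top by simp
  then show ?thesis by (rule homeomorphic_map_imp_homeomorphic_space)
qed

lemma order_complexD:
  assumes "\<sigma> \<in> order_complex Q g"
  shows "finite \<sigma>" "\<sigma> \<noteq> {}" "\<sigma> \<subseteq> Q" "x \<in> \<sigma> \<Longrightarrow> y \<in> \<sigma> \<Longrightarrow> g x y \<or> g y x"
  using assms unfolding order_complex_def by auto

text \<open>Transitivity is asked only inside \<open>\<sigma>\<close> because \<open>W_ge\<close>
  and \<open>limit_ge\<close> are known to be transitive only on their posets. Applied to the
  converse relation it also yields least elements.\<close>

lemma finite_chain_greatest:
  assumes "finite \<sigma>" "\<sigma> \<noteq> {}"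
    and chain: "\<And>x y. x \<in> \<sigma> \<Longrightarrow> y \<in> \<sigma> \<Longrightarrow> ge x y \<or> ge y x"
    and trans: "\<And>x y z. \<lbrakk>x \<in> \<sigma>; y \<in> \<sigma>; z \<in> \<sigma>; ge x y; ge y z\<rbrakk> \<Longrightarrow> ge x z"
  shows "\<exists>x\<in>\<sigma>. \<forall>y\<in>\<sigma>. ge x y"
  using assms
proof (induction \<sigma> rule: finite_ne_induct)
  case (singleton x)
  show ?case using singleton.prems(1)[of x x] by simp
next
  case (insert a \<sigma>)
  have "\<exists>x\<in>\<sigma>. \<forall>y\<in>\<sigma>. ge x y"
  proof (rule insert.IH)
    show "ge x y \<or> ge y x" if "x \<in> \<sigma>" "y \<in> \<sigma>" for x y
      using insert.prems(1)[of x y] that by simp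
    show "ge x z" if "x \<in> \<sigma>" "y \<in> \<sigma>" "z \<in> \<sigma>" "ge x y" "ge y z" for x y z
      using insert.prems(2)[of x y z] that by simp
  qed
  then obtain x where x: "x \<in> \<sigma>" "\<forall>y\<in>\<sigma>. ge x y" by blast
  have "ge a a" using insert.prems(1)[of a a] by auto
  consider "ge a x" | "ge x a" using insert.prems(1)[of a x] x(1) by auto
  then show ?case
  proof cases
    case 1
    have "ge a y" if "y \<in> \<sigma>" for y
      using x that 1 insert.prems(2)[of a x y] by simp
    then show ?thesis using \<open>ge a a\<close> by auto
  next
    case 2
    then show ?thesis using x by auto
  qed
qed

text \<open>The maps include the identities \<open>f p p\<close>, so that \<open>limit_ge\<close> is
  reflexive and \<open>spread\<close> needs no separate case at the top element.\<close>

locale discrete_diagram =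
  fixes P :: "'p set" and ge :: "'p \<Rightarrow> 'p \<Rightarrow> bool" and D :: "'p \<Rightarrow> 'x set" and f :: "'p \<Rightarrow> 'p \<Rightarrow> 'x \<Rightarrow> 'x"
  assumes ge_refl: "p \<in> P \<Longrightarrow> ge p p"
    and ge_antisym: "\<lbrakk>p \<in> P; q \<in> P; ge p q; ge q p\<rbrakk> \<Longrightarrow> p = q"
    and ge_trans: "\<lbrakk>p \<in> P; q \<in> P; s \<in> P; ge p q; ge q s\<rbrakk> \<Longrightarrow> ge p s"
    and f_in: "\<lbrakk>p \<in> P; q \<in> P; ge p q; x \<in> D p\<rbrakk> \<Longrightarrow> f p q x \<in> D q"
    and f_id: "\<lbrakk>p \<in> P; x \<in> D p\<rbrakk> \<Longrightarrow> f p p x = x"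
    and f_comp: "\<lbrakk>p \<in> P; q \<in> P; s \<in> P; ge p q; ge q s; x \<in> D p\<rbrakk> \<Longrightarrow> f q s (f p q x) = f p s x"
begin

definition limit_poset :: "('p \<times> 'x) set" where
  "limit_poset = {(p, x). p \<in> P \<and> x \<in> D p}"

definition limit_ge :: "'p \<times> 'x \<Rightarrow> 'p \<times> 'x \<Rightarrow> bool" where
  "limit_ge = (\<lambda>(p, x) (q, y). ge p q \<and> y = f p q x)"

abbreviation "sum_space \<equiv> hocolim_sum P ge (\<lambda>p. discrete_topology (D p))"
abbreviation "limit_space \<equiv> \<Delta> limit_poset limit_ge"

text \<open>Barycentric form of the simplicial map \<open>q \<mapsto> (q, f p q x)\<close> from the
  chains below \<open>p\<close> to the chains of the limit poset. Its fibres will turn out to be the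
  classes of the homotopy colimit.\<close>

definition spread :: "'p \<times> 'x \<times> ('p \<Rightarrow> real) \<Rightarrow> 'p \<times> 'x \<Rightarrow> real" where
  "spread = (\<lambda>(p, x, t) (q, y). if q \<in> P \<and> ge p q \<and> y = f p q x then t q else 0)"

definition simplex_over :: "'p \<Rightarrow> 'x \<Rightarrow> 'p set \<Rightarrow> ('p \<times> 'x) set" where
  "simplex_over p x \<sigma> = (\<lambda>q. (q, f p q x)) ` \<sigma>"

abbreviation below :: "'p \<Rightarrow> 'p set" where
  "below p \<equiv> {q\<in>P. ge p q}"

lemma topspace_sum: "topspace sum_space = {(p, x, t). p \<in> P \<and> x \<in> D p \<and> t \<in> topspace (\<Delta> (below p) ge)}"
  unfolding hocolim_sum_def topspace_sum_topology by auto

lemma simplex_over: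
  assumes "p \<in> P" "x \<in> D p" "\<sigma> \<in> order_complex (below p) ge"
  shows "simplex_over p x \<sigma> \<in> order_complex limit_poset limit_ge"
proof -
  note \<sigma> = order_complexD[OF assms(3)]
  have 1: "simplex_over p x \<sigma> \<subseteq> limit_poset"
    using \<sigma>(3) f_in assms(1,2) unfolding simplex_over_def limit_poset_def by auto
  have 2: "limit_ge (a, f p a x) (b, f p b x)" if "a \<in> \<sigma>" "b \<in> \<sigma>" "ge a b" for a b
  proof -
    have "a \<in> P" "b \<in> P" "ge p a" using that \<sigma>(3) by auto
    then show ?thesis using f_comp[of p a b x] assms(1,2) that unfolding limit_ge_def by simp
  qed
  have "limit_ge u v \<or> limit_ge v u" if "u \<in> simplex_over p x \<sigma>" "v \<in> simplex_over p x \<sigma>" for u v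
    using that 2 \<sigma>(4) unfolding simplex_over_def by fast
  then show ?thesis using 1 \<sigma>(1,2) unfolding order_complex_def simplex_over_def by auto
qed

lemma spread_simplex:
  assumes "p \<in> P" "x \<in> D p" "\<sigma> \<in> order_complex (below p) ge" "t \<in> simplex_points \<sigma>"
  shows "spread (p, x, t) \<in> simplex_points (simplex_over p x \<sigma>)"
    "spread (p, x, t) (q, f p q x) = t q"
proof -
  note \<sigma> = order_complexD[OF assms(3)]
  show *: "spread (p, x, t) (q, f p q x) = t q" for q
    using assms(4) \<sigma>(3) unfolding spread_def simplex_points_def by auto
  have "inj_on (\<lambda>q. (q, f p q x)) \<sigma>" by (auto intro: inj_onI)
  then have "sum (spread (p, x, t)) (simplex_over p x \<sigma>) = sum t \<sigma>"
    unfolding simplex_over_def by (subst sum.reindex) (auto simp: *)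
  moreover have "spread (p, x, t) v = 0" if "v \<notin> simplex_over p x \<sigma>" for v
  proof (cases v)
    case (Pair q y)
    then show ?thesis using that assms(4) unfolding simplex_over_def spread_def simplex_points_def by auto
  qed
  moreover have "0 \<le> spread (p, x, t) v" for v
    using assms(4) unfolding simplex_points_def spread_def by (cases v) auto
  ultimately show "spread (p, x, t) \<in> simplex_points (simplex_over p x \<sigma>)"
    using assms(4) unfolding simplex_points_def by simp
qed

lemma topspace_below:
  assumes "t \<in> topspace (\<Delta> (below p) ge)"
  obtains \<sigma> where "\<sigma> \<in> order_complex (below p) ge" "t \<in> simplex_points \<sigma>"
  using assms unfolding topspace_realization by auto

text \<open>Relative to the greatest element \<open>(p, x)\<close>, the definition of
  \<open>limit_ge\<close> forces the second component of every other element to be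
  \<open>f p q x\<close>.\<close>

lemma simplex_over_cases:
  assumes "\<upsilon> \<in> order_complex limit_poset limit_ge"
  obtains p x \<sigma> where "p \<in> P" "x \<in> D p" "\<sigma> \<in> order_complex (below p) ge" "p \<in> \<sigma>" "\<upsilon> = simplex_over p x \<sigma>"
proof -
  note \<upsilon> = order_complexD[OF assms]
  have "\<exists>u\<in>\<upsilon>. \<forall>v\<in>\<upsilon>. limit_ge u v"
  proof (rule finite_chain_greatest[OF \<upsilon>(1,2,4)])
    fix a b c assume "a \<in> \<upsilon>" "b \<in> \<upsilon>" "c \<in> \<upsilon>" and ge: "limit_ge a b" "limit_ge b c"
    then have in_limit: "a \<in> limit_poset" "b \<in> limit_poset" "c \<in> limit_poset" using \<upsilon>(3) by blast+
    obtain p x q y s z where abc: "a = (p, x)" "b = (q, y)" "c = (s, z)" by (metis surj_pair)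
    have "p \<in> P" "q \<in> P" "s \<in> P" "x \<in> D p" using in_limit unfolding abc limit_poset_def by auto
    moreover have "ge p q" "ge q s" "y = f p q x" "z = f q s y" using ge unfolding abc limit_ge_def by auto
    ultimately show "limit_ge a c"
      using ge_trans[of p q s] f_comp[of p q s x] unfolding abc limit_ge_def by simp
  qed
  then obtain u where u: "u \<in> \<upsilon>" "\<forall>v\<in>\<upsilon>. limit_ge u v" by blast
  obtain p x where "u = (p, x)" by (cases u)
  with u have px: "(p, x) \<in> \<upsilon>" "\<forall>v\<in>\<upsilon>. limit_ge (p, x) v" by simp_all
  have p: "p \<in> P" "x \<in> D p" using px \<upsilon>(3) unfolding limit_poset_def by auto
  have eq: "\<upsilon> = simplex_over p x (fst ` \<upsilon>)"
    using px(2) unfolding simplex_over_def limit_ge_def by (force simp: image_iff)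
  have "fst ` \<upsilon> \<in> order_complex (below p) ge"
    unfolding order_complex_def
  proof (intro CollectI conjI ballI)
    show "fst ` \<upsilon> \<subseteq> below p"
      using px(2) \<upsilon>(3) unfolding limit_poset_def limit_ge_def by auto
    fix a b assume "a \<in> fst ` \<upsilon>" "b \<in> fst ` \<upsilon>"
    then show "ge a b \<or> ge b a" using \<upsilon>(4) unfolding limit_ge_def by fastforce
  qed (use \<upsilon>(1,2) in auto)
  then show thesis using that[OF p _ _ eq] px(1) by force
qed

text \<open>The inverse of \<open>spread\<close> over a single simplex.\<close>

definition gather :: "'p \<Rightarrow> 'x \<Rightarrow> 'p set \<Rightarrow> ('p \<times> 'x \<Rightarrow> real) \<Rightarrow> 'p \<Rightarrow> real" where
  "gather p x \<sigma> v = (\<lambda>q. if q \<in> \<sigma> then v (q, f p q x) else 0)"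

lemma gather:
  assumes "p \<in> P" "x \<in> D p" "\<sigma> \<in> order_complex (below p) ge" "v \<in> simplex_points (simplex_over p x \<sigma>)"
  shows "gather p x \<sigma> v \<in> simplex_points \<sigma>" "spread (p, x, gather p x \<sigma> v) = v"
proof -
  have inj: "inj_on (\<lambda>q. (q, f p q x)) \<sigma>" by (auto intro: inj_onI)
  have "sum v (simplex_over p x \<sigma>) = sum (gather p x \<sigma> v) \<sigma>"
    unfolding simplex_over_def by (subst sum.reindex[OF inj]) (auto simp: gather_def)
  then show g: "gather p x \<sigma> v \<in> simplex_points \<sigma>"
    using assms(4) unfolding simplex_points_def gather_def by auto
  show "spread (p, x, gather p x \<sigma> v) = v"
  proof
    fix u :: "'p \<times> 'x"
    show "spread (p, x, gather p x \<sigma> v) u = v u"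
    proof (cases "u \<in> simplex_over p x \<sigma>")
      case True
      then obtain q where "q \<in> \<sigma>" "u = (q, f p q x)" unfolding simplex_over_def by auto
      then show ?thesis using spread_simplex(2)[OF assms(1-3) g] by (simp add: gather_def)
    next
      case False
      then show ?thesis
        using simplex_points_outside[OF spread_simplex(1)[OF assms(1-3) g]] simplex_points_outside[OF assms(4)] by simp
    qed
  qed
qed

lemma spread_surj: "spread ` topspace sum_space = topspace limit_space"
proof
  show "spread ` topspace sum_space \<subseteq> topspace limit_space"
  proof
    fix v assume "v \<in> spread ` topspace sum_space"
    then obtain p x t where *: "p \<in> P" "x \<in> D p" "t \<in> topspace (\<Delta> (below p) ge)" "v = spread (p, x, t)"
      unfolding topspace_sum by auto
    obtain \<sigma> where \<sigma>: "\<sigma> \<in> order_complex (below p) ge" "t \<in> simplex_points \<sigma>"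
      using topspace_below[OF *(3)] by blast
    show "v \<in> topspace limit_space"
      using spread_simplex(1)[OF *(1,2) \<sigma>] simplex_over[OF *(1,2) \<sigma>(1)] *(4) unfolding topspace_realization by blast
  qed
  show "topspace limit_space \<subseteq> spread ` topspace sum_space"
  proof
    fix v assume "v \<in> topspace limit_space"
    then obtain \<upsilon> where \<upsilon>: "\<upsilon> \<in> order_complex limit_poset limit_ge" "v \<in> simplex_points \<upsilon>"
      unfolding topspace_realization by auto
    obtain p x \<sigma> where *: "p \<in> P" "x \<in> D p" "\<sigma> \<in> order_complex (below p) ge" "p \<in> \<sigma>" "\<upsilon> = simplex_over p x \<sigma>"
      using simplex_over_cases[OF \<upsilon>(1)] by blast
    note t = gather[OF *(1-3) \<upsilon>(2)[unfolded *(5)]]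
    have "(p, x, gather p x \<sigma> v) \<in> topspace sum_space"
      using * t(1) unfolding topspace_sum topspace_realization by auto
    then show "v \<in> spread ` topspace sum_space" using t(2) by (metis imageI)
  qed
qed

lemma openin_discrete_prod:
  assumes "W \<subseteq> A \<times> topspace Z"
  shows "openin (prod_topology (discrete_topology A) Z) W \<longleftrightarrow> (\<forall>x\<in>A. openin Z {t. (x, t) \<in> W})"
proof
  assume L: "openin (prod_topology (discrete_topology A) Z) W"
  show "\<forall>x\<in>A. openin Z {t. (x, t) \<in> W}"
  proof
    fix x assume "x \<in> A"
    then have "continuous_map Z (prod_topology (discrete_topology A) Z) (\<lambda>t. (x, t))"
      by (simp add: continuous_map_pairedI)
    from openin_continuous_map_preimage[OF this L]
    have "openin Z {t \<in> topspace Z. (x, t) \<in> W}" .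
    moreover have "{t \<in> topspace Z. (x, t) \<in> W} = {t. (x, t) \<in> W}" using assms by auto
    ultimately show "openin Z {t. (x, t) \<in> W}" by simp
  qed
next
  assume R: "\<forall>x\<in>A. openin Z {t. (x, t) \<in> W}"
  have "openin (prod_topology (discrete_topology A) Z) (\<Union>x\<in>A. {x} \<times> {t. (x, t) \<in> W})"
    using R by (intro openin_Union) (auto simp: openin_prod_Times_iff)
  moreover have "(\<Union>x\<in>A. {x} \<times> {t. (x, t) \<in> W}) = W" using assms by auto
  ultimately show "openin (prod_topology (discrete_topology A) Z) W" by simp
qed

lemma openin_sum: "openin sum_space W \<longleftrightarrow> W \<subseteq> topspace sum_space \<and>
    (\<forall>p\<in>P. \<forall>x\<in>D p. openin (\<Delta> (below p) ge) {t. (p, x, t) \<in> W})"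
proof -
  have "openin (prod_topology (discrete_topology (D p)) (\<Delta> (below p) ge)) {z. (p, z) \<in> W} \<longleftrightarrow>
      (\<forall>x\<in>D p. openin (\<Delta> (below p) ge) {t. (p, x, t) \<in> W})"
    if "W \<subseteq> topspace sum_space" "p \<in> P" for p
    using that openin_discrete_prod[of "{z. (p, z) \<in> W}" "D p" "\<Delta> (below p) ge"]
    unfolding topspace_sum by auto
  then show ?thesis
    unfolding hocolim_sum_def openin_sum_topology topspace_sum_topology by blast
qed

lemma continuous_spread:
  assumes "p \<in> P" "x \<in> D p"
  shows "continuous_map (\<Delta> (below p) ge) limit_space (\<lambda>t. spread (p, x, t))"
proof (rule continuous_map_realization)
  fix \<sigma> assume \<sigma>: "\<sigma> \<in> order_complex (below p) ge"
  have "continuous_on (simplex_points \<sigma>) (\<lambda>t. spread (p, x, t))"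
  proof (intro continuous_on_coordinatewise_then_product)
    fix u show "continuous_on (simplex_points \<sigma>) (\<lambda>t. spread (p, x, t) u)"
    proof (cases u)
      case (Pair q y)
      then show ?thesis
        unfolding spread_def by (cases "q \<in> P \<and> ge p q \<and> y = f p q x") (simp_all only: prod.case if_True if_False continuous_on_apply continuous_on_const simp_thms)
    qed
  qed
  then have c: "continuous_map (top_of_set (simplex_points \<sigma>)) (top_of_set (simplex_points (simplex_over p x \<sigma>)))
      (\<lambda>t. spread (p, x, t))"
    using spread_simplex(1)[OF assms \<sigma>] by (simp add: image_subset_iff Pi_iff)
  show "continuous_map (top_of_set (simplex_points \<sigma>)) limit_space (\<lambda>t. spread (p, x, t))"
    unfolding continuous_map
  proof (intro conjI allI impI)
    show "(\<lambda>t. spread (p, x, t)) ` topspace (top_of_set (simplex_points \<sigma>)) \<subseteq> topspace limit_space"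
      using spread_simplex(1)[OF assms \<sigma>] simplex_over[OF assms \<sigma>] unfolding topspace_realization by auto
    fix U assume U: "openin limit_space U"
    then have "openin (top_of_set (simplex_points (simplex_over p x \<sigma>))) (U \<inter> simplex_points (simplex_over p x \<sigma>))"
      using simplex_over[OF assms \<sigma>] unfolding openin_realization_iff by blast
    from openin_continuous_map_preimage[OF c this]
    have "openin (top_of_set (simplex_points \<sigma>))
       {t \<in> simplex_points \<sigma>. spread (p, x, t) \<in> U \<inter> simplex_points (simplex_over p x \<sigma>)}" by simp
    moreover have "{t \<in> simplex_points \<sigma>. spread (p, x, t) \<in> U \<inter> simplex_points (simplex_over p x \<sigma>)}
       = {t \<in> topspace (top_of_set (simplex_points \<sigma>)). spread (p, x, t) \<in> U}"
      using spread_simplex(1)[OF assms \<sigma>] by auto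
    ultimately show "openin (top_of_set (simplex_points \<sigma>)) {t \<in> topspace (top_of_set (simplex_points \<sigma>)). spread (p, x, t) \<in> U}"
      by simp
  qed
qed

text \<open>Every closed simplex of the limit complex is a copy, through \<open>gather\<close>, of a
  simplex in one summand. A set with open preimage therefore meets each simplex in a relatively open
  set, which is all that the weak topology asks.\<close>

lemma quotient_spread: "quotient_map sum_space limit_space spread"
  unfolding quotient_map_def
proof (intro conjI allI impI spread_surj)
  fix U assume U: "U \<subseteq> topspace limit_space"
  let ?W = "{z \<in> topspace sum_space. spread z \<in> U}"
  have slice: "{t. (p, x, t) \<in> ?W} = {t \<in> topspace (\<Delta> (below p) ge). spread (p, x, t) \<in> U}"
    if "p \<in> P" "x \<in> D p" for p x
    using that unfolding topspace_sum by auto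
  show "openin sum_space ?W = openin limit_space U"
  proof
    assume "openin limit_space U"
    then show "openin sum_space ?W"
      unfolding openin_sum using slice openin_continuous_map_preimage[OF continuous_spread] by simp
  next
    assume W: "openin sum_space ?W"
    show "openin limit_space U"
      unfolding openin_realization_iff
    proof (intro conjI ballI)
      show "U \<subseteq> \<Union>(simplex_points ` order_complex limit_poset limit_ge)"
        using U unfolding topspace_realization .
      fix \<upsilon> assume \<upsilon>: "\<upsilon> \<in> order_complex limit_poset limit_ge"
      obtain p x \<sigma> where *: "p \<in> P" "x \<in> D p" "\<sigma> \<in> order_complex (below p) ge" "p \<in> \<sigma>" "\<upsilon> = simplex_over p x \<sigma>"
        using simplex_over_cases[OF \<upsilon>] by blast
      define g where "g = gather p x \<sigma>"
      have g: "g v \<in> simplex_points \<sigma>" and sg: "spread (p, x, g v) = v" if "v \<in> simplex_points \<upsilon>" for v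
        unfolding g_def using gather[OF *(1-3) that[unfolded *(5)]] by auto
      have "continuous_on (simplex_points \<upsilon>) g"
      proof (intro continuous_on_coordinatewise_then_product)
        fix q show "continuous_on (simplex_points \<upsilon>) (\<lambda>v. g v q)"
          unfolding g_def gather_def by (cases "q \<in> \<sigma>") (auto intro: continuous_on_apply)
      qed
      then have gc: "continuous_map (top_of_set (simplex_points \<upsilon>)) (top_of_set (simplex_points \<sigma>)) g"
        using g by (simp add: image_subset_iff Pi_iff)
      let ?S = "{t \<in> topspace (\<Delta> (below p) ge). spread (p, x, t) \<in> U}"
      have "openin (\<Delta> (below p) ge) ?S" using W slice *(1,2) unfolding openin_sum by simp
      then have "openin (top_of_set (simplex_points \<sigma>)) (?S \<inter> simplex_points \<sigma>)"
        using *(3) unfolding openin_realization_iff by blast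
      from openin_continuous_map_preimage[OF gc this]
      have "openin (top_of_set (simplex_points \<upsilon>)) {v \<in> simplex_points \<upsilon>. g v \<in> ?S \<inter> simplex_points \<sigma>}" by simp
      moreover have "{v \<in> simplex_points \<upsilon>. g v \<in> ?S \<inter> simplex_points \<sigma>} = U \<inter> simplex_points \<upsilon>"
        using g sg *(3) unfolding topspace_realization by auto
      ultimately show "openin (top_of_set (simplex_points \<upsilon>)) (U \<inter> simplex_points \<upsilon>)" by simp
    qed
  qed
qed

abbreviation "glue \<equiv> hocolim_glue P ge (\<lambda>p. discrete_topology (D p)) f"

lemma spread_glue:
  assumes "(a, b) \<in> glue"
  shows "spread a = spread b"
proof -
  obtain p q x t where *: "a = (p, x, t)" "b = (q, f p q x, t)" "p \<in> P" "q \<in> P" "ge p q" "x \<in> D p"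
    "t \<in> topspace (\<Delta> (below q) ge)"
    using assms unfolding hocolim_glue_def by auto
  obtain \<sigma> where \<sigma>: "\<sigma> \<in> order_complex (below q) ge" "t \<in> simplex_points \<sigma>"
    using topspace_below[OF *(7)] by blast
  \<comment> \<open>The weights of \<open>t\<close> sit below \<open>q\<close>, and there
    \<open>f p s\<close> factors through \<open>f p q\<close>.\<close>
  have sub: "t s = 0 \<or> s \<in> P \<and> ge q s" for s
    using \<sigma> order_complexD(3)[OF \<sigma>(1)] unfolding simplex_points_def by auto
  show ?thesis
  proof
    fix u :: "'p \<times> 'x"
    show "spread a u = spread b u"
    proof (cases u)
      case (Pair s y)
      then show ?thesis using sub[of s] ge_trans[of p q s] f_comp[of p q s x] * unfolding spread_def by auto
    qed
  qed
qed

text \<open>A normal form for the gluing: the index \<open>p\<close> is lowered to the greatest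
  element of the carrier of \<open>t\<close>. At most one gluing step is needed, and none if
  \<open>p\<close> is already that element.\<close>

lemma glue_canonical:
  assumes "(p, x, t) \<in> topspace sum_space"
  shows "\<exists>p0. p0 \<in> P \<and> ge p p0 \<and> t p0 \<noteq> 0 \<and> (\<forall>q. t q \<noteq> 0 \<longrightarrow> ge p0 q) \<and>
    ((p, x, t), (p0, f p p0 x, t)) \<in> glue\<^sup>* \<and> (p0, f p p0 x, t) \<in> topspace sum_space"
proof -
  have px: "p \<in> P" "x \<in> D p" "t \<in> topspace (\<Delta> (below p) ge)" using assms unfolding topspace_sum by auto
  obtain \<sigma> where \<sigma>: "\<sigma> \<in> order_complex (below p) ge" "t \<in> simplex_points \<sigma>"
    using topspace_below[OF px(3)] by blast
  note s = order_complexD[OF \<sigma>(1)]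
  let ?c = "{q. t q \<noteq> 0}"
  note c = simplex_points_carrier[OF \<sigma>(2) s(1)]
  have "\<exists>p0\<in>?c. \<forall>q\<in>?c. ge p0 q"
  proof (rule finite_chain_greatest)
    show "finite ?c" using c(1) s(1) finite_subset by blast
    show "?c \<noteq> {}" by (rule c(2))
    show "ge x y \<or> ge y x" if "x \<in> ?c" "y \<in> ?c" for x y using that c(1) s(4) by blast
    show "ge x z" if "x \<in> ?c" "y \<in> ?c" "z \<in> ?c" "ge x y" "ge y z" for x y z
    proof -
      have "x \<in> P" "y \<in> P" "z \<in> P" using that c(1) s(3) by blast+
      then show ?thesis using ge_trans that by blast
    qed
  qed
  then obtain p0 where p0: "t p0 \<noteq> 0" "\<And>q. t q \<noteq> 0 \<Longrightarrow> ge p0 q" by blast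
  have p0P: "p0 \<in> P" "ge p p0" using p0(1) c(1) s(3) by auto
  have "?c \<in> order_complex (below p0) ge"
    unfolding order_complex_def
  proof (intro CollectI conjI ballI)
    show "?c \<subseteq> below p0" using p0(2) c(1) s(3) by auto
    show "finite ?c" using c(1) s(1) finite_subset by blast
    show "?c \<noteq> {}" by (rule c(2))
    show "ge x y \<or> ge y x" if "x \<in> ?c" "y \<in> ?c" for x y using that c(1) s(4) by blast
  qed
  then have t0: "t \<in> topspace (\<Delta> (below p0) ge)" using c(3) unfolding topspace_realization by blast
  have "((p, x, t), (p0, f p p0 x, t)) \<in> glue\<^sup>*"
  proof (cases "p = p0")
    case True
    then show ?thesis using f_id px by simp
  next
    case False
    then have "((p, x, t), (p0, f p p0 x, t)) \<in> glue"
      unfolding hocolim_glue_def using px p0P t0 by auto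
    then show ?thesis by blast
  qed
  moreover have "(p0, f p p0 x, t) \<in> topspace sum_space" using p0P t0 f_in px unfolding topspace_sum by auto
  ultimately show ?thesis using p0 p0P by blast
qed

lemma spread_determines:
  assumes "(p, x, t) \<in> topspace sum_space" "(p', x', t') \<in> topspace sum_space" "spread (p, x, t) = spread (p', x', t')"
    and "t q \<noteq> 0"
  shows "t' q = t q" "f p q x = f p' q x'"
proof -
  have px: "p \<in> P" "x \<in> D p" "t \<in> topspace (\<Delta> (below p) ge)" using assms(1) unfolding topspace_sum by auto
  obtain \<sigma> where \<sigma>: "\<sigma> \<in> order_complex (below p) ge" "t \<in> simplex_points \<sigma>"
    using topspace_below[OF px(3)] by blast
  have "spread (p', x', t') (q, f p q x) = t q"
    using spread_simplex(2)[OF px(1,2) \<sigma>] assms(3) by simp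
  then show "t' q = t q" "f p q x = f p' q x'"
    using assms(4) unfolding spread_def by (auto split: if_splits)
qed

text \<open>Equal images force equal weights, hence the same greatest carrier element, and
  \<open>spread_determines\<close> gives the same point of the diagram there. Both points are thus
  glued to one normal form.\<close>

lemma spread_kernel:
  assumes a: "a \<in> topspace sum_space" and b: "b \<in> topspace sum_space"
  shows "(a, b) \<in> (glue \<union> glue\<inverse>)\<^sup>* \<inter> topspace sum_space \<times> topspace sum_space \<longleftrightarrow> spread a = spread b"
proof
  assume "(a, b) \<in> (glue \<union> glue\<inverse>)\<^sup>* \<inter> topspace sum_space \<times> topspace sum_space"
  then have "(a, b) \<in> (glue \<union> glue\<inverse>)\<^sup>*" by blast
  then show "spread a = spread b"
    by (induction rule: rtrancl_induct) (auto dest: spread_glue)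
next
  assume eq: "spread a = spread b"
  obtain p x t where at: "a = (p, x, t)" by (cases a)
  obtain p' x' t' where bt: "b = (p', x', t')" by (cases b)
  obtain q where q: "q \<in> P" "t q \<noteq> 0" "\<And>s. t s \<noteq> 0 \<Longrightarrow> ge q s" "(a, (q, f p q x, t)) \<in> glue\<^sup>*"
    using glue_canonical a unfolding at by blast
  obtain q' where q': "q' \<in> P" "t' q' \<noteq> 0" "\<And>s. t' s \<noteq> 0 \<Longrightarrow> ge q' s" "(b, (q', f p' q' x', t')) \<in> glue\<^sup>*"
    using glue_canonical b unfolding bt by blast
  have d: "t s \<noteq> 0 \<Longrightarrow> t' s = t s \<and> f p s x = f p' s x'" for s
    using spread_determines a b eq unfolding at bt by blast
  have d': "t' s \<noteq> 0 \<Longrightarrow> t s = t' s" for s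
    using spread_determines(1)[of p' x' t' p x t] a b eq unfolding at bt by simp
  have tt: "t = t'" using d d' by (metis ext)
  then have "q = q'" using q q' ge_antisym by blast
  then have "(q, f p q x, t) = (q', f p' q' x', t')" using tt d q(2) by auto
  then have 1: "(a, (q, f p q x, t)) \<in> glue\<^sup>*" "(b, (q, f p q x, t)) \<in> glue\<^sup>*" using q q' by auto
  have "(a, (q, f p q x, t)) \<in> (glue \<union> glue\<inverse>)\<^sup>*" using 1(1) rtrancl_mono[of glue "glue \<union> glue\<inverse>"] by blast
  moreover have "((q, f p q x, t), b) \<in> (glue \<union> glue\<inverse>)\<^sup>*"
    using rtrancl_converseI[OF 1(2)] rtrancl_mono[of "glue\<inverse>" "glue \<union> glue\<inverse>"] by blast
  ultimately show "(a, b) \<in> (glue \<union> glue\<inverse>)\<^sup>* \<inter> topspace sum_space \<times> topspace sum_space"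
    using a b by (auto intro: rtrancl_trans)
qed

lemma hocolim_homeomorphic:
  "hocolim P ge (\<lambda>p. discrete_topology (D p)) f homeomorphic_space \<Delta> limit_poset limit_ge"
  unfolding hocolim_def Let_def
  by (rule quotient_topology_homeomorphic[OF equiv_generated quotient_spread spread_kernel])

end

section \<open>Faces of an arrangement as sign vectors\<close>

lemma sgn_convex_combination:
  fixes a b u v :: real
  assumes "sgn a = s" "sgn b = s" "u \<ge> 0" "v \<ge> 0" "u + v = 1"
  shows "sgn (u * a + v * b) = s"
proof -
  consider "a = 0" "b = 0" | "a > 0" "b > 0" | "a < 0" "b < 0"
    using assms by (auto simp: sgn_if split: if_splits)
  then show ?thesis
  proof cases
    case 1
    then show ?thesis using assms by simp
  next
    case 2
    then have "u * a + v * b > 0"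
      using assms by (cases "u = 0") (auto intro!: add_pos_nonneg)
    then show ?thesis using assms 2 by simp
  next
    case 3
    have "u * a + v * b < 0"
    proof (cases "u = 0")
      case True
      then show ?thesis using assms 3 by simp
    next
      case False
      then have "u * a < 0" using assms 3 by (simp add: mult_pos_neg)
      moreover have "v * b \<le> 0" using assms 3 by (simp add: mult_nonneg_nonpos)
      ultimately show ?thesis by linarith
    qed
    then show ?thesis using assms 3 by simp
  qed
qed

locale arrangement =
  fixes \<A> :: "'a::euclidean_space set set" and w :: "'a set \<Rightarrow> 'a"
  assumes arrangement: "hyperplane_arrangement \<A>"
    and w_in: "F \<in> faces \<A> \<Longrightarrow> w F \<in> F"
begin

text \<open>The choice of a normal orients the hyperplane; all signs below are relative to
  it.\<close>

definition nrm :: "'a set \<Rightarrow> 'a" where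
  "nrm H = (SOME a. a \<noteq> 0 \<and> (\<exists>b. H = {x. a \<bullet> x = b}))"

definition off :: "'a set \<Rightarrow> real" where
  "off H = (SOME b. H = {x. nrm H \<bullet> x = b})"

definition val :: "'a set \<Rightarrow> 'a \<Rightarrow> real" where
  "val H x = nrm H \<bullet> x - off H"

definition cell :: "'a set set \<Rightarrow> 'a \<Rightarrow> 'a set" where
  "cell B x = {y. \<forall>H\<in>B. sgn (val H y) = sgn (val H x)}"

text \<open>The covector of \<open>F\<close> in the sense of oriented matroids. By
  \<open>in_face_iff\<close> any other point of \<open>F\<close> gives the same signs.\<close>

definition sn :: "'a set \<Rightarrow> 'a set \<Rightarrow> real" where
  "sn F H = sgn (val H (w F))"

lemma finite_A: "finite \<A>"
  using arrangement unfolding hyperplane_arrangement_def by simp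

lemma hyperplane:
  assumes "H \<in> \<A>"
  shows "nrm H \<noteq> 0" "H = {x. nrm H \<bullet> x = off H}" "x \<in> H \<longleftrightarrow> val H x = 0"
proof -
  have "\<exists>a. a \<noteq> 0 \<and> (\<exists>b. H = {x. a \<bullet> x = b})"
    using arrangement assms unfolding hyperplane_arrangement_def by blast
  from someI_ex[OF this] have *: "nrm H \<noteq> 0" "\<exists>b. H = {x. nrm H \<bullet> x = b}"
    unfolding nrm_def by blast+
  show "nrm H \<noteq> 0" by (rule *(1))
  show H: "H = {x. nrm H \<bullet> x = off H}" unfolding off_def using someI_ex[OF *(2)] .
  show "x \<in> H \<longleftrightarrow> val H x = 0" unfolding val_def by (subst H) simp
qed

lemma val_combination: "u + v = 1 \<Longrightarrow> val H (u *\<^sub>R x + v *\<^sub>R y) = u * val H x + v * val H y"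
proof -
  assume "u + v = 1"
  then have "u * off H + v * off H = off H" by (simp flip: distrib_right)
  then show ?thesis by (simp add: val_def inner_add_right right_diff_distrib)
qed

lemma convex_cell: "convex (cell B x)"
proof (rule convexI)
  fix y z u v assume "y \<in> cell B x" "z \<in> cell B x" and uv: "0 \<le> u" "0 \<le> v" "u + v = (1::real)"
  then show "u *\<^sub>R y + v *\<^sub>R z \<in> cell B x"
    unfolding cell_def val_combination[OF uv(3)] mem_Collect_eq using sgn_convex_combination[OF _ _ uv] by blast
qed

lemma cell_self: "x \<in> cell B x"
  unfolding cell_def by simp

lemma cell_eq: "y \<in> cell B x \<Longrightarrow> cell B y = cell B x"
  unfolding cell_def by auto

text \<open>A small move from \<open>x\<close> towards \<open>y\<close> cannot change a nonzero
  sign, and on a hyperplane through \<open>x\<close> the sign of \<open>y\<close> takes over. The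
  filter \<open>at_right 0\<close> lets finitely many hyperplanes be treated at once.\<close>

lemma val_perturb:
  assumes "finite B"
  shows "\<forall>\<^sub>F d in at_right 0. \<forall>H\<in>B. sgn (val H ((1 - d) *\<^sub>R x + d *\<^sub>R y)) =
    (if val H x = 0 then sgn (val H y) else sgn (val H x))"
proof (rule eventually_ball_finite[OF assms], intro ballI)
  fix H
  have ev: "\<forall>\<^sub>F d in at_right 0. (0::real) < d" by (simp add: eventually_at_right_less)
  have eq: "val H ((1 - d) *\<^sub>R x + d *\<^sub>R y) = (1 - d) * val H x + d * val H y" for d
    by (rule val_combination) simp
  have lim: "((\<lambda>d. (1 - d) * val H x + d * val H y) \<longlongrightarrow> (1 - 0) * val H x + 0 * val H y) (at_right 0)"
    by (intro tendsto_intros)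
  show "\<forall>\<^sub>F d in at_right 0. sgn (val H ((1 - d) *\<^sub>R x + d *\<^sub>R y)) =
    (if val H x = 0 then sgn (val H y) else sgn (val H x))"
  proof -
    consider "val H x = 0" | "val H x > 0" | "val H x < 0" by linarith
    then show ?thesis
    proof cases
      case 1
      show ?thesis using ev by eventually_elim (simp add: 1 eq sgn_mult)
    next
      case 2
      then have "\<forall>\<^sub>F d in at_right 0. 0 < (1 - d) * val H x + d * val H y"
        using order_tendstoD(1)[OF lim, of 0] by simp
      then show ?thesis by eventually_elim (use 2 in \<open>simp add: eq\<close>)
    next
      case 3
      then have "\<forall>\<^sub>F d in at_right 0. (1 - d) * val H x + d * val H y < 0"
        using order_tendstoD(2)[OF lim, of 0] by simp
      then show ?thesis by eventually_elim (use 3 in \<open>simp add: eq\<close>)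
    qed
  qed
qed

lemma val_perturb_ex:
  assumes "finite B"
  shows "\<exists>d. \<forall>H\<in>B. sgn (val H ((1 - d) *\<^sub>R x + d *\<^sub>R y)) =
    (if val H x = 0 then sgn (val H y) else sgn (val H x))"
  by (rule eventually_happens'[OF _ val_perturb[OF assms]]) simp

text \<open>A cell is convex, hence connected. Conversely a connected set that avoids a hyperplane
  lies on one side of it by the intermediate value theorem.\<close>

lemma connected_component_cell:
  assumes "B \<subseteq> \<A>" "x \<in> S" "cell B x \<subseteq> S" "\<And>H. H \<in> B \<Longrightarrow> S \<subseteq> H \<or> S \<inter> H = {}"
  shows "connected_component_set S x = cell B x"
proof
  show "cell B x \<subseteq> connected_component_set S x"
    using assms cell_self convex_cell by (intro connected_component_maximal convex_connected)
  show "connected_component_set S x \<subseteq> cell B x"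
  proof
    fix y assume "y \<in> connected_component_set S x"
    then obtain T where T: "connected T" "T \<subseteq> S" "x \<in> T" "y \<in> T"
      unfolding connected_component_def by auto
    have "sgn (val H y) = sgn (val H x)" if H: "H \<in> B" for H
    proof (cases "S \<subseteq> H")
      case True
      then have "x \<in> H" "y \<in> H" using T by auto
      then show ?thesis using hyperplane(3) H assms(1) by auto
    next
      case False
      then have dis: "val H z \<noteq> 0" if "z \<in> T" for z
        using assms(1) assms(4)[OF H] H that T(2) hyperplane(3) by blast
      have no: False if "a \<in> T" "b \<in> T" "val H a < 0" "0 < val H b" for a b
      proof -
        have "nrm H \<bullet> a \<le> off H" "off H \<le> nrm H \<bullet> b" using that unfolding val_def by auto
        with connected_ivt_hyperplane[OF T(1) that(1,2)] obtain z where "z \<in> T" "nrm H \<bullet> z = off H"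
          by blast
        then show False using dis unfolding val_def by auto
      qed
      show ?thesis using no[OF T(3,4)] no[OF T(4,3)] dis[OF T(3)] dis[OF T(4)]
        by (cases "val H x" "0::real" rule: linorder_cases; cases "val H y" "0::real" rule: linorder_cases) simp_all
    qed
    then show "y \<in> cell B x" unfolding cell_def by blast
  qed
qed

text \<open>Formulated for subarrangements because \<open>chamber_at\<close> refers to the chambers
  of a localization and \<open>separates\<close> to those of a single hyperplane.\<close>

lemma cell_in_chambers_iff:
  assumes "B \<subseteq> \<A>"
  shows "chambers B = {cell B x | x. \<forall>H\<in>B. val H x \<noteq> 0}"
proof -
  have S: "x \<in> UNIV - \<Union>B \<longleftrightarrow> (\<forall>H\<in>B. val H x \<noteq> 0)" for x
    using hyperplane(3) assms by blast
  have "connected_component_set (UNIV - \<Union>B) x = cell B x" if "\<forall>H\<in>B. val H x \<noteq> 0" for x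
  proof (rule connected_component_cell[OF assms])
    show "x \<in> UNIV - \<Union>B" using S that by blast
    show "cell B x \<subseteq> UNIV - \<Union>B"
      using that unfolding cell_def by (auto simp only: S subset_iff mem_Collect_eq) (metis sgn_zero_iff)
  qed blast
  then show ?thesis unfolding chambers_def components_def using S by (auto simp: image_iff) blast+
qed

lemma faces_eq: "faces \<A> = range (cell \<A>)"
proof -
  define St where "St \<B> = \<Inter>\<B> - \<Union>{H\<in>\<A>. \<not> \<Inter>\<B> \<subseteq> H}" for \<B> :: "'a set set"
  have cc: "connected_component_set (St \<B>) x = cell \<A> x" if "\<B> \<subseteq> \<A>" "x \<in> St \<B>" for \<B> x
  proof (rule connected_component_cell[OF order_refl that(2)])
    show "cell \<A> x \<subseteq> St \<B>"
    proof
      fix y assume y: "y \<in> cell \<A> x"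
      have mem: "y \<in> H \<longleftrightarrow> x \<in> H" if "H \<in> \<A>" for H
      proof -
        have "sgn (val H y) = sgn (val H x)" using y that unfolding cell_def by blast
        then have "val H y = 0 \<longleftrightarrow> val H x = 0" by (metis sgn_zero_iff)
        then show ?thesis using hyperplane(3)[OF that] by simp
      qed
      have "y \<in> \<Inter>\<B>" using mem that unfolding St_def by blast
      moreover have "y \<notin> H" if "H \<in> \<A>" "\<not> \<Inter>\<B> \<subseteq> H" for H
        using mem[OF that(1)] that \<open>x \<in> St \<B>\<close> unfolding St_def by blast
      ultimately show "y \<in> St \<B>" unfolding St_def by blast
    qed
    show "St \<B> \<subseteq> H \<or> St \<B> \<inter> H = {}" if "H \<in> \<A>" for H
      using that unfolding St_def by blast
  qed
  show ?thesis
  proof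
    show "faces \<A> \<subseteq> range (cell \<A>)"
    proof
      fix F assume "F \<in> faces \<A>"
      then obtain \<B> where \<B>: "\<B> \<subseteq> \<A>" "F \<in> components (St \<B>)" unfolding faces_def St_def by blast
      then obtain x where "x \<in> St \<B>" "F = connected_component_set (St \<B>) x"
        unfolding components_def by auto
      then show "F \<in> range (cell \<A>)" using cc[OF \<B>(1)] by auto
    qed
    show "range (cell \<A>) \<subseteq> faces \<A>"
    proof clarify
      fix x
      \<comment> \<open>The hyperplanes through \<open>x\<close> cut out the flat whose open stratum
        contains \<open>x\<close>.\<close>
      define \<B> where "\<B> = {H\<in>\<A>. x \<in> H}"
      have x: "x \<in> St \<B>" unfolding St_def \<B>_def by auto
      have \<B>: "\<B> \<subseteq> \<A>" unfolding \<B>_def by auto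
      have "cell \<A> x \<in> components (St \<B>)" using cc[OF \<B> x] x unfolding components_def by blast
      then show "cell \<A> x \<in> faces \<A>" using \<B> unfolding faces_def St_def by blast
    qed
  qed
qed

lemma cell_w:
  assumes "F \<in> faces \<A>"
  shows "cell \<A> (w F) = F"
proof -
  obtain x where x: "F = cell \<A> x" using assms unfolding faces_eq by blast
  then have "w F \<in> cell \<A> x" using w_in[OF assms] by simp
  then show ?thesis using cell_eq x by simp
qed

lemma in_face_iff:
  assumes "F \<in> faces \<A>"
  shows "x \<in> F \<longleftrightarrow> (\<forall>H\<in>\<A>. sgn (val H x) = sn F H)"
proof -
  have "x \<in> cell \<A> (w F) \<longleftrightarrow> (\<forall>H\<in>\<A>. sgn (val H x) = sn F H)"
    unfolding cell_def sn_def by simp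
  then show ?thesis unfolding cell_w[OF assms] .
qed

lemma cell_face [simp]: "cell \<A> x \<in> faces \<A>"
  unfolding faces_eq by simp

lemma sn_cell: "H \<in> \<A> \<Longrightarrow> sn (cell \<A> x) H = sgn (val H x)"
  using in_face_iff[OF cell_face, of x x] cell_self[of x \<A>] by simp

lemma face_eqI: "\<lbrakk>F \<in> faces \<A>; G \<in> faces \<A>; \<And>H. H \<in> \<A> \<Longrightarrow> sn F H = sn G H\<rbrakk> \<Longrightarrow> F = G"
  by (rule set_eqI) (simp add: in_face_iff)

lemma sn_cases: "sn F H = 0 \<or> sn F H = 1 \<or> sn F H = -1"
  unfolding sn_def by (simp add: sgn_if)

text \<open>The right-hand side is given by weak linear inequalities and equations, so it is closed.
  Conversely, a segment from such a point \<open>x\<close> towards \<open>w F\<close> enters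
  \<open>F\<close> immediately, by \<open>val_perturb\<close>.\<close>

lemma closure_face:
  assumes "F \<in> faces \<A>"
  shows "closure F = {x. \<forall>H\<in>\<A>. val H x = 0 \<or> sgn (val H x) = sn F H}"
proof
  have "{x. \<forall>H\<in>\<A>. val H x = 0 \<or> sgn (val H x) = sn F H} =
      (\<Inter>H\<in>\<A>. {x. val H x * sn F H \<ge> 0 \<and> (sn F H = 0 \<longrightarrow> val H x = 0)})"
    using sn_cases[of F] by (fastforce simp: sgn_if mult_le_0_iff zero_le_mult_iff split: if_splits)
  moreover have "closed {x. val H x * sn F H \<ge> 0 \<and> (sn F H = 0 \<longrightarrow> val H x = 0)}" for H
    unfolding val_def
    by (intro closed_Collect_conj closed_Collect_imp closed_Collect_le closed_Collect_eq continuous_intros) auto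
  ultimately have "closed {x. \<forall>H\<in>\<A>. val H x = 0 \<or> sgn (val H x) = sn F H}"
    by (simp add: closed_INT)
  moreover have "F \<subseteq> {x. \<forall>H\<in>\<A>. val H x = 0 \<or> sgn (val H x) = sn F H}"
    using in_face_iff[OF assms] by blast
  ultimately show "closure F \<subseteq> {x. \<forall>H\<in>\<A>. val H x = 0 \<or> sgn (val H x) = sn F H}"
    by (rule closure_minimal[rotated])
  show "{x. \<forall>H\<in>\<A>. val H x = 0 \<or> sgn (val H x) = sn F H} \<subseteq> closure F"
  proof
    fix x assume x: "x \<in> {x. \<forall>H\<in>\<A>. val H x = 0 \<or> sgn (val H x) = sn F H}"
    have ev: "\<forall>\<^sub>F d in at_right 0. (1 - d) *\<^sub>R x + d *\<^sub>R w F \<in> F"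
      using val_perturb[OF finite_A, of x "w F"]
    proof eventually_elim
      case (elim d)
      then show ?case using x unfolding in_face_iff[OF assms] by (auto simp: sn_def)
    qed
    have "((\<lambda>d. (1 - d) *\<^sub>R x + d *\<^sub>R w F) \<longlongrightarrow> (1 - 0) *\<^sub>R x + 0 *\<^sub>R w F) (at_right 0)"
      by (intro tendsto_intros)
    then have "((\<lambda>d. (1 - d) *\<^sub>R x + d *\<^sub>R w F) \<longlongrightarrow> x) (at_right 0)" by simp
    moreover have "\<forall>\<^sub>F d in at_right 0. (1 - d) *\<^sub>R x + d *\<^sub>R w F \<in> closure F"
      using ev by eventually_elim (use closure_subset in blast)
    ultimately show "x \<in> closure F"
      by (intro Lim_in_closed_set[OF closed_closure]) simp_all
  qed
qed

lemma face_subset_closure_iff: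
  assumes "F \<in> faces \<A>" "G \<in> faces \<A>"
  shows "F \<subseteq> closure G \<longleftrightarrow> (\<forall>H\<in>\<A>. sn F H = 0 \<or> sn F H = sn G H)"
  unfolding closure_face[OF assms(2)]
proof
  assume "F \<subseteq> {x. \<forall>H\<in>\<A>. val H x = 0 \<or> sgn (val H x) = sn G H}"
  then have "w F \<in> {x. \<forall>H\<in>\<A>. val H x = 0 \<or> sgn (val H x) = sn G H}" using w_in[OF assms(1)] by (rule subsetD)
  then show "\<forall>H\<in>\<A>. sn F H = 0 \<or> sn F H = sn G H" unfolding sn_def by (simp add: sgn_zero_iff)
next
  assume "\<forall>H\<in>\<A>. sn F H = 0 \<or> sn F H = sn G H"
  then show "F \<subseteq> {x. \<forall>H\<in>\<A>. val H x = 0 \<or> sgn (val H x) = sn G H}"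
    using in_face_iff[OF assms(1)] by (fastforce simp: sgn_zero_iff)
qed

lemma face_ge_iff:
  assumes "F \<in> faces \<A>" "G \<in> faces \<A>"
  shows "face_ge F G \<longleftrightarrow> (\<forall>H\<in>\<A>. sn F H = 0 \<or> sn F H = sn G H)"
  using face_subset_closure_iff[OF assms] closure_minimal[of F "closure G"] closure_subset[of F]
  unfolding face_ge_def by auto

lemma face_ge_refl: "face_ge F F"
  unfolding face_ge_def by simp

lemma face_ge_trans: "face_ge F G \<Longrightarrow> face_ge G E \<Longrightarrow> face_ge F E"
  unfolding face_ge_def by simp

lemma face_ge_antisym: "\<lbrakk>F \<in> faces \<A>; G \<in> faces \<A>; face_ge F G; face_ge G F\<rbrakk> \<Longrightarrow> F = G"
proof (rule face_eqI)
  fix H assume "F \<in> faces \<A>" "G \<in> faces \<A>" "face_ge F G" "face_ge G F" "H \<in> \<A>"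
  then have "sn F H = 0 \<or> sn F H = sn G H" "sn G H = 0 \<or> sn G H = sn F H"
    using face_ge_iff[of F G] face_ge_iff[of G F] by blast+
  then show "sn F H = sn G H" by auto
qed

section \<open>Chambers and the covector operations\<close>

lemma chambers_iff: "C \<in> chambers \<A> \<longleftrightarrow> C \<in> faces \<A> \<and> (\<forall>H\<in>\<A>. sn C H \<noteq> 0)"
proof
  assume "C \<in> chambers \<A>"
  then obtain x where "C = cell \<A> x" "\<forall>H\<in>\<A>. val H x \<noteq> 0"
    unfolding cell_in_chambers_iff[OF order_refl] mem_Collect_eq by (elim exE conjE)
  then show "C \<in> faces \<A> \<and> (\<forall>H\<in>\<A>. sn C H \<noteq> 0)" by (simp add: sn_cell sgn_zero_iff)
next
  assume "C \<in> faces \<A> \<and> (\<forall>H\<in>\<A>. sn C H \<noteq> 0)"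
  then show "C \<in> chambers \<A>"
    unfolding cell_in_chambers_iff[OF order_refl] sn_def mem_Collect_eq using cell_w[of C]
    by (intro exI[of _ "w C"]) (simp add: sgn_zero_iff)
qed

lemma chamber_face: "C \<in> chambers \<A> \<Longrightarrow> C \<in> faces \<A>"
  by (simp add: chambers_iff)

text \<open>Finitely many hyperplanes do not cover the space: a point off the hyperplanes of
  \<open>B\<close> is moved slightly towards a point off the next one, which keeps the earlier
  values nonzero.\<close>

lemma chambers_nonempty: "chambers \<A> \<noteq> {}"
proof -
  have "\<exists>x. \<forall>H\<in>B. val H x \<noteq> 0" if "finite B" "B \<subseteq> \<A>" for B
    using that
  proof (induction B)
    case empty
    then show ?case by simp
  next
    case (insert H B)
    then obtain x where x: "\<forall>H\<in>B. val H x \<noteq> 0" by auto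
    have "H \<in> \<A>" using insert by auto
    \<comment> \<open>The value changes along the normal, so at least one of the two points is off
      \<open>H\<close>.\<close>
    have "val H (x + nrm H) \<noteq> val H x"
      using hyperplane(1)[OF \<open>H \<in> \<A>\<close>] unfolding val_def by (simp add: inner_add_right)
    then obtain y where y: "val H y \<noteq> 0" by (metis (full_types))
    obtain d where d: "\<forall>H\<in>insert H B. sgn (val H ((1 - d) *\<^sub>R x + d *\<^sub>R y)) =
        (if val H x = 0 then sgn (val H y) else sgn (val H x))"
      using val_perturb_ex[of "insert H B" x y] insert by auto
    have "val G ((1 - d) *\<^sub>R x + d *\<^sub>R y) \<noteq> 0" if "G \<in> insert H B" for G
    proof (cases "val G x = 0")
      case True
      then have "G = H" using x that by auto
      then show ?thesis using bspec[OF d that] True y by (auto simp: sgn_zero_iff)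
    next
      case False
      then show ?thesis using bspec[OF d that] by (auto simp: sgn_zero_iff)
    qed
    then show ?case by blast
  qed
  from this[OF finite_A order_refl] obtain x where "\<forall>H\<in>\<A>. val H x \<noteq> 0" ..
  then have "cell \<A> x \<in> chambers \<A>" unfolding cell_in_chambers_iff[OF order_refl] by auto
  then show ?thesis by auto
qed

text \<open>Composition of covectors: \<open>E\<close> is the face entered when leaving
  \<open>w F\<close> slightly towards \<open>w G\<close>.\<close>

lemma face_composition:
  assumes "F \<in> faces \<A>" "G \<in> faces \<A>"
  obtains E where "E \<in> faces \<A>" "\<And>H. H \<in> \<A> \<Longrightarrow> sn E H = (if sn F H = 0 then sn G H else sn F H)"
proof -
  obtain d where d: "\<forall>H\<in>\<A>. sgn (val H ((1 - d) *\<^sub>R w F + d *\<^sub>R w G)) =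
      (if val H (w F) = 0 then sgn (val H (w G)) else sgn (val H (w F)))"
    using val_perturb_ex[OF finite_A, of "w F" "w G"] by blast
  show thesis
  proof (rule that[of "cell \<A> ((1 - d) *\<^sub>R w F + d *\<^sub>R w G)"])
    fix H assume "H \<in> \<A>"
    then show "sn (cell \<A> ((1 - d) *\<^sub>R w F + d *\<^sub>R w G)) H = (if sn F H = 0 then sn G H else sn F H)"
      using bspec[OF d] unfolding sn_cell[OF \<open>H \<in> \<A>\<close>] by (simp add: sn_def sgn_zero_iff)
  qed simp
qed

text \<open>Elimination of covectors: \<open>E\<close> contains the point where the segment from
  \<open>w F\<close> to \<open>w G\<close> meets \<open>H\<close>. Along the segment a sign is
  constant on every hyperplane where the ends agree.\<close>

lemma face_elimination:
  assumes "F \<in> faces \<A>" "G \<in> faces \<A>" "H \<in> \<A>" "sn F H \<noteq> sn G H" "sn F H \<noteq> 0" "sn G H \<noteq> 0"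
  obtains E where "E \<in> faces \<A>" "sn E H = 0"
    "\<And>H'. H' \<in> \<A> \<Longrightarrow> sn F H' = sn G H' \<Longrightarrow> sn E H' = sn F H'"
proof -
  define a b where "a = val H (w F)" "b = val H (w G)"
  have ab: "a < 0 \<and> b > 0 \<or> a > 0 \<and> b < 0"
    using assms(4-6) unfolding sn_def a_b_def by (auto simp: sgn_if split: if_splits)
  define u where "u = a / (a - b)"
  have u: "0 \<le> u" "u \<le> 1" "(1 - u) * a + u * b = 0"
    using ab unfolding u_def by (auto simp: divide_simps field_simps)
  define z where "z = (1 - u) *\<^sub>R w F + u *\<^sub>R w G"
  have z: "val H' z = (1 - u) * val H' (w F) + u * val H' (w G)" for H'
    unfolding z_def by (rule val_combination) simp
  show thesis
  proof (rule that[of "cell \<A> z"])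
    show "sn (cell \<A> z) H = 0" using assms(3) z[of H] u(3) unfolding a_b_def by (simp add: sn_cell)
    fix H' assume H': "H' \<in> \<A>" "sn F H' = sn G H'"
    have "sgn (val H' z) = sn F H'"
      unfolding z using u H'(2) by (intro sgn_convex_combination) (simp_all add: sn_def)
    then show "sn (cell \<A> z) H' = sn F H'" unfolding sn_cell[OF H'(1)] .
  qed simp
qed

lemma hyperplanes_distinct:
  assumes "H1 \<in> \<A>" "H2 \<in> \<A>" "H1 \<noteq> H2"
  obtains F where "F \<in> faces \<A>" "sn F H1 = 0 \<and> sn F H2 \<noteq> 0 \<or> sn F H1 \<noteq> 0 \<and> sn F H2 = 0"
proof -
  obtain x where "x \<in> H1 \<and> x \<notin> H2 \<or> x \<notin> H1 \<and> x \<in> H2" using assms(3) by blast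
  then show thesis
    using that[of "cell \<A> x"] assms(1,2) hyperplane(3) by (auto simp: sn_cell sgn_zero_iff)
qed

lemma localization_face:
  assumes "F \<in> faces \<A>"
  shows "localization \<A> F = {H\<in>\<A>. sn F H = 0}"
proof -
  have "affine hull F \<subseteq> H \<longleftrightarrow> sn F H = 0" if H: "H \<in> \<A>" for H
  proof
    assume "affine hull F \<subseteq> H"
    then have "w F \<in> H" using w_in[OF assms] hull_subset[of F affine] by blast
    then show "sn F H = 0" using hyperplane(3)[OF H] unfolding sn_def by simp
  next
    assume "sn F H = 0"
    then have "F \<subseteq> H" using in_face_iff[OF assms] H hyperplane(3)[OF H] by (metis sgn_zero_iff subsetI)
    moreover have "affine H" using hyperplane(2)[OF H] affine_hyperplane by metis
    ultimately show "affine hull F \<subseteq> H" by (rule hull_minimal)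
  qed
  then show ?thesis unfolding localization_def by blast
qed

text \<open>\<open>chamber_at \<A> F C\<close> is the composition of the covectors of
  \<open>F\<close> and \<open>C\<close>. Having \<open>F\<close> in the closure fixes the signs
  where \<open>F\<close> is nonzero, and sharing a chamber of the localization with \<open>C\<close>
  fixes the others.\<close>

lemma chamber_at:
  assumes F: "F \<in> faces \<A>" and C: "C \<in> chambers \<A>"
  shows "chamber_at \<A> F C \<in> chambers \<A>"
    and "H \<in> \<A> \<Longrightarrow> sn (chamber_at \<A> F C) H = (if sn F H = 0 then sn C H else sn F H)"
proof -
  have Cf: "C \<in> faces \<A>" using C by (rule chamber_face)
  obtain E where E: "E \<in> faces \<A>" "\<And>H. H \<in> \<A> \<Longrightarrow> sn E H = (if sn F H = 0 then sn C H else sn F H)"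
    using face_composition[OF F Cf] by blast
  have Ec: "E \<in> chambers \<A>" using E C unfolding chambers_iff by simp
  let ?L = "localization \<A> F"
  have L: "?L = {H\<in>\<A>. sn F H = 0}" by (rule localization_face[OF F])
  have LA: "?L \<subseteq> \<A>" using L by auto
  define K where "K = cell ?L (w C)"
  have in_K: "D \<subseteq> K" if "D \<in> faces \<A>" "\<And>H. H \<in> ?L \<Longrightarrow> sn D H = sn C H" for D
    using that LA in_face_iff[OF that(1)] unfolding K_def cell_def sn_def by auto
  have K: "K \<in> chambers ?L"
    unfolding cell_in_chambers_iff[OF LA] K_def using C LA unfolding chambers_iff sn_def by (auto simp: sgn_zero_iff)
  have "chamber_at \<A> F C = E"
    unfolding chamber_at_def
  proof (rule the_equality)
    show "E \<in> chambers \<A> \<and> F \<subseteq> closure E \<and> (\<exists>K\<in>chambers ?L. C \<subseteq> K \<and> E \<subseteq> K)"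
      using Ec E K in_K[OF Cf] in_K[OF E(1)] L face_subset_closure_iff[OF F E(1)] by auto
  next
    fix D assume D: "D \<in> chambers \<A> \<and> F \<subseteq> closure D \<and> (\<exists>K\<in>chambers ?L. C \<subseteq> K \<and> D \<subseteq> K)"
    then have Df: "D \<in> faces \<A>" by (auto intro: chamber_face)
    obtain z where z: "C \<subseteq> cell ?L z" "D \<subseteq> cell ?L z"
      using D unfolding cell_in_chambers_iff[OF LA] by auto
    show "D = E"
    proof (rule face_eqI[OF Df E(1)])
      fix H assume H: "H \<in> \<A>"
      show "sn D H = sn E H"
      proof (cases "sn F H = 0")
        case True
        then have "H \<in> ?L" using L H by simp
        moreover have "w C \<in> cell ?L z" "w D \<in> cell ?L z" using z w_in Cf Df by auto
        ultimately have "sn D H = sn C H" unfolding cell_def sn_def by simp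
        then show ?thesis using E(2)[OF H] True by simp
      next
        case False
        then show ?thesis using E(2)[OF H] face_subset_closure_iff[OF F Df] D H by auto
      qed
    qed
  qed
  then show "chamber_at \<A> F C \<in> chambers \<A>"
    "H \<in> \<A> \<Longrightarrow> sn (chamber_at \<A> F C) H = (if sn F H = 0 then sn C H else sn F H)"
    by (simp_all only: Ec E(2))
qed

lemma separates_iff:
  assumes "H \<in> \<A>" "C \<in> chambers \<A>" "D \<in> chambers \<A>"
  shows "separates H C D \<longleftrightarrow> sn C H \<noteq> sn D H"
proof -
  have f: "C \<in> faces \<A>" "D \<in> faces \<A>"
    by (rule chamber_face[OF assms(2)], rule chamber_face[OF assms(3)])
  have ch: "chambers {H} = {cell {H} x | x. val H x \<noteq> 0}"
    by (subst cell_in_chambers_iff) (use assms(1) in auto)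
  have "(\<exists>K\<in>chambers {H}. C \<subseteq> K \<and> D \<subseteq> K) \<longleftrightarrow> sn C H = sn D H"
  proof
    assume "\<exists>K\<in>chambers {H}. C \<subseteq> K \<and> D \<subseteq> K"
    then obtain x where "C \<subseteq> cell {H} x" "D \<subseteq> cell {H} x" unfolding ch by blast
    then have "w C \<in> cell {H} x" "w D \<in> cell {H} x" using w_in f by auto
    then show "sn C H = sn D H" unfolding cell_def sn_def by simp
  next
    assume eq: "sn C H = sn D H"
    have "val H (w C) \<noteq> 0" using assms unfolding chambers_iff sn_def by auto
    then have "cell {H} (w C) \<in> chambers {H}" unfolding ch by blast
    moreover have "C \<subseteq> cell {H} (w C)" "D \<subseteq> cell {H} (w C)"
      using in_face_iff f assms(1) eq unfolding cell_def sn_def by auto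
    ultimately show "\<exists>K\<in>chambers {H}. C \<subseteq> K \<and> D \<subseteq> K" by blast
  qed
  then show ?thesis unfolding separates_def by simp
qed

end

section \<open>Local systems on the face poset\<close>

text \<open>A functor from the face poset to sets and bijections. In the application
  \<open>\<Phi> F\<close> is the fibre over the vertex \<open>(F, chamber_at \<A> F C)\<close> for a
  fixed chamber \<open>C\<close>.\<close>

locale local_system = arrangement \<A> w for \<A> :: "'a::euclidean_space set set" and w +
  fixes \<Phi> :: "'a set \<Rightarrow> 's set" and T :: "'a set \<Rightarrow> 'a set \<Rightarrow> 's \<Rightarrow> 's"
  assumes T_bij: "\<lbrakk>F \<in> faces \<A>; G \<in> faces \<A>; face_ge F G\<rbrakk> \<Longrightarrow> bij_betw (T F G) (\<Phi> F) (\<Phi> G)"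
    and T_comp: "\<lbrakk>F \<in> faces \<A>; G \<in> faces \<A>; E \<in> faces \<A>; face_ge F G; face_ge G E; u \<in> \<Phi> F\<rbrakk>
      \<Longrightarrow> T G E (T F G u) = T F E u"
begin

lemma T_in: "\<lbrakk>F \<in> faces \<A>; G \<in> faces \<A>; face_ge F G; u \<in> \<Phi> F\<rbrakk> \<Longrightarrow> T F G u \<in> \<Phi> G"
  using T_bij bij_betwE by blast

lemma T_inj: "\<lbrakk>F \<in> faces \<A>; G \<in> faces \<A>; face_ge F G; u \<in> \<Phi> F; v \<in> \<Phi> F; T F G u = T F G v\<rbrakk> \<Longrightarrow> u = v"
  using T_bij[of F G] unfolding bij_betw_def inj_on_def by blast

lemma T_surj: "\<lbrakk>F \<in> faces \<A>; G \<in> faces \<A>; face_ge F G; v \<in> \<Phi> G\<rbrakk> \<Longrightarrow> \<exists>u\<in>\<Phi> F. T F G u = v"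
  using bij_betw_imp_surj_on[OF T_bij[of F G]] by (metis imageE)

text \<open>\<open>T F F\<close> is idempotent by \<open>T_comp\<close> and injective, hence the
  identity.\<close>

lemma T_id: "F \<in> faces \<A> \<Longrightarrow> u \<in> \<Phi> F \<Longrightarrow> T F F u = u"
  by (rule T_inj[of F F]) (simp_all add: face_ge_refl T_comp T_in)

definition flat :: "('a set \<Rightarrow> 's) \<Rightarrow> 'a set set \<Rightarrow> bool" where
  "flat s R \<longleftrightarrow> (\<forall>F\<in>R. s F \<in> \<Phi> F) \<and> (\<forall>F\<in>R. \<forall>G\<in>R. face_ge F G \<longrightarrow> T F G (s F) = s G)"

text \<open>The faces in a convex piece of the space: for a face \<open>F\<close>, an empty
  \<open>B\<close> gives the whole face poset and \<open>B = \<A>\<close> only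
  \<open>F\<close>.\<close>

definition region :: "'a set set \<Rightarrow> 'a set \<Rightarrow> 'a set set" where
  "region B F = {E \<in> faces \<A>. \<forall>H\<in>B. sn E H = sn F H}"

text \<open>What simple connectivity means for the local system: every value extends to a flat
  section, and a flat section is determined by any one of its values.\<close>

definition simply_flat :: "'a set set \<Rightarrow> bool" where
  "simply_flat R \<longleftrightarrow> (\<forall>E\<in>R. \<forall>u\<in>\<Phi> E. \<exists>s. flat s R \<and> s E = u) \<and>
     (\<forall>s s'. flat s R \<longrightarrow> flat s' R \<longrightarrow> (\<forall>E\<in>R. \<forall>G\<in>R. s E = s' E \<longrightarrow> s G = s' G))"

lemma flat_subset: "flat s R \<Longrightarrow> Q \<subseteq> R \<Longrightarrow> flat s Q"
  unfolding flat_def by blast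

lemma flat_in: "flat s R \<Longrightarrow> F \<in> R \<Longrightarrow> s F \<in> \<Phi> F"
  unfolding flat_def by blast

lemma flat_T: "flat s R \<Longrightarrow> F \<in> R \<Longrightarrow> G \<in> R \<Longrightarrow> face_ge F G \<Longrightarrow> T F G (s F) = s G"
  unfolding flat_def by blast

lemma simply_flat_ex: "\<lbrakk>simply_flat R; E \<in> R; u \<in> \<Phi> E\<rbrakk> \<Longrightarrow> \<exists>s. flat s R \<and> s E = u"
  unfolding simply_flat_def by blast

lemma simply_flat_unique:
  assumes "simply_flat R" "flat s R" "flat s' R" "E \<in> R" "G \<in> R" "s E = s' E"
  shows "s G = s' G"
  using assms(1)[unfolded simply_flat_def, THEN conjunct2, rule_format, OF assms(2-6)] .

lemma region_face: "E \<in> region B F \<Longrightarrow> E \<in> faces \<A>"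
  unfolding region_def by blast

text \<open>
  Induction on the number of hyperplanes not in \<open>B\<close>. A further hyperplane \<open>H\<close> cuts the region into the
  parts \<open>Q e\<close>, where \<open>e\<close> is the sign of \<open>H\<close>, and flat sections over \<open>Q 1\<close> and \<open>Q (-1)\<close> are glued to one over
  \<open>Q 0\<close>. A face \<open>F\<close> in \<open>Q 0\<close> has a well-defined continuation to \<open>Q e\<close> because the faces of \<open>Q e\<close> with \<open>F\<close>
  in their closure again form a region, to which the induction hypothesis applies.
\<close>

lemma simply_flat_region:
  assumes "B \<subseteq> \<A>" "F0 \<in> faces \<A>"
  shows "simply_flat (region B F0)"
  using assms
proof (induction "card (\<A> - B)" arbitrary: B F0 rule: less_induct)
  case less
  note F0 = \<open>F0 \<in> faces \<A>\<close>
  let ?R = "region B F0"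
  show ?case
  proof (cases "B = \<A>")
    case True
    have "?R = {F0}"
    proof
      show "?R \<subseteq> {F0}" unfolding True region_def using face_eqI[OF _ F0] by blast
      show "{F0} \<subseteq> ?R" unfolding region_def using F0 by blast
    qed
    moreover have "flat (\<lambda>_. u) {F0}" if "u \<in> \<Phi> F0" for u
      using T_id[OF F0] that unfolding flat_def by simp
    ultimately show ?thesis unfolding simply_flat_def by auto
  next
    case False
    then obtain H where H: "H \<in> \<A>" "H \<notin> B" using less.prems by blast
    have IH: "simply_flat (region B' E)" if "insert H B \<subseteq> B'" "B' \<subseteq> \<A>" "E \<in> faces \<A>" for B' E
    proof (rule less.hyps[OF _ that(2,3)])
      have "\<A> - B' \<subset> \<A> - B" using that H by blast
      then show "card (\<A> - B') < card (\<A> - B)" using finite_A by (intro psubset_card_mono) auto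
    qed
    have HB: "insert H B \<subseteq> \<A>" using H less.prems by blast
    define Q where "Q e = {E \<in> ?R. sn E H = e}" for e
    have QR: "Q e \<subseteq> ?R" for e unfolding Q_def by blast
    have Q_face: "E \<in> faces \<A>" if "E \<in> Q e" for E e using that unfolding Q_def region_def by blast
    have Q_region: "Q e = region (insert H B) E" if "E \<in> Q e" for E e
      using that unfolding Q_def region_def by auto
    have Q_sf: "simply_flat (Q e)" for e
    proof (cases "Q e = {}")
      case True
      then show ?thesis unfolding simply_flat_def by simp
    next
      case False
      then obtain E where E: "E \<in> Q e" by blast
      show ?thesis unfolding Q_region[OF E] by (rule IH[OF order_refl HB Q_face[OF E]])
    qed
    \<comment> \<open>The composition of \<open>F\<close> with \<open>E\<close> has the sign of
      \<open>E\<close> on \<open>H\<close>, because \<open>F\<close> lies on \<open>H\<close>, and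
      stays in the region because both factors have the same signs on \<open>B\<close>.\<close>
    have comp: "\<exists>G \<in> Q e. face_ge F G" if F: "F \<in> Q 0" and E: "E \<in> Q e" for F E e
    proof -
      note f = Q_face[OF F] Q_face[OF E]
      obtain G where G: "G \<in> faces \<A>" "\<And>H'. H' \<in> \<A> \<Longrightarrow> sn G H' = (if sn F H' = 0 then sn E H' else sn F H')"
        using face_composition[OF f] by blast
      have "sn G H = e" using G(2)[OF H(1)] F E unfolding Q_def by simp
      moreover have "sn G H' = sn F0 H'" if "H' \<in> B" for H'
        using G(2)[of H'] F E less.prems(1) that unfolding Q_def region_def by auto
      ultimately have "G \<in> Q e" using G(1) unfolding Q_def region_def by blast
      moreover have "face_ge F G" unfolding face_ge_iff[OF f(1) G(1)] using G(2) by simp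
      ultimately show ?thesis by blast
    qed
    have star: "T F E x = s E"
      if F: "F \<in> Q 0" and s: "flat s (Q e)" and E: "E \<in> Q e" "face_ge F E"
        and E': "E' \<in> Q e" "face_ge F E'" "x \<in> \<Phi> F" "T F E' x = s E'" for F s e E E' x
    proof -
      \<comment> \<open>Fixing in addition the signs where \<open>F\<close> is nonzero cuts
        \<open>Q e\<close> down to exactly the faces that have \<open>F\<close> in their
        closure.\<close>
      let ?B = "insert H B \<union> {H' \<in> \<A>. sn F H' \<noteq> 0}"
      note Ff = Q_face[OF F] and E'f = Q_face[OF E'(1)] and Ef = Q_face[OF E(1)]
      have sf: "simply_flat (region ?B E')" by (rule IH[OF _ _ E'f]) (use HB in blast)+
      have sub: "region ?B E' \<subseteq> Q e" unfolding Q_region[OF E'(1)] region_def by blast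
      have below: "face_ge F G" if "G \<in> region ?B E'" for G
      proof -
        have "sn F H' = 0 \<or> sn F H' = sn G H'" if "H' \<in> \<A>" for H'
        proof (cases "sn F H' = 0")
          case False
          then have "sn G H' = sn E' H'" using \<open>G \<in> region ?B E'\<close> that unfolding region_def by blast
          then show ?thesis using E'(2)[unfolded face_ge_iff[OF Ff E'f]] that by auto
        qed simp
        then show ?thesis using face_ge_iff[OF Ff region_face[OF that]] by blast
      qed
      have E_in: "E \<in> region ?B E'"
      proof -
        have "sn E H' = sn E' H'" if "H' \<in> \<A>" "sn F H' \<noteq> 0" for H'
          using E(2)[unfolded face_ge_iff[OF Ff Ef]] E'(2)[unfolded face_ge_iff[OF Ff E'f]] that by metis
        moreover have "E \<in> region (insert H B) E'" using E(1) unfolding Q_region[OF E'(1)] .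
        ultimately show ?thesis unfolding region_def by blast
      qed
      have "flat (\<lambda>G. T F G x) (region ?B E')"
        unfolding flat_def
      proof (intro conjI ballI impI)
        fix G assume "G \<in> region ?B E'"
        then show "T F G x \<in> \<Phi> G" by (intro T_in[OF Ff _ _ E'(3)] region_face below)
      next
        fix G G' assume "G \<in> region ?B E'" "G' \<in> region ?B E'" "face_ge G G'"
        then show "T G G' (T F G x) = T F G' x" using T_comp[OF Ff _ _ below _ E'(3)] region_face by blast
      qed
      moreover have "flat s (region ?B E')" by (rule flat_subset[OF s sub])
      moreover have "E' \<in> region ?B E'" unfolding region_def using E'f by blast
      ultimately show ?thesis
        by (rule simply_flat_unique[OF sf, of "\<lambda>G. T F G x" s E' E, OF _ _ _ E_in E'(4)])
    qed
    show ?thesis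
    proof (cases "\<exists>E\<in>?R. sn E H \<noteq> sn F0 H")
      case False
      then have "?R = region (insert H B) F0" unfolding region_def by auto
      then show ?thesis using IH[OF order_refl HB F0] by simp
    next
      case True
      then obtain E1 where E1: "E1 \<in> ?R" "sn E1 H \<noteq> sn F0 H" by blast
      have F0R: "F0 \<in> ?R" using F0 unfolding region_def by simp
      \<comment> \<open>The region contains faces with different signs on \<open>H\<close>; if
        neither lies on \<open>H\<close>, elimination produces one that does and keeps the signs on
        \<open>B\<close>.\<close>
      have "\<exists>Z. Z \<in> Q 0"
      proof (cases "sn E1 H = 0 \<or> sn F0 H = 0")
        case True
        then show ?thesis using E1 F0R unfolding Q_def by blast
      next
        case False
        then obtain Z where Z: "Z \<in> faces \<A>" "sn Z H = 0" "\<And>H'. H' \<in> \<A> \<Longrightarrow> sn E1 H' = sn F0 H' \<Longrightarrow> sn Z H' = sn E1 H'"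
          using face_elimination[OF region_face[OF E1(1)] F0 H(1) E1(2)] by blast
        have "sn Z H' = sn F0 H'" if "H' \<in> B" for H'
          using Z(3)[of H'] E1(1) less.prems(1) that unfolding region_def by auto
        then show ?thesis using Z(1,2) unfolding Q_def region_def by blast
      qed
      then obtain Z where Z: "Z \<in> Q 0" by blast
      have Zf: "Z \<in> faces \<A>" and ZR: "Z \<in> ?R" using Q_face[OF Z] subsetD[OF QR Z] by blast+
      have RQ: "E \<in> Q (sn E H)" if "E \<in> ?R" for E using that unfolding Q_def by simp
      \<comment> \<open>All comparisons go through the single face \<open>Z\<close>. Each part that
        occurs contains a face with \<open>Z\<close> in its closure, where the value at
        \<open>Z\<close> is carried injectively, and inside a part one value decides.\<close>
      have agree: "s E = s' E \<longleftrightarrow> s Z = s' Z" if s: "flat s ?R" "flat s' ?R" and E: "E \<in> ?R" for s s' E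
      proof -
        obtain E' where E': "E' \<in> Q (sn E H)" "face_ge Z E'" using comp[OF Z RQ[OF E]] by blast
        have E'R: "E' \<in> ?R" and E'f: "E' \<in> faces \<A>" using subsetD[OF QR E'(1)] Q_face[OF E'(1)] by blast+
        note fl = flat_subset[OF s(1) QR, of "sn E H"] flat_subset[OF s(2) QR, of "sn E H"]
        have "s E = s' E \<longleftrightarrow> s E' = s' E'"
          using simply_flat_unique[OF Q_sf fl RQ[OF E] E'(1)] simply_flat_unique[OF Q_sf fl E'(1) RQ[OF E]] by blast
        also have "\<dots> \<longleftrightarrow> s Z = s' Z"
          using flat_T[OF s(1) ZR E'R E'(2)] flat_T[OF s(2) ZR E'R E'(2)]
            T_inj[OF Zf E'f E'(2) flat_in[OF s(1) ZR] flat_in[OF s(2) ZR]] by metis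
        finally show ?thesis .
      qed
      have from_Z: "\<exists>s. flat s ?R \<and> s Z = u" if u: "u \<in> \<Phi> Z" for u
      proof -
        have "\<forall>e. \<exists>s. flat s (Q e) \<and> (\<forall>E\<in>Q e. face_ge Z E \<longrightarrow> s E = T Z E u)"
        proof
          fix e
          show "\<exists>s. flat s (Q e) \<and> (\<forall>E\<in>Q e. face_ge Z E \<longrightarrow> s E = T Z E u)"
          proof (cases "Q e = {}")
            case True
            then show ?thesis unfolding flat_def by simp
          next
            case False
            then obtain E where "E \<in> Q e" by blast
            then obtain E' where E': "E' \<in> Q e" "face_ge Z E'" using comp[OF Z] by blast
            have "T Z E' u \<in> \<Phi> E'" by (rule T_in[OF Zf Q_face[OF E'(1)] E'(2) u])
            then obtain s where s: "flat s (Q e)" "s E' = T Z E' u"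
              using simply_flat_ex[OF Q_sf E'(1)] by blast
            have "s E = T Z E u" if "E \<in> Q e" "face_ge Z E" for E
              using star[OF Z s(1) that E' u s(2)[symmetric]] by simp
            then show ?thesis using s(1) by blast
          qed
        qed
        from choice[OF this] obtain S where
          SS: "\<forall>e. flat (S e) (Q e) \<and> (\<forall>E\<in>Q e. face_ge Z E \<longrightarrow> S e E = T Z E u)" ..
        have S: "flat (S e) (Q e)" "E \<in> Q e \<Longrightarrow> face_ge Z E \<Longrightarrow> S e E = T Z E u" for e E
          using SS by blast+
        define s where "s E = S (sn E H) E" for E
        \<comment> \<open>By \<open>star\<close>, pulling \<open>S e\<close> back along
          \<open>T\<close> gives one well-defined value at each face of \<open>Q 0\<close>. The
          resulting flat section \<open>t\<close> takes the value \<open>u\<close> at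
          \<open>Z\<close>, as \<open>S 0\<close> does, so the two coincide.\<close>
        have cross: "T F G (S 0 F) = S e G" if F: "F \<in> Q 0" and G: "G \<in> Q e" "face_ge F G" for F G e
        proof -
          have "\<forall>F\<in>Q 0. \<exists>x. x \<in> \<Phi> F \<and> (\<forall>G\<in>Q e. face_ge F G \<longrightarrow> T F G x = S e G)"
          proof
            fix F assume F: "F \<in> Q 0"
            obtain E' where E': "E' \<in> Q e" "face_ge F E'" using comp[OF F G(1)] by blast
            have "S e E' \<in> \<Phi> E'" by (rule flat_in[OF S(1) E'(1)])
            then obtain x where x: "x \<in> \<Phi> F" "T F E' x = S e E'"
              using T_surj[OF Q_face[OF F] Q_face[OF E'(1)] E'(2)] by blast
            have "T F G x = S e G" if "G \<in> Q e" "face_ge F G" for G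
              by (rule star[OF F S(1) that E' x])
            then show "\<exists>x. x \<in> \<Phi> F \<and> (\<forall>G\<in>Q e. face_ge F G \<longrightarrow> T F G x = S e G)" using x(1) by blast
          qed
          from bchoice[OF this] obtain t where
            tt: "\<forall>F\<in>Q 0. t F \<in> \<Phi> F \<and> (\<forall>G\<in>Q e. face_ge F G \<longrightarrow> T F G (t F) = S e G)" ..
          have t: "F \<in> Q 0 \<Longrightarrow> t F \<in> \<Phi> F"
            "F \<in> Q 0 \<Longrightarrow> G \<in> Q e \<Longrightarrow> face_ge F G \<Longrightarrow> T F G (t F) = S e G" for F G
            using tt by blast+
          have "flat t (Q 0)"
            unfolding flat_def
          proof (intro conjI ballI impI t(1))
            fix F F' assume FF: "F \<in> Q 0" "F' \<in> Q 0" "face_ge F F'"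
            obtain E' where E': "E' \<in> Q e" "face_ge F' E'" using comp[OF FF(2) G(1)] by blast
            note f = Q_face[OF FF(1)] Q_face[OF FF(2)] Q_face[OF E'(1)]
            have "T F' E' (T F F' (t F)) = T F E' (t F)" by (rule T_comp[OF f FF(3) E'(2) t(1)[OF FF(1)]])
            also have "\<dots> = T F' E' (t F')"
              using t(2)[OF FF(1) E'(1) face_ge_trans[OF FF(3) E'(2)]] t(2)[OF FF(2) E'] by simp
            finally show "T F F' (t F) = t F'"
              by (rule T_inj[OF f(2,3) E'(2) T_in[OF f(1,2) FF(3) t(1)[OF FF(1)]] t(1)[OF FF(2)]])
          qed
          moreover have "t Z = S 0 Z"
          proof -
            obtain E' where E': "E' \<in> Q e" "face_ge Z E'" using comp[OF Z G(1)] by blast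
            have "T Z E' (t Z) = T Z E' u" using t(2)[OF Z E'] S(2)[OF E'] by simp
            then have "t Z = u" by (rule T_inj[OF Zf Q_face[OF E'(1)] E'(2) t(1)[OF Z] u])
            then show ?thesis using S(2)[OF Z face_ge_refl] T_id[OF Zf u] by simp
          qed
          ultimately have "t F = S 0 F" by (intro simply_flat_unique[OF Q_sf _ S(1) Z F])
          then show ?thesis using t(2)[OF F G] by simp
        qed
        have "flat s ?R"
          unfolding flat_def
        proof (intro conjI ballI impI)
          fix F assume "F \<in> ?R"
          then show "s F \<in> \<Phi> F" unfolding s_def by (intro flat_in[OF S(1)] RQ)
        next
          fix F G assume FG: "F \<in> ?R" "G \<in> ?R" "face_ge F G"
          show "T F G (s F) = s G"
          proof (cases "sn F H = sn G H")
            case True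
            have "F \<in> Q (sn G H)" using RQ[OF FG(1)] True by simp
            then show ?thesis unfolding s_def True by (intro flat_T[OF S(1) _ RQ[OF FG(2)] FG(3)])
          next
            case False
            then have z: "sn F H = 0"
              using FG(3) H(1) unfolding face_ge_iff[OF region_face[OF FG(1)] region_face[OF FG(2)]] by blast
            have "F \<in> Q 0" using RQ[OF FG(1)] z by simp
            then show ?thesis unfolding s_def z by (intro cross RQ[OF FG(2)] FG(3))
          qed
        qed
        moreover have "s Z = u"
          unfolding s_def using S(2)[OF RQ[OF ZR] face_ge_refl] T_id[OF Zf u] by simp
        ultimately show ?thesis by blast
      qed
      show ?thesis
        unfolding simply_flat_def
      proof (intro conjI allI ballI impI)
        fix s s' E G assume "flat s ?R" "flat s' ?R" "E \<in> ?R" "G \<in> ?R" "s E = s' E"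
        then show "s G = s' G" using agree by blast
      next
        \<comment> \<open>The value at \<open>E\<close> is continued inside its own part to a face
          with \<open>Z\<close> in its closure, pulled back to \<open>Z\<close>, and extended from
          there to the whole region.\<close>
        fix E u assume E: "E \<in> ?R" and u: "u \<in> \<Phi> E"
        obtain E' where E': "E' \<in> Q (sn E H)" "face_ge Z E'" using comp[OF Z RQ[OF E]] by blast
        obtain g where g: "flat g (Q (sn E H))" "g E = u" using simply_flat_ex[OF Q_sf RQ[OF E] u] by blast
        obtain z where z: "z \<in> \<Phi> Z" "T Z E' z = g E'"
          using T_surj[OF Zf Q_face[OF E'(1)] E'(2) flat_in[OF g(1) E'(1)]] by blast
        obtain s where s: "flat s ?R" "s Z = z" using from_Z[OF z(1)] by blast
        have "s E' = g E'" using flat_T[OF s(1) ZR subsetD[OF QR E'(1)] E'(2)] s(2) z(2) by simp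
        then have "s E = g E"
          by (rule simply_flat_unique[OF Q_sf flat_subset[OF s(1) QR] g(1) E'(1) RQ[OF E]])
        then show "\<exists>s. flat s ?R \<and> s E = u" using s(1) g(2) by auto
      qed
    qed
  qed
qed

lemma flat_section_exists:
  assumes "F \<in> faces \<A>" "u \<in> \<Phi> F"
  obtains s where "flat s (faces \<A>)" "s F = u"
proof -
  have "region {} F = faces \<A>" unfolding region_def by simp
  then have "simply_flat (faces \<A>)" using simply_flat_region[of "{}" F] assms(1) by simp
  then show thesis using simply_flat_ex[OF _ assms] that by blast
qed

end

section \<open>Coverings of oriented graphs\<close>

definition flip :: "('v \<times> 'v) \<times> bool \<Rightarrow> ('v \<times> 'v) \<times> bool" where
  "flip s = (fst s, \<not> snd s)"

lemma flip_simps [simp]: "fst (flip s) = fst s" "step_src (flip s) = step_tgt s" "step_tgt (flip s) = step_src s"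
  by (cases s rule: step_src.cases; simp add: flip_def)+

lemma step_endpoints: "E \<subseteq> V \<times> V \<Longrightarrow> fst s \<in> E \<Longrightarrow> step_src s \<in> V \<and> step_tgt s \<in> V"
  by (cases s rule: step_src.cases) auto

lemma p_inv_eq: "p_inv \<alpha> = (p_end \<alpha>, rev (map flip (snd \<alpha>)))"
proof -
  have "(\<lambda>(e, s). (e, \<not> s)) = (flip :: ('a \<times> 'a) \<times> bool \<Rightarrow> _)" unfolding flip_def by (auto simp: fun_eq_iff)
  then show ?thesis unfolding p_inv_def by simp
qed

lemma p_begin_simps [simp]: "p_begin (v, ss) = v" "p_begin (p_comp \<alpha> \<beta>) = p_begin \<alpha>" "p_begin (p_inv \<alpha>) = p_end \<alpha>"
  "p_begin (p_map f \<alpha>) = f (p_begin \<alpha>)"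
  by (simp_all add: p_begin_def p_comp_def p_inv_def p_map_def)

lemma p_end_Nil [simp]: "p_end (v, []) = v"
  by (simp add: p_end_def)

lemma p_end_Cons [simp]: "p_end (v, s # ss) = p_end (step_tgt s, ss)"
  by (simp add: p_end_def)

lemma p_end_append: "p_end (v, ss @ ts) = p_end (p_end (v, ss), ts)"
  by (induction ss arbitrary: v) auto

lemma p_end_comp: "p_end \<alpha> = p_begin \<beta> \<Longrightarrow> p_end (p_comp \<alpha> \<beta>) = p_end \<beta>"
  by (cases \<alpha>; cases \<beta>) (simp add: p_comp_def p_end_append)

lemma paths_Nil [simp]: "(v, []) \<in> paths V E \<longleftrightarrow> v \<in> V"
  by (simp add: paths_def)

text \<open>Replaces the condition on indices by a recursion, so that paths can be treated by
  induction on the list of steps.\<close>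

lemma paths_Cons:
  assumes "E \<subseteq> V \<times> V"
  shows "(v, s # ss) \<in> paths V E \<longleftrightarrow> v \<in> V \<and> fst s \<in> E \<and> step_src s = v \<and> (step_tgt s, ss) \<in> paths V E"
proof -
  have "(\<forall>i. Suc i < length (s # ss) \<longrightarrow> step_tgt ((s # ss) ! i) = step_src ((s # ss) ! Suc i)) \<longleftrightarrow>
    (ss \<noteq> [] \<longrightarrow> step_src (hd ss) = step_tgt s) \<and>
    (\<forall>i. Suc i < length ss \<longrightarrow> step_tgt (ss ! i) = step_src (ss ! Suc i))" (is "?L \<longleftrightarrow> ?R")
  proof
    assume L: ?L
    have "step_src (hd ss) = step_tgt s" if "ss \<noteq> []"
      using L[rule_format, of 0] that by (simp add: hd_conv_nth)
    moreover have "step_tgt (ss ! i) = step_src (ss ! Suc i)" if "Suc i < length ss" for i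
      using L[rule_format, of "Suc i"] that by simp
    ultimately show ?R by blast
  next
    assume R: ?R
    show ?L
    proof (intro allI impI)
      fix i assume i: "Suc i < length (s # ss)"
      show "step_tgt ((s # ss) ! i) = step_src ((s # ss) ! Suc i)"
      proof (cases i)
        case 0
        then show ?thesis using R i by (auto simp: hd_conv_nth)
      next
        case (Suc j)
        then show ?thesis using R i by simp
      qed
    qed
  qed
  moreover have "fst s \<in> E \<Longrightarrow> step_tgt s \<in> V" using step_endpoints[OF assms] by blast
  ultimately show ?thesis unfolding paths_def by auto
qed

lemma paths_begin: "\<alpha> \<in> paths V E \<Longrightarrow> p_begin \<alpha> \<in> V"
  unfolding paths_def p_begin_def by auto

context
  fixes V :: "'v set" and E :: "('v \<times> 'v) set"
  assumes E: "E \<subseteq> V \<times> V"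
begin

lemma paths_end: "\<alpha> \<in> paths V E \<Longrightarrow> p_end \<alpha> \<in> V"
proof (cases \<alpha>)
  case (Pair v ss)
  have "(v, ss) \<in> paths V E \<Longrightarrow> p_end (v, ss) \<in> V" for v ss
    by (induction ss arbitrary: v) (auto simp: paths_Cons[OF E])
  then show "\<alpha> \<in> paths V E \<Longrightarrow> p_end \<alpha> \<in> V" using Pair by simp
qed

lemma paths_append: "(v, ss @ ts) \<in> paths V E \<longleftrightarrow> (v, ss) \<in> paths V E \<and> (p_end (v, ss), ts) \<in> paths V E"
  by (induction ss arbitrary: v) (auto simp: paths_Cons[OF E] dest: paths_begin)

lemma paths_comp: "\<alpha> \<in> paths V E \<Longrightarrow> \<beta> \<in> paths V E \<Longrightarrow> p_end \<alpha> = p_begin \<beta> \<Longrightarrow> p_comp \<alpha> \<beta> \<in> paths V E"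
  by (cases \<alpha>; cases \<beta>) (simp add: p_comp_def paths_append)

lemma paths_inv_aux:
  "(v, ss) \<in> paths V E \<Longrightarrow> (p_end (v, ss), rev (map flip ss)) \<in> paths V E \<and> p_end (p_end (v, ss), rev (map flip ss)) = v"
proof (induction ss arbitrary: v)
  case (Cons s ss)
  then have s: "v \<in> V" "fst s \<in> E" "step_src s = v" "(step_tgt s, ss) \<in> paths V E" by (auto simp: paths_Cons[OF E])
  then show ?case
    using Cons.IH[OF s(4)] paths_begin[OF s(4)] by (simp add: paths_append p_end_append paths_Cons[OF E])
qed simp

lemma paths_inv: "\<alpha> \<in> paths V E \<Longrightarrow> p_inv \<alpha> \<in> paths V E"
  and p_end_inv: "\<alpha> \<in> paths V E \<Longrightarrow> p_end (p_inv \<alpha>) = p_begin \<alpha>"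
  using paths_inv_aux[of "fst \<alpha>" "snd \<alpha>"] by (simp_all add: p_inv_eq p_begin_def)

lemma p_inv_inv: "\<alpha> \<in> paths V E \<Longrightarrow> p_inv (p_inv \<alpha>) = \<alpha>"
proof -
  assume "\<alpha> \<in> paths V E"
  then have "p_end (p_inv \<alpha>) = fst \<alpha>" using p_end_inv[of \<alpha>] by (simp add: p_begin_def)
  moreover have "map flip (map flip ss) = ss" for ss :: "(('v \<times> 'v) \<times> bool) list"
    by (simp add: flip_def map_idI)
  ultimately show ?thesis
    by (subst p_inv_eq) (simp add: p_inv_eq rev_map)
qed

end

definition step_map :: "('v \<Rightarrow> 'u) \<Rightarrow> ('v \<times> 'v) \<times> bool \<Rightarrow> ('u \<times> 'u) \<times> bool" where
  "step_map f s = (map_prod f f (fst s), snd s)"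

lemma step_map_pair: "step_map f ((a, b), s) = ((f a, f b), s)"
  by (simp add: step_map_def)

lemma step_map_simps [simp]:
  "step_src (step_map f s) = f (step_src s)" "step_tgt (step_map f s) = f (step_tgt s)"
  by (cases s rule: step_src.cases; simp add: step_map_def)+

lemma p_map_eq: "p_map f \<alpha> = (f (fst \<alpha>), map (step_map f) (snd \<alpha>))"
  by (auto simp: p_map_def step_map_def id_def)

lemma p_end_map [simp]: "p_end (p_map f \<alpha>) = f (p_end \<alpha>)"
  by (simp add: p_end_def p_map_eq last_map)

lemma p_map_comp: "p_map f (p_comp \<alpha> \<beta>) = p_comp (p_map f \<alpha>) (p_map f \<beta>)"
  by (simp add: p_map_eq p_comp_def)

lemma p_map_inv: "p_map f (p_inv \<alpha>) = p_inv (p_map f \<alpha>)"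
proof -
  have "map (step_map f) (map flip ss) = map flip (map (step_map f) ss)" for ss
    by (simp add: flip_def step_map_def)
  then show ?thesis
    unfolding p_inv_eq p_end_map by (simp add: p_map_eq rev_map[symmetric])
qed

text \<open>Unique lifting is required of outgoing and of incoming edges because a path may traverse
  an edge backwards.\<close>

locale graph_covering =
  fixes V\<Theta> :: "'v set" and E\<Theta> :: "('v \<times> 'v) set" and V\<Gamma> :: "'u set" and E\<Gamma> :: "('u \<times> 'u) set" and \<rho> :: "'v \<Rightarrow> 'u"
  assumes E\<Theta>: "E\<Theta> \<subseteq> V\<Theta> \<times> V\<Theta>" and E\<Gamma>: "E\<Gamma> \<subseteq> V\<Gamma> \<times> V\<Gamma>"
    and vertex_map: "v \<in> V\<Theta> \<Longrightarrow> \<rho> v \<in> V\<Gamma>"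
    and edge_map: "(u, v) \<in> E\<Theta> \<Longrightarrow> (\<rho> u, \<rho> v) \<in> E\<Gamma>"
    and edge_out: "u \<in> V\<Theta> \<Longrightarrow> (\<rho> u, d) \<in> E\<Gamma> \<Longrightarrow> \<exists>!v. (u, v) \<in> E\<Theta> \<and> \<rho> v = d"
    and edge_in: "v \<in> V\<Theta> \<Longrightarrow> (c, \<rho> v) \<in> E\<Gamma> \<Longrightarrow> \<exists>!u. (u, v) \<in> E\<Theta> \<and> \<rho> u = c"
begin

definition lifts :: "'v \<Rightarrow> 'u opath \<Rightarrow> 'v opath \<Rightarrow> bool" where
  "lifts v \<alpha> \<alpha>' \<longleftrightarrow> \<alpha>' \<in> paths V\<Theta> E\<Theta> \<and> p_begin \<alpha>' = v \<and> p_map \<rho> \<alpha>' = \<alpha>"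

lemma step_lift:
  assumes "v \<in> V\<Theta>" "fst s \<in> E\<Gamma>" "step_src s = \<rho> v"
  shows "\<exists>!s'. fst s' \<in> E\<Theta> \<and> step_src s' = v \<and> step_map \<rho> s' = s"
proof -
  obtain c d b where s: "s = ((c, d), b)" by (cases s rule: step_src.cases)
  show ?thesis
  proof (cases b)
    case True
    then have "\<exists>!x. (v, x) \<in> E\<Theta> \<and> \<rho> x = d" using assms s by (intro edge_out) auto
    then obtain x where x: "(v, x) \<in> E\<Theta>" "\<rho> x = d" "\<And>y. (v, y) \<in> E\<Theta> \<Longrightarrow> \<rho> y = d \<Longrightarrow> y = x" by blast
    show ?thesis
    proof (rule ex1I[of _ "((v, x), True)"])
      show "fst ((v, x), True) \<in> E\<Theta> \<and> step_src ((v, x), True) = v \<and> step_map \<rho> ((v, x), True) = s"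
        using x(1,2) assms s True by (simp add: step_map_pair)
      fix s' assume s': "fst s' \<in> E\<Theta> \<and> step_src s' = v \<and> step_map \<rho> s' = s"
      then obtain p q c' where pq: "s' = ((p, q), c')" by (cases s' rule: step_src.cases)
      then have "c'" "p = v" "(v, q) \<in> E\<Theta>" "\<rho> q = d" using s' s True by (auto simp: step_map_pair)
      then show "s' = ((v, x), True)" using x(3)[of q] pq by simp
    qed
  next
    case False
    then have "\<exists>!x. (x, v) \<in> E\<Theta> \<and> \<rho> x = c" using assms s by (intro edge_in) auto
    then obtain x where x: "(x, v) \<in> E\<Theta>" "\<rho> x = c" "\<And>y. (y, v) \<in> E\<Theta> \<Longrightarrow> \<rho> y = c \<Longrightarrow> y = x" by blast
    show ?thesis
    proof (rule ex1I[of _ "((x, v), False)"])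
      show "fst ((x, v), False) \<in> E\<Theta> \<and> step_src ((x, v), False) = v \<and> step_map \<rho> ((x, v), False) = s"
        using x(1,2) assms s False by (simp add: step_map_pair)
      fix s' assume s': "fst s' \<in> E\<Theta> \<and> step_src s' = v \<and> step_map \<rho> s' = s"
      then obtain p q c' where pq: "s' = ((p, q), c')" by (cases s' rule: step_src.cases)
      then have "\<not> c'" "q = v" "(p, v) \<in> E\<Theta>" "\<rho> p = c" using s' s False by (auto simp: step_map_pair)
      then show "s' = ((x, v), False)" using x(3)[of p] pq by simp
    qed
  qed
qed

lemma path_lift_aux:
  "v \<in> V\<Theta> \<Longrightarrow> (\<rho> v, ss) \<in> paths V\<Gamma> E\<Gamma> \<Longrightarrow> \<exists>!ss'. (v, ss') \<in> paths V\<Theta> E\<Theta> \<and> map (step_map \<rho>) ss' = ss"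
proof (induction ss arbitrary: v)
  case Nil
  then show ?case by auto
next
  case (Cons s ss)
  then have s: "fst s \<in> E\<Gamma>" "step_src s = \<rho> v" "(step_tgt s, ss) \<in> paths V\<Gamma> E\<Gamma>" by (auto simp: paths_Cons[OF E\<Gamma>])
  obtain s' where s': "fst s' \<in> E\<Theta>" "step_src s' = v" "step_map \<rho> s' = s"
    and s'u: "\<And>x. fst x \<in> E\<Theta> \<Longrightarrow> step_src x = v \<Longrightarrow> step_map \<rho> x = s \<Longrightarrow> x = s'"
    using step_lift[OF Cons.prems(1) s(1,2)] by blast
  have "step_tgt s' \<in> V\<Theta>" using step_endpoints[OF E\<Theta> s'(1)] by blast
  moreover have "\<rho> (step_tgt s') = step_tgt s" using s'(3) by auto
  ultimately have "\<exists>!ss'. (step_tgt s', ss') \<in> paths V\<Theta> E\<Theta> \<and> map (step_map \<rho>) ss' = ss"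
    using Cons.IH[of "step_tgt s'"] s(3) by simp
  then obtain ss' where ss': "(step_tgt s', ss') \<in> paths V\<Theta> E\<Theta>" "map (step_map \<rho>) ss' = ss"
    and ss'u: "\<And>x. (step_tgt s', x) \<in> paths V\<Theta> E\<Theta> \<Longrightarrow> map (step_map \<rho>) x = ss \<Longrightarrow> x = ss'" by blast
  show ?case
  proof (rule ex1I[of _ "s' # ss'"])
    show "(v, s' # ss') \<in> paths V\<Theta> E\<Theta> \<and> map (step_map \<rho>) (s' # ss') = s # ss"
      using s' ss' Cons.prems(1) by (simp add: paths_Cons[OF E\<Theta>])
    fix x assume x: "(v, x) \<in> paths V\<Theta> E\<Theta> \<and> map (step_map \<rho>) x = s # ss"
    then obtain y ys where y: "x = y # ys" "step_map \<rho> y = s" "map (step_map \<rho>) ys = ss" by auto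
    then have p: "fst y \<in> E\<Theta>" "step_src y = v" "(step_tgt y, ys) \<in> paths V\<Theta> E\<Theta>" using x by (auto simp: paths_Cons[OF E\<Theta>])
    have "y = s'" using s'u[OF p(1,2) y(2)] .
    moreover have "ys = ss'" using ss'u[of ys] p(3) y(3) \<open>y = s'\<close> by blast
    ultimately show "x = s' # ss'" using y(1) by simp
  qed
qed

lemma unique_lift:
  assumes "v \<in> V\<Theta>" "\<alpha> \<in> paths V\<Gamma> E\<Gamma>" "p_begin \<alpha> = \<rho> v"
  shows "\<exists>!\<alpha>'. lifts v \<alpha> \<alpha>'"
proof -
  obtain ss where \<alpha>: "\<alpha> = (\<rho> v, ss)" using assms(3) by (cases \<alpha>) simp
  obtain ss' where ss': "(v, ss') \<in> paths V\<Theta> E\<Theta>" "map (step_map \<rho>) ss' = ss"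
    and u: "\<And>x. (v, x) \<in> paths V\<Theta> E\<Theta> \<Longrightarrow> map (step_map \<rho>) x = ss \<Longrightarrow> x = ss'"
    using path_lift_aux[OF assms(1)] assms(2) unfolding \<alpha> by blast
  show ?thesis
  proof (rule ex1I[of _ "(v, ss')"])
    show "lifts v \<alpha> (v, ss')" using ss' unfolding lifts_def \<alpha> p_map_eq by simp
    fix \<beta> assume "lifts v \<alpha> \<beta>"
    then show "\<beta> = (v, ss')" using u unfolding lifts_def \<alpha> p_map_eq by (cases \<beta>) auto
  qed
qed

lemma lifts_unique: "v \<in> V\<Theta> \<Longrightarrow> \<alpha> \<in> paths V\<Gamma> E\<Gamma> \<Longrightarrow> lifts v \<alpha> \<beta> \<Longrightarrow> lifts v \<alpha> \<beta>' \<Longrightarrow> \<beta> = \<beta>'"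
  using unique_lift[of v \<alpha>] p_begin_simps(4)[of \<rho> \<beta>] unfolding lifts_def by metis

lemma lifts_exists:
  assumes "v \<in> V\<Theta>" "\<alpha> \<in> paths V\<Gamma> E\<Gamma>" "p_begin \<alpha> = \<rho> v"
  obtains \<alpha>' where "lifts v \<alpha> \<alpha>'" "p_end \<alpha>' \<in> V\<Theta>" "\<rho> (p_end \<alpha>') = p_end \<alpha>"
proof -
  obtain \<alpha>' where *: "lifts v \<alpha> \<alpha>'" using unique_lift[OF assms] by blast
  then show thesis using that[OF *] paths_end[OF E\<Theta>] unfolding lifts_def by auto
qed

lemma p_map_paths:
  "\<alpha> \<in> paths V\<Theta> E\<Theta> \<Longrightarrow> p_map \<rho> \<alpha> \<in> paths V\<Gamma> E\<Gamma>"
proof -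
  have "(v, ss) \<in> paths V\<Theta> E\<Theta> \<Longrightarrow> (\<rho> v, map (step_map \<rho>) ss) \<in> paths V\<Gamma> E\<Gamma>" for v ss
  proof (induction ss arbitrary: v)
    case Nil
    then show ?case using vertex_map by simp
  next
    case (Cons s ss)
    then have s: "v \<in> V\<Theta>" "fst s \<in> E\<Theta>" "step_src s = v" "(step_tgt s, ss) \<in> paths V\<Theta> E\<Theta>"
      by (auto simp: paths_Cons[OF E\<Theta>])
    have "fst (step_map \<rho> s) \<in> E\<Gamma>"
      using s(2) edge_map by (cases s rule: step_src.cases) (simp add: step_map_pair)
    then show ?case using s Cons.IH[OF s(4)] vertex_map by (simp add: paths_Cons[OF E\<Gamma>])
  qed
  then show "\<alpha> \<in> paths V\<Theta> E\<Theta> \<Longrightarrow> p_map \<rho> \<alpha> \<in> paths V\<Gamma> E\<Gamma>" by (cases \<alpha>) (simp add: p_map_eq)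
qed

text \<open>The invariant for rule induction over \<open>generated_rel\<close>. Membership in the
  paths and equality of both ends downstairs are carried along so that the rules for inverses and
  contexts can be applied.\<close>

definition same_lifts :: "'u opath \<Rightarrow> 'u opath \<Rightarrow> bool" where
  "same_lifts \<alpha> \<beta> \<longleftrightarrow> \<alpha> \<in> paths V\<Gamma> E\<Gamma> \<and> \<beta> \<in> paths V\<Gamma> E\<Gamma> \<and> p_begin \<alpha> = p_begin \<beta> \<and> p_end \<alpha> = p_end \<beta> \<and>
     (\<forall>v\<in>V\<Theta>. \<forall>\<alpha>' \<beta>'. lifts v \<alpha> \<alpha>' \<longrightarrow> lifts v \<beta> \<beta>' \<longrightarrow> p_end \<alpha>' = p_end \<beta>')"

lemma same_liftsI:
  assumes "\<alpha> \<in> paths V\<Gamma> E\<Gamma>" "\<beta> \<in> paths V\<Gamma> E\<Gamma>" "p_begin \<alpha> = p_begin \<beta>" "p_end \<alpha> = p_end \<beta>"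
    and "\<And>v \<alpha>' \<beta>'. v \<in> V\<Theta> \<Longrightarrow> lifts v \<alpha> \<alpha>' \<Longrightarrow> lifts v \<beta> \<beta>' \<Longrightarrow> p_end \<alpha>' = p_end \<beta>'"
  shows "same_lifts \<alpha> \<beta>"
  using assms unfolding same_lifts_def by blast

lemma same_liftsD:
  assumes "same_lifts \<alpha> \<beta>"
  shows "\<alpha> \<in> paths V\<Gamma> E\<Gamma>" "\<beta> \<in> paths V\<Gamma> E\<Gamma>" "p_begin \<alpha> = p_begin \<beta>" "p_end \<alpha> = p_end \<beta>"
    "v \<in> V\<Theta> \<Longrightarrow> lifts v \<alpha> \<alpha>' \<Longrightarrow> lifts v \<beta> \<beta>' \<Longrightarrow> p_end \<alpha>' = p_end \<beta>'"
  using assms unfolding same_lifts_def by blast+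

lemma lifts_begin: "lifts v \<alpha> \<alpha>' \<Longrightarrow> p_begin \<alpha> = \<rho> v"
  unfolding lifts_def by (metis p_begin_simps(4))

lemma lifts_inv: "lifts v \<alpha> \<alpha>' \<Longrightarrow> lifts (p_end \<alpha>') (p_inv \<alpha>) (p_inv \<alpha>') \<and> p_end (p_inv \<alpha>') = v"
  unfolding lifts_def using paths_inv[OF E\<Theta>] p_end_inv[OF E\<Theta>] by (auto simp: p_map_inv)

lemma lifts_comp:
  "lifts v \<alpha> \<alpha>' \<Longrightarrow> lifts (p_end \<alpha>') \<beta> \<beta>' \<Longrightarrow> lifts v (p_comp \<alpha> \<beta>) (p_comp \<alpha>' \<beta>') \<and> p_end (p_comp \<alpha>' \<beta>') = p_end \<beta>'"
  unfolding lifts_def using paths_comp[OF E\<Theta>] p_end_comp[of \<alpha>' \<beta>'] by (auto simp: p_map_comp)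

text \<open>Every rule except \<open>base\<close> preserves the property by unique path lifting
  alone, so geometry enters only through the generators \<open>B\<close>.\<close>

lemma same_lifts_generated:
  assumes base: "\<And>\<alpha> \<beta>. (\<alpha>, \<beta>) \<in> B \<Longrightarrow> same_lifts \<alpha> \<beta>"
    and "(\<alpha>, \<beta>) \<in> generated_rel V\<Gamma> E\<Gamma> B"
  shows "same_lifts \<alpha> \<beta>"
  using assms(2)
proof (induction rule: generated_rel.induct)
  case (base \<alpha> \<beta>)
  then show ?case by (rule assms(1))
next
  case (refl \<alpha>)
  show ?case
  proof (rule same_liftsI)
    fix v \<alpha>' \<beta>' assume "v \<in> V\<Theta>" "lifts v \<alpha> \<alpha>'" "lifts v \<alpha> \<beta>'"
    then have "\<alpha>' = \<beta>'" by (intro lifts_unique[OF _ refl])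
    then show "p_end \<alpha>' = p_end \<beta>'" by simp
  qed (simp_all add: refl)
next
  case (sym \<alpha> \<beta>)
  note * = same_liftsD[OF sym.IH]
  show ?case using * by (intro same_liftsI) (simp_all add: *(5)[symmetric])
next
  case (trans \<alpha> \<beta> \<gamma>)
  note 1 = same_liftsD[OF trans.IH(1)] and 2 = same_liftsD[OF trans.IH(2)]
  show ?case
  proof (rule same_liftsI)
    fix v \<alpha>' \<gamma>' assume v: "v \<in> V\<Theta>" and l: "lifts v \<alpha> \<alpha>'" "lifts v \<gamma> \<gamma>'"
    have "p_begin \<beta> = \<rho> v" using 1(3) lifts_begin[OF l(1)] by simp
    then obtain \<beta>' where b: "lifts v \<beta> \<beta>'" using lifts_exists[OF v 1(2)] by blast
    show "p_end \<alpha>' = p_end \<gamma>'" using 1(5)[OF v l(1) b] 2(5)[OF v b l(2)] by simp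
  qed (use 1 2 in simp_all)
next
  case (cancel \<alpha>)
  have p: "p_comp \<alpha> (p_inv \<alpha>) \<in> paths V\<Gamma> E\<Gamma>" using paths_comp[OF E\<Gamma> cancel paths_inv[OF E\<Gamma> cancel]] by simp
  have "p_end \<alpha>' = p_end \<beta>'"
    if v: "v \<in> V\<Theta>" and l: "lifts v (p_comp \<alpha> (p_inv \<alpha>)) \<alpha>'" "lifts v (p_begin \<alpha>, []) \<beta>'" for v \<alpha>' \<beta>'
  proof -
    have b: "p_begin \<alpha> = \<rho> v" using lifts_begin[OF l(2)] by simp
    then have "lifts v (p_begin \<alpha>, []) (v, [])" using v unfolding lifts_def p_map_eq by simp
    then have "\<beta>' = (v, [])" using paths_begin[OF cancel] by (intro lifts_unique[OF v _ l(2)]) simp_all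
    obtain \<gamma> where g: "lifts v \<alpha> \<gamma>" using lifts_exists[OF v cancel b] by blast
    then have "\<alpha>' = p_comp \<gamma> (p_inv \<gamma>)"
      using lifts_comp[OF g conjunct1[OF lifts_inv[OF g]]] by (intro lifts_unique[OF v p l(1)]) simp
    then have "p_end \<alpha>' = v"
      using lifts_inv[OF g] lifts_comp[OF g conjunct1[OF lifts_inv[OF g]]] by simp
    then show ?thesis using \<open>\<beta>' = (v, [])\<close> by simp
  qed
  then show ?case
    unfolding same_lifts_def using p paths_begin[OF cancel] p_end_comp[of \<alpha> "p_inv \<alpha>"] p_end_inv[OF E\<Gamma> cancel] by auto
next
  case (inv \<alpha> \<beta>)
  have ab: "\<alpha> \<in> paths V\<Gamma> E\<Gamma>" "\<beta> \<in> paths V\<Gamma> E\<Gamma>" "p_begin \<alpha> = p_begin \<beta>" "p_end \<alpha> = p_end \<beta>"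
    and eq: "\<And>v \<alpha>' \<beta>'. v \<in> V\<Theta> \<Longrightarrow> lifts v \<alpha> \<alpha>' \<Longrightarrow> lifts v \<beta> \<beta>' \<Longrightarrow> p_end \<alpha>' = p_end \<beta>'"
    by (fact same_liftsD[OF inv.IH])+
  have "p_end \<alpha>' = p_end \<beta>'" if v: "v \<in> V\<Theta>" and l: "lifts v (p_inv \<alpha>) \<alpha>'" "lifts v (p_inv \<beta>) \<beta>'" for v \<alpha>' \<beta>'
  proof -
    \<comment> \<open>Reversing a lift of \<open>p_inv \<alpha>\<close> gives a lift of
      \<open>\<alpha>\<close> starting at \<open>?x\<close>. The lift of \<open>\<beta>\<close> from
      there ends at \<open>v\<close> as well, and its reverse is the lift of
      \<open>p_inv \<beta>\<close> at \<open>v\<close>.\<close>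
    let ?x = "p_end \<alpha>'"
    have x: "?x \<in> V\<Theta>" using l(1) paths_end[OF E\<Theta>] unfolding lifts_def by blast
    have a: "lifts ?x \<alpha> (p_inv \<alpha>')" "p_end (p_inv \<alpha>') = v"
      using lifts_inv[OF l(1)] p_inv_inv[OF E\<Gamma> ab(1)] by auto
    have "p_begin \<beta> = \<rho> ?x" using lifts_begin[OF a(1)] ab(3) by simp
    then obtain \<gamma> where g: "lifts ?x \<beta> \<gamma>" using lifts_exists[OF x ab(2)] by blast
    then have "p_end \<gamma> = v" using eq[OF x a(1) g] a(2) by simp
    then have "lifts v (p_inv \<beta>) (p_inv \<gamma>)" "p_end (p_inv \<gamma>) = ?x" using lifts_inv[OF g] by auto
    then show ?thesis using lifts_unique[OF v paths_inv[OF E\<Gamma> ab(2)] l(2)] by simp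
  qed
  then show ?case
    unfolding same_lifts_def using ab paths_inv[OF E\<Gamma>] p_end_inv[OF E\<Gamma>] by auto
next
  case (ctxt \<alpha> \<beta> \<gamma> \<delta>)
  have ab: "\<alpha> \<in> paths V\<Gamma> E\<Gamma>" "\<beta> \<in> paths V\<Gamma> E\<Gamma>" "p_begin \<alpha> = p_begin \<beta>" "p_end \<alpha> = p_end \<beta>"
    and eq: "\<And>v \<alpha>' \<beta>'. v \<in> V\<Theta> \<Longrightarrow> lifts v \<alpha> \<alpha>' \<Longrightarrow> lifts v \<beta> \<beta>' \<Longrightarrow> p_end \<alpha>' = p_end \<beta>'"
    by (fact same_liftsD[OF ctxt.IH])+
  have ga: "p_comp \<gamma> \<alpha> \<in> paths V\<Gamma> E\<Gamma>" "p_end (p_comp \<gamma> \<alpha>) = p_end \<alpha>"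
    using paths_comp[OF E\<Gamma> ctxt.hyps(2) ab(1)] p_end_comp[of \<gamma> \<alpha>] ctxt.hyps(4) by simp_all
  have gb: "p_comp \<gamma> \<beta> \<in> paths V\<Gamma> E\<Gamma>" "p_end (p_comp \<gamma> \<beta>) = p_end \<beta>"
    using paths_comp[OF E\<Gamma> ctxt.hyps(2) ab(2)] p_end_comp[of \<gamma> \<beta>] ctxt.hyps(4) ab(3) by simp_all
  have gad: "p_comp (p_comp \<gamma> \<alpha>) \<delta> \<in> paths V\<Gamma> E\<Gamma>" "p_end (p_comp (p_comp \<gamma> \<alpha>) \<delta>) = p_end \<delta>"
    using paths_comp[OF E\<Gamma> ga(1) ctxt.hyps(3)] p_end_comp[of "p_comp \<gamma> \<alpha>" \<delta>] ctxt.hyps(5) ga(2) by simp_all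
  have gbd: "p_comp (p_comp \<gamma> \<beta>) \<delta> \<in> paths V\<Gamma> E\<Gamma>" "p_end (p_comp (p_comp \<gamma> \<beta>) \<delta>) = p_end \<delta>"
    using paths_comp[OF E\<Gamma> gb(1) ctxt.hyps(3)] p_end_comp[of "p_comp \<gamma> \<beta>" \<delta>] ctxt.hyps(5) gb(2) ab(4) by simp_all
  have "p_end \<alpha>' = p_end \<beta>'"
    if v: "v \<in> V\<Theta>" and l: "lifts v (p_comp (p_comp \<gamma> \<alpha>) \<delta>) \<alpha>'" "lifts v (p_comp (p_comp \<gamma> \<beta>) \<delta>) \<beta>'" for v \<alpha>' \<beta>'
  proof -
    have "p_begin \<gamma> = \<rho> v" using lifts_begin[OF l(1)] by simp
    then obtain g where g: "lifts v \<gamma> g" "p_end g \<in> V\<Theta>" "\<rho> (p_end g) = p_end \<gamma>"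
      using lifts_exists[OF v ctxt.hyps(2)] by blast
    obtain a where a: "lifts (p_end g) \<alpha> a" "p_end a \<in> V\<Theta>" "\<rho> (p_end a) = p_end \<alpha>"
      using lifts_exists[OF g(2) ab(1)] g(3) ctxt.hyps(4) by auto
    have "p_begin \<beta> = \<rho> (p_end g)" using g(3) ctxt.hyps(4) ab(3) by simp
    then obtain b where b: "lifts (p_end g) \<beta> b" using lifts_exists[OF g(2) ab(2)] by blast
    have ends: "p_end a = p_end b" by (rule eq[OF g(2) a(1) b])
    have "p_begin \<delta> = \<rho> (p_end a)" using a(3) ctxt.hyps(5) by simp
    then obtain d where d: "lifts (p_end a) \<delta> d" using lifts_exists[OF a(2) ctxt.hyps(3)] by blast
    have "lifts v (p_comp (p_comp \<gamma> \<alpha>) \<delta>) (p_comp (p_comp g a) d)" "p_end (p_comp (p_comp g a) d) = p_end d"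
      using lifts_comp[OF g(1) a(1)] lifts_comp[of v "p_comp \<gamma> \<alpha>" "p_comp g a" \<delta> d] d by simp_all
    moreover have "lifts v (p_comp (p_comp \<gamma> \<beta>) \<delta>) (p_comp (p_comp g b) d)" "p_end (p_comp (p_comp g b) d) = p_end d"
      using lifts_comp[OF g(1) b] lifts_comp[of v "p_comp \<gamma> \<beta>" "p_comp g b" \<delta> d] d ends by simp_all
    ultimately show ?thesis using lifts_unique[OF v gad(1) l(1)] lifts_unique[OF v gbd(1) l(2)] by simp
  qed
  then show ?case unfolding same_lifts_def using gad gbd by auto
qed

end

lemma oriented_system_same_ends:
  assumes E: "E \<subseteq> V \<times> V" and conn: "connected_graph V E"
  shows "oriented_system \<lparr>verts = V, edges = E,
    prel = {(\<alpha>, \<beta>). \<alpha> \<in> paths V E \<and> \<beta> \<in> paths V E \<and> p_begin \<alpha> = p_begin \<beta> \<and> p_end \<alpha> = p_end \<beta>}\<rparr>"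
proof -
  let ?R = "{(\<alpha>, \<beta>). \<alpha> \<in> paths V E \<and> \<beta> \<in> paths V E \<and> p_begin \<alpha> = p_begin \<beta> \<and> p_end \<alpha> = p_end \<beta>}"
  have "equiv (paths V E) ?R"
    by (rule equivI) (auto simp: refl_on_def sym_def trans_def)
  moreover have "(p_comp \<alpha> (p_inv \<alpha>), (p_begin \<alpha>, [])) \<in> ?R" if "\<alpha> \<in> paths V E" for \<alpha>
    using that paths_comp[OF E that paths_inv[OF E that]] paths_begin[OF that] p_end_comp[of \<alpha> "p_inv \<alpha>"]
      p_end_inv[OF E that] by auto
  moreover have "(p_inv \<alpha>, p_inv \<beta>) \<in> ?R" if "(\<alpha>, \<beta>) \<in> ?R" for \<alpha> \<beta>
    using that paths_inv[OF E] p_end_inv[OF E] by auto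
  moreover have "(p_comp (p_comp \<gamma> \<alpha>) \<delta>, p_comp (p_comp \<gamma> \<beta>) \<delta>) \<in> ?R"
    if "(\<alpha>, \<beta>) \<in> ?R" "\<gamma> \<in> paths V E" "\<delta> \<in> paths V E" "p_end \<gamma> = p_begin \<alpha>" "p_end \<alpha> = p_begin \<delta>" for \<alpha> \<beta> \<gamma> \<delta>
    using that by (auto simp: paths_comp[OF E] p_end_comp)
  ultimately show ?thesis
    unfolding oriented_system_def using E conn by auto
qed

lemma generated_rel_ends:
  assumes E: "E \<subseteq> V \<times> V"
    and B: "\<And>\<alpha> \<beta>. (\<alpha>, \<beta>) \<in> B \<Longrightarrow> \<alpha> \<in> paths V E \<and> \<beta> \<in> paths V E \<and> p_begin \<alpha> = p_begin \<beta> \<and> p_end \<alpha> = p_end \<beta>"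
    and "(\<alpha>, \<beta>) \<in> generated_rel V E B"
  shows "\<alpha> \<in> paths V E \<and> \<beta> \<in> paths V E \<and> p_begin \<alpha> = p_begin \<beta> \<and> p_end \<alpha> = p_end \<beta>"
  using assms(3)
proof (induction rule: generated_rel.induct)
  case (cancel \<alpha>)
  then show ?case
    using paths_comp[OF E cancel paths_inv[OF E cancel]] paths_begin[OF cancel] p_end_comp[of \<alpha> "p_inv \<alpha>"]
      p_end_inv[OF E cancel] by auto
next
  case (inv \<alpha> \<beta>)
  then show ?case using paths_inv[OF E] p_end_inv[OF E] by auto
next
  case (ctxt \<alpha> \<beta> \<gamma> \<delta>)
  then show ?case by (auto simp: paths_comp[OF E] p_end_comp)
qed (use B in auto)

lemma oriented_system_generated:
  assumes E: "E \<subseteq> V \<times> V" and conn: "connected_graph V E"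
    and B: "\<And>\<alpha> \<beta>. (\<alpha>, \<beta>) \<in> B \<Longrightarrow> \<alpha> \<in> paths V E \<and> \<beta> \<in> paths V E \<and> p_begin \<alpha> = p_begin \<beta> \<and> p_end \<alpha> = p_end \<beta>"
  shows "oriented_system \<lparr>verts = V, edges = E, prel = generated_rel V E B\<rparr>"
proof -
  note ends = generated_rel_ends[OF E B]
  have "equiv (paths V E) (generated_rel V E B)"
  proof (rule equivI)
    show "generated_rel V E B \<subseteq> paths V E \<times> paths V E" using ends by auto
    show "refl_on (paths V E) (generated_rel V E B)" by (auto simp: refl_on_def intro: generated_rel.refl)
    show "sym (generated_rel V E B)" by (auto simp: sym_def intro: generated_rel.sym)
    show "trans (generated_rel V E B)" by (rule transI) (rule generated_rel.trans)
  qed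
  then show ?thesis
    unfolding oriented_system_def using E conn ends
    by (auto intro: generated_rel.cancel generated_rel.inv generated_rel.ctxt)
qed

section \<open>Galleries\<close>

context arrangement
begin

definition Sep :: "'a set \<Rightarrow> 'a set \<Rightarrow> 'a set set" where
  "Sep C D = {H\<in>\<A>. sn C H \<noteq> sn D H}"

lemma finite_Sep: "finite (Sep C D)"
  unfolding Sep_def using finite_A by simp

lemma Sep_self [simp]: "Sep C C = {}"
  unfolding Sep_def by simp

lemma card_Sep_triangle: "card (Sep C E) \<le> card (Sep C D) + card (Sep D E)"
proof -
  have "Sep C E \<subseteq> Sep C D \<union> Sep D E" unfolding Sep_def by auto
  then show ?thesis
    using card_mono[of "Sep C D \<union> Sep D E" "Sep C E"] card_Un_le[of "Sep C D" "Sep D E"] finite_Sep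
    by (meson finite_UnI le_trans)
qed

lemma Sep_empty: "\<lbrakk>C \<in> faces \<A>; D \<in> faces \<A>; Sep C D = {}\<rbrakk> \<Longrightarrow> C = D"
  by (rule face_eqI) (auto simp: Sep_def)

lemma chamber_sn: "C \<in> chambers \<A> \<Longrightarrow> H \<in> \<A> \<Longrightarrow> sn C H \<noteq> 0"
  by (simp add: chambers_iff)

lemma chamber_sn_flip:
  assumes "C \<in> chambers \<A>" "D \<in> chambers \<A>" "E \<in> chambers \<A>" "H \<in> \<A>" "sn C H \<noteq> sn D H" "sn C H \<noteq> sn E H"
  shows "sn D H = sn E H"
  using assms chamber_sn[of C H] chamber_sn[of D H] chamber_sn[of E H] sn_cases[of C H] sn_cases[of D H] sn_cases[of E H]
  by auto

lemma edge_iff: "(C, D) \<in> chamber_edges \<A> \<longleftrightarrow> C \<in> chambers \<A> \<and> D \<in> chambers \<A> \<and> card (Sep C D) = 1"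
proof -
  have "{H\<in>\<A>. separates H C D} = Sep C D" if "C \<in> chambers \<A>" "D \<in> chambers \<A>"
    unfolding Sep_def using separates_iff[OF _ that] by blast
  then show ?thesis unfolding chamber_edges_def adjacent_def by auto
qed

lemma edges_sub: "chamber_edges \<A> \<subseteq> chambers \<A> \<times> chambers \<A>"
  unfolding chamber_edges_def by blast

text \<open>Elimination yields a face on \<open>H1\<close>. If it also lies on \<open>H2\<close>,
  composing it with a face lying on exactly one of the two hyperplanes breaks the tie; the signs
  outside \<open>Sep C E\<close> survive because they are nonzero.\<close>

lemma separating_face:
  assumes C: "C \<in> chambers \<A>" and E: "E \<in> chambers \<A>"
    and H: "H1 \<in> Sep C E" "H2 \<in> Sep C E" "H1 \<noteq> H2"
  obtains X Ha Hb where "X \<in> faces \<A>" "Ha \<in> Sep C E" "Hb \<in> Sep C E" "sn X Ha = 0" "sn X Hb \<noteq> 0"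
    "\<And>H'. H' \<in> \<A> - Sep C E \<Longrightarrow> sn X H' = sn C H'"
proof -
  have HA: "H1 \<in> \<A>" "H2 \<in> \<A>" using H unfolding Sep_def by auto
  have "sn C H1 \<noteq> sn E H1" using H unfolding Sep_def by auto
  then obtain Z where Z: "Z \<in> faces \<A>" "sn Z H1 = 0"
    "\<And>H'. H' \<in> \<A> \<Longrightarrow> sn C H' = sn E H' \<Longrightarrow> sn Z H' = sn C H'"
    using face_elimination[OF chamber_face[OF C] chamber_face[OF E] HA(1) _ chamber_sn[OF C HA(1)] chamber_sn[OF E HA(1)]]
    by blast
  have Z': "sn Z H' = sn C H'" if "H' \<in> \<A> - Sep C E" for H' using Z(3) that unfolding Sep_def by blast
  show thesis
  proof (cases "sn Z H2 = 0")
    case False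
    then show thesis using that[OF Z(1) H(1,2) Z(2) _ Z'] by blast
  next
    case True
    obtain F where F: "F \<in> faces \<A>" "sn F H1 = 0 \<and> sn F H2 \<noteq> 0 \<or> sn F H1 \<noteq> 0 \<and> sn F H2 = 0"
      using hyperplanes_distinct[OF HA H(3)] by blast
    obtain X where X: "X \<in> faces \<A>" "\<And>H. H \<in> \<A> \<Longrightarrow> sn X H = (if sn Z H = 0 then sn F H else sn Z H)"
      using face_composition[OF Z(1) F(1)] by blast
    have X12: "sn X H1 = sn F H1" "sn X H2 = sn F H2" using X(2) HA Z(2) True by auto
    have X': "sn X H' = sn C H'" if "H' \<in> \<A> - Sep C E" for H'
      using X(2)[of H'] Z'[OF that] chamber_sn[OF C, of H'] that by auto
    show thesis
      using F(2)
    proof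
      assume "sn F H1 = 0 \<and> sn F H2 \<noteq> 0"
      then show thesis using that[OF X(1) H(1,2) _ _ X'] X12 by auto
    next
      assume "sn F H1 \<noteq> 0 \<and> sn F H2 = 0"
      then show thesis using that[OF X(1) H(2,1) _ _ X'] X12 by auto
    qed
  qed
qed

text \<open>The face \<open>X\<close> of \<open>separating_face\<close> is completed to a chamber by
  composing it with \<open>C\<close> or with \<open>E\<close>. Since \<open>X\<close> lies on
  \<open>Ha\<close>, this choice decides the sign on \<open>Ha\<close> and can be made so that
  exactly one of \<open>Ha\<close> and \<open>Hb\<close> separates the result from
  \<open>C\<close>.\<close>

lemma intermediate_chamber:
  assumes C: "C \<in> chambers \<A>" and E: "E \<in> chambers \<A>"
    and H: "H1 \<in> Sep C E" "H2 \<in> Sep C E" "H1 \<noteq> H2"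
  obtains D where "D \<in> chambers \<A>" "Sep C D \<subset> Sep C E" "Sep C D \<noteq> {}"
proof -
  note intermediate = that
  obtain X Ha Hb where X: "X \<in> faces \<A>" "Ha \<in> Sep C E" "Hb \<in> Sep C E" "sn X Ha = 0" "sn X Hb \<noteq> 0"
    "\<And>H'. H' \<in> \<A> - Sep C E \<Longrightarrow> sn X H' = sn C H'"
    using separating_face[OF assms] by blast
  have HA: "Ha \<in> \<A>" "Hb \<in> \<A>" using X unfolding Sep_def by auto
  have key: thesis
    if D0: "D0 \<in> chambers \<A>" and sep: "sn D0 Ha = sn C Ha \<and> sn X Hb \<noteq> sn C Hb \<or> sn D0 Ha \<noteq> sn C Ha \<and> sn X Hb = sn C Hb" for D0
  proof -
    obtain D where D: "D \<in> faces \<A>" "\<And>H. H \<in> \<A> \<Longrightarrow> sn D H = (if sn X H = 0 then sn D0 H else sn X H)"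
      using face_composition[OF X(1) chamber_face[OF D0]] by blast
    have Dc: "D \<in> chambers \<A>" using D chamber_sn[OF D0] unfolding chambers_iff by simp
    have sub: "Sep C D \<subseteq> Sep C E"
    proof
      fix H assume "H \<in> Sep C D"
      then have "H \<in> \<A>" "sn C H \<noteq> sn D H" unfolding Sep_def by auto
      then show "H \<in> Sep C E" using X(6)[of H] D(2)[of H] chamber_sn[OF C, of H] by (cases "H \<in> Sep C E") auto
    qed
    have D_ab: "sn D Ha = sn D0 Ha" "sn D Hb = sn X Hb" using D(2)[OF HA(1)] D(2)[OF HA(2)] X(4,5) by auto
    have "Ha \<in> Sep C D \<and> Hb \<notin> Sep C D \<or> Ha \<notin> Sep C D \<and> Hb \<in> Sep C D"
      using sep HA unfolding Sep_def D_ab mem_Collect_eq by metis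
    then show thesis using intermediate[OF Dc] sub X(2,3) by blast
  qed
  show thesis
  proof (cases "sn X Hb = sn C Hb")
    case True
    have "sn E Ha \<noteq> sn C Ha" using X(2) unfolding Sep_def by auto
    then show thesis using key[OF E] True by blast
  next
    case False
    then show thesis using key[OF C] by blast
  qed
qed

text \<open>As long as more than one hyperplane separates, an intermediate chamber gives a smaller
  nonempty separating set; the descent stops at a neighbour of \<open>C\<close> on the way to
  \<open>D\<close>.\<close>

lemma adjacent_chamber:
  assumes C: "C \<in> chambers \<A>" and D: "D \<in> chambers \<A>" and "C \<noteq> D"
  obtains E where "(C, E) \<in> chamber_edges \<A>" "Sep C E \<subseteq> Sep C D"
proof -
  have "\<exists>E. (C, E) \<in> chamber_edges \<A> \<and> Sep C E \<subseteq> Sep C D"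
    if "D \<in> chambers \<A>" "Sep C D \<noteq> {}" for D
    using that
  proof (induction "card (Sep C D)" arbitrary: D rule: less_induct)
    case less
    show ?case
    proof (cases "card (Sep C D) = 1")
      case True
      then show ?thesis using C less.prems edge_iff by blast
    next
      case False
      obtain H1 where H1: "H1 \<in> Sep C D" using less.prems by blast
      have "Sep C D \<noteq> {H1}" using False by auto
      then obtain H2 where H2: "H2 \<in> Sep C D" "H1 \<noteq> H2" using H1 by blast
      obtain E where E: "E \<in> chambers \<A>" "Sep C E \<subset> Sep C D" "Sep C E \<noteq> {}"
        using intermediate_chamber[OF C less.prems(1) H1 H2] by blast
      have "card (Sep C E) < card (Sep C D)" using E(2) finite_Sep by (intro psubset_card_mono)
      then obtain E' where "(C, E') \<in> chamber_edges \<A>" "Sep C E' \<subseteq> Sep C E" using less.hyps E by blast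
      then show ?thesis using E(2) by blast
    qed
  qed
  moreover have "Sep C D \<noteq> {}" using Sep_empty[of C D] C D assms(3) chamber_face by blast
  ultimately show thesis using that D by blast
qed

lemma Sep_step:
  assumes "C \<in> chambers \<A>" "D \<in> chambers \<A>" "E \<in> chambers \<A>" "Sep C E \<subseteq> Sep C D"
  shows "Sep E D = Sep C D - Sep C E"
proof (intro set_eqI iffI)
  fix H assume "H \<in> Sep E D"
  then have H: "H \<in> \<A>" "sn E H \<noteq> sn D H" unfolding Sep_def by auto
  show "H \<in> Sep C D - Sep C E"
  proof (cases "sn C H = sn E H")
    case True
    then show ?thesis using H unfolding Sep_def by auto
  next
    case False
    then have "H \<in> Sep C D" using assms(4) H unfolding Sep_def by auto
    then have "sn D H = sn E H" using chamber_sn_flip[OF assms(1-3) H(1)] False unfolding Sep_def by auto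
    then show ?thesis using H by simp
  qed
qed (auto simp: Sep_def)

text \<open>Each edge crosses exactly one hyperplane, and the number of separating hyperplanes
  satisfies the triangle inequality.\<close>

lemma positive_path_length:
  assumes "(C, ss) \<in> paths (chambers \<A>) (chamber_edges \<A>)" "positive (C, ss)"
  shows "card (Sep C (p_end (C, ss))) \<le> length ss"
  using assms
proof (induction ss arbitrary: C)
  case (Cons s ss)
  obtain a b t where s: "s = ((a, b), t)" by (cases s rule: step_src.cases)
  have p: "(a, b) \<in> chamber_edges \<A>" "a = C" "(b, ss) \<in> paths (chambers \<A>) (chamber_edges \<A>)" "t"
    using Cons.prems unfolding s positive_def by (auto simp: paths_Cons[OF edges_sub])
  have "positive (b, ss)" using Cons.prems(2) unfolding positive_def by simp
  then have "card (Sep b (p_end (b, ss))) \<le> length ss" using Cons.IH p(3) by blast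
  moreover have "card (Sep C b) = 1" using p edge_iff by blast
  ultimately show ?case using card_Sep_triangle[of C "p_end (b, ss)" b] p(4) unfolding s by simp
qed simp

text \<open>The neighbour given by \<open>adjacent_chamber\<close> crosses a hyperplane of
  \<open>Sep C D\<close>, which then no longer separates, so the distance to \<open>D\<close> drops
  by one.\<close>

lemma shortest_path_exists:
  assumes "C \<in> chambers \<A>" "D \<in> chambers \<A>"
  shows "\<exists>ss. (C, ss) \<in> paths (chambers \<A>) (chamber_edges \<A>) \<and> positive (C, ss) \<and> p_end (C, ss) = D \<and>
    length ss = card (Sep C D)"
  using assms
proof (induction "card (Sep C D)" arbitrary: C)
  case 0
  then have "C = D" using Sep_empty[of C D] finite_Sep chamber_face by auto
  then show ?case using 0 by (intro exI[of _ "[]"]) (simp add: positive_def)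
next
  case (Suc n)
  have "C \<noteq> D" using Suc.hyps(2) by auto
  then obtain E where E: "(C, E) \<in> chamber_edges \<A>" "Sep C E \<subseteq> Sep C D"
    using adjacent_chamber[OF Suc.prems] by blast
  have Ec: "E \<in> chambers \<A>" and one: "card (Sep C E) = 1" using E(1) edge_iff by auto
  have "card (Sep E D) = card (Sep C D) - card (Sep C E)"
    unfolding Sep_step[OF Suc.prems Ec E(2)] by (rule card_Diff_subset[OF finite_Sep E(2)])
  then have n: "n = card (Sep E D)" using one Suc.hyps(2) by simp
  obtain ss where ss: "(E, ss) \<in> paths (chambers \<A>) (chamber_edges \<A>)" "positive (E, ss)" "p_end (E, ss) = D"
    "length ss = card (Sep E D)"
    using Suc.hyps(1)[OF n Ec Suc.prems(2)] by blast
  have "(C, ((C, E), True) # ss) \<in> paths (chambers \<A>) (chamber_edges \<A>)"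
    using ss(1) E(1) Suc.prems(1) by (simp add: paths_Cons[OF edges_sub])
  moreover have "positive (C, ((C, E), True) # ss)" using ss(2) unfolding positive_def by simp
  ultimately show ?case
    using ss(3,4) n Suc.hyps(2) by (intro exI[of _ "((C, E), True) # ss"]) simp
qed

text \<open>The lower bound on lengths is attained. Minimality thus becomes an equation for the
  length, which can be followed step by step along a path.\<close>

lemma min_positive_paths_eq:
  assumes "C \<in> chambers \<A>" "D \<in> chambers \<A>"
  shows "min_positive_paths (chambers \<A>) (chamber_edges \<A>) C D =
    {\<alpha> \<in> paths (chambers \<A>) (chamber_edges \<A>). positive \<alpha> \<and> p_begin \<alpha> = C \<and> p_end \<alpha> = D \<and> p_length \<alpha> = card (Sep C D)}"
    (is "?L = ?R")
proof -
  have lower: "card (Sep C D) \<le> p_length \<alpha>"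
    if "\<alpha> \<in> paths (chambers \<A>) (chamber_edges \<A>)" "positive \<alpha>" "p_begin \<alpha> = C" "p_end \<alpha> = D" for \<alpha>
    using positive_path_length[of C "snd \<alpha>"] that by (cases \<alpha>) (simp add: p_length_def p_begin_def)
  obtain ss where ss: "(C, ss) \<in> ?R"
    using shortest_path_exists[OF assms] by (auto simp: p_length_def)
  show ?thesis
  proof
    show "?R \<subseteq> ?L" unfolding min_positive_paths_def Let_def using lower by auto
    show "?L \<subseteq> ?R"
    proof
      fix \<alpha> assume \<alpha>: "\<alpha> \<in> ?L"
      then have "p_length \<alpha> \<le> p_length (C, ss)" using ss unfolding min_positive_paths_def Let_def by blast
      moreover have a: "\<alpha> \<in> paths (chambers \<A>) (chamber_edges \<A>)" "positive \<alpha>" "p_begin \<alpha> = C" "p_end \<alpha> = D"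
        using \<alpha> unfolding min_positive_paths_def Let_def by blast+
      ultimately have "p_length \<alpha> = card (Sep C D)" using lower[OF a] ss by simp
      then show "\<alpha> \<in> ?R" using a by blast
    qed
  qed
qed

lemma min_positive_paths_nonempty:
  assumes "C \<in> chambers \<A>" "D \<in> chambers \<A>"
  shows "min_positive_paths (chambers \<A>) (chamber_edges \<A>) C D \<noteq> {}"
  unfolding min_positive_paths_eq[OF assms] using shortest_path_exists[OF assms] by (auto simp: p_length_def)

lemma connected_chambers: "connected_graph (chambers \<A>) (chamber_edges \<A>)"
  unfolding connected_graph_def
proof (intro conjI chambers_nonempty ballI)
  fix C D assume "C \<in> chambers \<A>" "D \<in> chambers \<A>"
  then obtain ss where "(C, ss) \<in> paths (chambers \<A>) (chamber_edges \<A>)" "p_end (C, ss) = D"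
    using shortest_path_exists by blast
  then show "\<exists>\<alpha>\<in>paths (chambers \<A>) (chamber_edges \<A>). p_begin \<alpha> = C \<and> p_end \<alpha> = D" by force
qed

section \<open>Common facets and the chambers at a face\<close>

definition facet :: "'a set \<Rightarrow> 'a set \<Rightarrow> 'a set" where
  "facet C D = (SOME G. G \<in> faces \<A> \<and> (\<forall>H\<in>\<A>. sn G H = (if sn C H = sn D H then sn C H else 0)))"

text \<open>Elimination on the unique hyperplane that separates the two chambers; their signs agree
  on all the others.\<close>

lemma facet:
  assumes "(C, D) \<in> chamber_edges \<A>"
  shows "facet C D \<in> faces \<A>"
    "H \<in> \<A> \<Longrightarrow> sn (facet C D) H = (if sn C H = sn D H then sn C H else 0)"
proof -
  have CD: "C \<in> chambers \<A>" "D \<in> chambers \<A>" "card (Sep C D) = 1" using assms edge_iff by auto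
  obtain H0 where H0: "Sep C D = {H0}" using CD(3) card_1_singletonE by blast
  have H0A: "H0 \<in> \<A>" "sn C H0 \<noteq> sn D H0" using H0 unfolding Sep_def by auto
  obtain G where G: "G \<in> faces \<A>" "sn G H0 = 0" "\<And>H'. H' \<in> \<A> \<Longrightarrow> sn C H' = sn D H' \<Longrightarrow> sn G H' = sn C H'"
    using face_elimination[OF chamber_face[OF CD(1)] chamber_face[OF CD(2)] H0A chamber_sn[OF CD(1) H0A(1)]
        chamber_sn[OF CD(2) H0A(1)]] by blast
  have "sn G H = (if sn C H = sn D H then sn C H else 0)" if "H \<in> \<A>" for H
  proof (cases "sn C H = sn D H")
    case False
    then have "H = H0" using H0 that unfolding Sep_def by blast
    then show ?thesis using G(2) False by simp
  qed (use G(3) that in simp)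
  then have "\<exists>G. G \<in> faces \<A> \<and> (\<forall>H\<in>\<A>. sn G H = (if sn C H = sn D H then sn C H else 0))" using G(1) by blast
  from someI_ex[OF this] show "facet C D \<in> faces \<A>"
    "H \<in> \<A> \<Longrightarrow> sn (facet C D) H = (if sn C H = sn D H then sn C H else 0)"
    unfolding facet_def by blast+
qed

lemma facet_ge:
  assumes "(C, D) \<in> chamber_edges \<A>"
  shows "face_ge (facet C D) C" "face_ge (facet C D) D"
proof -
  have "C \<in> faces \<A>" "D \<in> faces \<A>" using assms edge_iff chamber_face by auto
  then show "face_ge (facet C D) C" "face_ge (facet C D) D"
    using face_ge_iff[OF facet(1)[OF assms]] facet(2)[OF assms] by auto
qed

lemma chamber_at_eqI:
  assumes "F \<in> faces \<A>" "C \<in> chambers \<A>" "D \<in> chambers \<A>"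
    and "\<And>H. H \<in> \<A> \<Longrightarrow> sn D H = (if sn F H = 0 then sn C H else sn F H)"
  shows "chamber_at \<A> F C = D"
  using assms chamber_at[OF assms(1,2)] by (intro face_eqI) (auto intro: chamber_face)

lemma chamber_at_ge: "F \<in> faces \<A> \<Longrightarrow> C \<in> chambers \<A> \<Longrightarrow> face_ge F (chamber_at \<A> F C)"
  using chamber_at[of F C] face_ge_iff[of F "chamber_at \<A> F C"] chamber_face by auto

lemma chamber_at_id:
  assumes "F \<in> faces \<A>" "C \<in> chambers \<A>" "face_ge F C"
  shows "chamber_at \<A> F C = C"
proof (rule chamber_at_eqI[OF assms(1,2,2)])
  fix H assume "H \<in> \<A>"
  then have "sn F H = 0 \<or> sn F H = sn C H" using assms(3) face_ge_iff[OF assms(1) chamber_face[OF assms(2)]] by blast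
  then show "sn C H = (if sn F H = 0 then sn C H else sn F H)" by auto
qed

lemma chamber_at_self: "C \<in> chambers \<A> \<Longrightarrow> D \<in> chambers \<A> \<Longrightarrow> chamber_at \<A> D C = D"
  using chamber_at_eqI[OF chamber_face] chamber_sn by auto

text \<open>This makes \<open>F \<mapsto> (F, chamber_at \<A> F C)\<close> order preserving and
  \<open>W_ge\<close> transitive.\<close>

lemma chamber_at_trans:
  assumes "F \<in> faces \<A>" "G \<in> faces \<A>" "C \<in> chambers \<A>" "face_ge F G"
  shows "chamber_at \<A> G (chamber_at \<A> F C) = chamber_at \<A> G C"
proof (rule chamber_at_eqI[OF assms(2) chamber_at(1)[OF assms(1,3)] chamber_at(1)[OF assms(2,3)]])
  fix H assume H: "H \<in> \<A>"
  then have "sn F H = 0 \<or> sn F H = sn G H" using assms(4) face_ge_iff[OF assms(1,2)] by blast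
  then show "sn (chamber_at \<A> G C) H = (if sn G H = 0 then sn (chamber_at \<A> F C) H else sn G H)"
    using chamber_at(2)[OF assms(1,3) H] chamber_at(2)[OF assms(2,3) H] by auto
qed

text \<open>Seen from a chamber \<open>B\<close> on the departure side, the facet carries the
  chamber \<open>C\<close>. So \<open>(facet C D, C)\<close>, the vertex through which the edge from
  \<open>C\<close> to \<open>D\<close> runs, belongs to the copy of the face poset of
  \<open>B\<close>.\<close>

lemma chamber_at_facet:
  assumes "(C, D) \<in> chamber_edges \<A>" "B \<in> chambers \<A>" "\<And>H. H \<in> Sep C D \<Longrightarrow> sn B H = sn C H"
  shows "chamber_at \<A> (facet C D) B = C"
proof (rule chamber_at_eqI[OF facet(1)[OF assms(1)] assms(2)])
  show C: "C \<in> chambers \<A>" using assms(1) edge_iff by blast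
  fix H assume H: "H \<in> \<A>"
  show "sn C H = (if sn (facet C D) H = 0 then sn B H else sn (facet C D) H)"
  proof (cases "sn C H = sn D H")
    case True
    then show ?thesis using facet(2)[OF assms(1) H] chamber_sn[OF C H] by simp
  next
    case False
    then have "sn B H = sn C H" using assms(3) H unfolding Sep_def by blast
    then show ?thesis using facet(2)[OF assms(1) H] False by simp
  qed
qed

end

section \<open>The Salvetti complex as an order complex\<close>

text \<open>Repeatedly peeling off the greatest element orders the chain. It is needed because
  \<open>sal_simplices\<close> lists vertices along strictly descending sequences of faces, while an
  order complex consists of sets.\<close>

lemma chain_enumeration:
  assumes "finite \<sigma>" "\<sigma> \<noteq> {}"
    and "\<And>x y. x \<in> \<sigma> \<Longrightarrow> y \<in> \<sigma> \<Longrightarrow> ge x y \<or> ge y x"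
    and "\<And>x y z. \<lbrakk>x \<in> \<sigma>; y \<in> \<sigma>; z \<in> \<sigma>; ge x y; ge y z\<rbrakk> \<Longrightarrow> ge x z"
  shows "\<exists>(k::nat) p. \<sigma> = p ` {..k} \<and> (\<forall>i<k. ge (p i) (p (Suc i)) \<and> p i \<noteq> p (Suc i))"
  using assms
proof (induction "card \<sigma>" arbitrary: \<sigma>)
  case 0
  show ?case using 0(1-3) by simp
next
  case (Suc n)
  have "\<exists>x\<in>\<sigma>. \<forall>y\<in>\<sigma>. ge x y" by (rule finite_chain_greatest[OF Suc.prems])
  then obtain x where x: "x \<in> \<sigma>" "\<forall>y\<in>\<sigma>. ge x y" by blast
  show ?case
  proof (cases "\<sigma> = {x}")
    case True
    then show ?thesis by (intro exI[of _ 0] exI[of _ "\<lambda>_. x"]) simp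
  next
    case False
    then have ne: "\<sigma> - {x} \<noteq> {}" using x(1) by blast
    have "\<exists>(k::nat) p. \<sigma> - {x} = p ` {..k} \<and> (\<forall>i<k. ge (p i) (p (Suc i)) \<and> p i \<noteq> p (Suc i))"
    proof (rule Suc.hyps(1)[OF _ _ ne])
      show "n = card (\<sigma> - {x})" using Suc.hyps(2) Suc.prems(1) x(1) by simp
      show "finite (\<sigma> - {x})" using Suc.prems(1) by simp
      show "ge a b \<or> ge b a" if "a \<in> \<sigma> - {x}" "b \<in> \<sigma> - {x}" for a b
        using Suc.prems(3)[of a b] that by blast
      show "ge a c" if "a \<in> \<sigma> - {x}" "b \<in> \<sigma> - {x}" "c \<in> \<sigma> - {x}" "ge a b" "ge b c" for a b c
        using Suc.prems(4)[of a b c] that by blast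
    qed
    then obtain k p where p: "\<sigma> - {x} = p ` {..k::nat}" "\<forall>i<k. ge (p i) (p (Suc i)) \<and> p i \<noteq> p (Suc i)" by blast
    define p' where "p' = case_nat x p"
    have "p' ` {..Suc k} = insert x (p ` {..k})"
      unfolding atMost_Suc_eq_insert_0 p'_def by (simp add: image_image)
    then have "\<sigma> = p' ` {..Suc k}" using p(1) x(1) by auto
    moreover have "ge (p' i) (p' (Suc i)) \<and> p' i \<noteq> p' (Suc i)" if "i < Suc k" for i
    proof (cases i)
      case 0
      have "p 0 \<in> \<sigma> - {x}" unfolding p(1) by simp
      then show ?thesis using x(2) 0 unfolding p'_def by auto
    next
      case (Suc j)
      then show ?thesis using p(2) that unfolding p'_def by simp
    qed
    ultimately show ?thesis by blast
  qed
qed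

lemma sgn_sum:
  fixes t v :: "'i \<Rightarrow> real"
  assumes "finite I" "\<And>i. i \<in> I \<Longrightarrow> 0 \<le> t i" "\<And>i. i \<in> I \<Longrightarrow> t i \<noteq> 0 \<Longrightarrow> sgn (v i) = 0 \<or> sgn (v i) = s"
    and "p \<in> I" "0 < t p" "sgn (v p) = s"
  shows "sgn (\<Sum>i\<in>I. t i * v i) = s"
proof -
  consider "v p = 0" | "v p > 0" | "v p < 0" by linarith
  then show ?thesis
  proof cases
    case 1
    then have "s = 0" using assms(6) by simp
    then have "t i * v i = 0" if "i \<in> I" for i using assms(3)[OF that] by (auto simp: sgn_zero_iff)
    then have "(\<Sum>i\<in>I. t i * v i) = 0" by (intro sum.neutral) blast
    then show ?thesis using \<open>s = 0\<close> by simp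
  next
    case 2
    then have s: "s = 1" using assms(6) by simp
    have nn: "0 \<le> t i * v i" if "i \<in> I" for i
      using assms(3)[OF that] assms(2)[OF that] s by (cases "t i = 0") (auto simp: sgn_if split: if_splits)
    have "0 < (\<Sum>i\<in>I. t i * v i)"
      using assms 2 by (intro sum_pos2[OF assms(1,4) _ nn]) auto
    then show ?thesis using s by simp
  next
    case 3
    then have s: "s = -1" using assms(6) by simp
    have nn: "0 \<le> - (t i * v i)" if "i \<in> I" for i
      using assms(3)[OF that] assms(2)[OF that] s
      by (cases "t i = 0") (auto simp: sgn_if mult_le_0_iff split: if_splits)
    have "0 < (\<Sum>i\<in>I. - (t i * v i))"
      using assms 3 by (intro sum_pos2[OF assms(1,4) _ nn]) (auto simp: mult_pos_neg)
    then show ?thesis using s by (simp add: sum_negf)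
  qed
qed

context arrangement
begin

text \<open>One index for each vertex: \<open>sal_vertex\<close> sees \<open>C\<close> only through
  \<open>chamber_at\<close>, so it suffices to keep the pairs with \<open>F\<close> in the closure
  of \<open>C\<close>.\<close>

definition W :: "('a set \<times> 'a set) set" where
  "W = {(F, C). F \<in> faces \<A> \<and> C \<in> chambers \<A> \<and> face_ge F C}"

definition W_ge :: "'a set \<times> 'a set \<Rightarrow> 'a set \<times> 'a set \<Rightarrow> bool" where
  "W_ge = (\<lambda>(F, C) (G, D). face_ge F G \<and> D = chamber_at \<A> G C)"

definition vertex :: "'a set \<times> 'a set \<Rightarrow> 'a \<times> 'a" where
  "vertex p = sal_vertex \<A> w (fst p) (snd p)"

lemma W_ge_iff: "W_ge p q \<longleftrightarrow> face_ge (fst p) (fst q) \<and> snd q = chamber_at \<A> (fst q) (snd p)"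
  unfolding W_ge_def by (simp add: case_prod_beta)

lemma vertex_W: "(F, C) \<in> W \<Longrightarrow> vertex (F, C) = (w F, w F - w C)"
  unfolding vertex_def sal_vertex_def W_def using chamber_at_id by simp

lemma W_I: "F \<in> faces \<A> \<Longrightarrow> C \<in> chambers \<A> \<Longrightarrow> (F, chamber_at \<A> F C) \<in> W"
  unfolding W_def using chamber_at(1) chamber_at_ge by simp

lemma W_ge_I: "F \<in> faces \<A> \<Longrightarrow> G \<in> faces \<A> \<Longrightarrow> C \<in> chambers \<A> \<Longrightarrow> face_ge F G \<Longrightarrow>
    W_ge (F, chamber_at \<A> F C) (G, chamber_at \<A> G C)"
  unfolding W_ge_def by (simp add: chamber_at_trans)

lemma W_ge_refl: "p \<in> W \<Longrightarrow> W_ge p p"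
  unfolding W_ge_def W_def by (auto simp: face_ge_refl chamber_at_id)

lemma W_ge_trans:
  assumes "p \<in> W" "q \<in> W" "r \<in> W" "W_ge p q" "W_ge q r"
  shows "W_ge p r"
proof -
  obtain F C G D E B where *: "p = (F, C)" "q = (G, D)" "r = (E, B)" by (metis surj_pair)
  have "face_ge F G" "D = chamber_at \<A> G C" "face_ge G E" "B = chamber_at \<A> E D"
    using assms(4,5) unfolding W_ge_def * by auto
  moreover have "G \<in> faces \<A>" "E \<in> faces \<A>" "C \<in> chambers \<A>" using assms(1-3) unfolding W_def * by auto
  ultimately show ?thesis
    unfolding W_ge_def * using face_ge_trans[of F G E] chamber_at_trans[of G E C] by simp
qed

lemma W_ge_antisym:
  assumes "p \<in> W" "q \<in> W" "W_ge p q" "W_ge q p"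
  shows "p = q"
proof -
  obtain F C G D where *: "p = (F, C)" "q = (G, D)" by (metis surj_pair)
  have "F = G" using assms face_ge_antisym unfolding W_ge_def W_def * by auto
  moreover have "D = C" using assms \<open>F = G\<close> unfolding W_ge_def W_def * by (auto simp: chamber_at_id)
  ultimately show ?thesis using * by simp
qed

lemma finite_faces: "finite (faces \<A>)"
proof -
  have "inj_on (\<lambda>F. restrict (sn F) \<A>) (faces \<A>)"
  proof (rule inj_onI, rule face_eqI)
    fix F G H assume "restrict (sn F) \<A> = restrict (sn G) \<A>" "H \<in> \<A>"
    then show "sn F H = sn G H" by (metis restrict_apply')
  qed
  moreover have "(\<lambda>F. restrict (sn F) \<A>) ` faces \<A> \<subseteq> PiE \<A> (\<lambda>_. {0, 1, -1})"
    using sn_cases by fastforce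
  moreover have "finite (PiE \<A> (\<lambda>_. {0, 1, -1 :: real}))" by (intro finite_PiE finite_A) simp
  ultimately show ?thesis by (meson finite_imageD finite_subset)
qed

lemma finite_W: "finite W"
proof -
  have "W \<subseteq> faces \<A> \<times> faces \<A>" unfolding W_def using chamber_face by auto
  then show ?thesis using finite_faces finite_subset by blast
qed

lemma Sal_eq: "Sal \<A> w = (\<Union>\<sigma>\<in>order_complex W W_ge. convex hull (vertex ` \<sigma>))"
proof
  show "Sal \<A> w \<subseteq> (\<Union>\<sigma>\<in>order_complex W W_ge. convex hull (vertex ` \<sigma>))"
  proof
    fix x assume "x \<in> Sal \<A> w"
    then obtain k F C where x: "x \<in> convex hull ((\<lambda>i. sal_vertex \<A> w (F i) (C i)) ` {..k::nat})"
      and fc: "\<forall>i\<le>k. F i \<in> faces \<A> \<and> C i \<in> chambers \<A>"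
      and chain: "\<forall>i<k. face_ge (F i) (F (Suc i)) \<and> F i \<noteq> F (Suc i)"
      and same: "\<forall>i\<le>k. chamber_at \<A> (F i) (C 0) = chamber_at \<A> (F i) (C i)"
      unfolding Sal_def sal_simplices_def by auto
    define p where "p i = (F i, chamber_at \<A> (F i) (C 0))" for i
    have C0: "C 0 \<in> chambers \<A>" using fc by simp
    have le: "face_ge (F i) (F j)" if "i \<le> j" "j \<le> k" for i j
      using that
    proof (induction j rule: dec_induct)
      case base
      show ?case by (rule face_ge_refl)
    next
      case (step n)
      then show ?case using chain face_ge_trans[of "F i" "F n"] by simp
    qed
    have ge: "W_ge (p i) (p j)" if "i \<le> j" "j \<le> k" for i j
      unfolding p_def using fc that by (intro W_ge_I C0 le) auto
    have "p ` {..k} \<in> order_complex W W_ge"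
      unfolding order_complex_def
    proof (intro CollectI conjI ballI)
      show "p ` {..k} \<subseteq> W" unfolding p_def using fc C0 W_I by auto
      fix a b assume "a \<in> p ` {..k}" "b \<in> p ` {..k}"
      then obtain i j where "a = p i" "b = p j" "i \<le> k" "j \<le> k" by auto
      then show "W_ge a b \<or> W_ge b a" using ge by (metis linear)
    qed auto
    moreover have "vertex (p i) = sal_vertex \<A> w (F i) (C i)" if "i \<le> k" for i
    proof -
      have "chamber_at \<A> (F i) (chamber_at \<A> (F i) (C 0)) = chamber_at \<A> (F i) (C i)"
        using fc that C0 same by (simp add: chamber_at_trans face_ge_refl)
      then show ?thesis unfolding vertex_def p_def sal_vertex_def by simp
    qed
    then have "vertex ` p ` {..k} = (\<lambda>i. sal_vertex \<A> w (F i) (C i)) ` {..k}"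
      unfolding image_image by (intro image_cong) auto
    ultimately show "x \<in> (\<Union>\<sigma>\<in>order_complex W W_ge. convex hull (vertex ` \<sigma>))"
      using x by (intro UN_I[of "p ` {..k}"]) simp_all
  qed
  show "(\<Union>\<sigma>\<in>order_complex W W_ge. convex hull (vertex ` \<sigma>)) \<subseteq> Sal \<A> w"
  proof (rule UN_least)
    fix \<sigma> assume "\<sigma> \<in> order_complex W W_ge"
    note \<sigma> = order_complexD[OF this]
    have "\<exists>(k::nat) p. \<sigma> = p ` {..k} \<and> (\<forall>i<k. W_ge (p i) (p (Suc i)) \<and> p i \<noteq> p (Suc i))"
    proof (rule chain_enumeration[OF \<sigma>(1,2,4)])
      show "W_ge x z" if "x \<in> \<sigma>" "y \<in> \<sigma>" "z \<in> \<sigma>" "W_ge x y" "W_ge y z" for x y z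
        using W_ge_trans[of x y z] \<sigma>(3) that by blast
    qed
    then obtain k p where p: "\<sigma> = p ` {..k::nat}" "\<forall>i<k. W_ge (p i) (p (Suc i)) \<and> p i \<noteq> p (Suc i)" by blast
    have pW: "p i \<in> W" if "i \<le> k" for i using that p(1) \<sigma>(3) by auto
    have p0: "W_ge (p 0) (p i)" if "i \<le> k" for i
      using that
    proof (induction i)
      case 0
      then show ?case using W_ge_refl pW by blast
    next
      case (Suc i)
      then show ?case using W_ge_trans[of "p 0" "p i" "p (Suc i)"] pW p(2) by auto
    qed
    have fc: "fst (p i) \<in> faces \<A>" "snd (p i) \<in> chambers \<A>" "face_ge (fst (p i)) (snd (p i))" if "i \<le> k" for i
      using pW[OF that] unfolding W_def by auto
    have "face_ge (fst (p i)) (fst (p (Suc i))) \<and> fst (p i) \<noteq> fst (p (Suc i))" if "i < k" for i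
    proof -
      have ge: "face_ge (fst (p i)) (fst (p (Suc i)))" "snd (p (Suc i)) = chamber_at \<A> (fst (p (Suc i))) (snd (p i))"
        using p(2) that unfolding W_ge_iff by blast+
      \<comment> \<open>Inside \<open>W\<close> a chamber is its own localization, so equal faces
        would carry equal chambers and the chain would not be strict.\<close>
      have "fst (p i) \<noteq> fst (p (Suc i))"
      proof
        assume "fst (p i) = fst (p (Suc i))"
        then have "snd (p (Suc i)) = snd (p i)" using ge(2) fc[of i] that chamber_at_id by simp
        then have "p i = p (Suc i)" using \<open>fst (p i) = fst (p (Suc i))\<close> by (simp add: prod_eq_iff)
        then show False using p(2) that by blast
      qed
      then show ?thesis using ge(1) by blast
    qed
    moreover have "chamber_at \<A> (fst (p i)) (snd (p 0)) = chamber_at \<A> (fst (p i)) (snd (p i))" if "i \<le> k" for i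
      using p0[OF that] chamber_at_id[OF fc[OF that]] unfolding W_ge_iff by simp
    moreover have "vertex ` \<sigma> = (\<lambda>i. sal_vertex \<A> w (fst (p i)) (snd (p i))) ` {..k}"
      unfolding p(1) image_image vertex_def ..
    ultimately have "convex hull (vertex ` \<sigma>) \<in> sal_simplices \<A> w"
      unfolding sal_simplices_def using fc(1,2)
      by (intro CollectI exI[of _ k] exI[of _ "\<lambda>i. fst (p i)"] exI[of _ "\<lambda>i. snd (p i)"]) simp
    then show "convex hull (vertex ` \<sigma>) \<subseteq> Sal \<A> w" unfolding Sal_def by blast
  qed
qed

text \<open>Barycentric coordinates on a chain without the condition that the total is 1, so that
  the class is stable under lowering the weight of a vertex.\<close>

definition chain_weight :: "('a set \<times> 'a set \<Rightarrow> real) \<Rightarrow> bool" where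
  "chain_weight t \<longleftrightarrow> (\<forall>x. 0 \<le> t x) \<and> {x. t x \<noteq> 0} \<subseteq> W \<and>
     (\<forall>x y. t x \<noteq> 0 \<longrightarrow> t y \<noteq> 0 \<longrightarrow> W_ge x y \<or> W_ge y x)"

lemma nrm_sum: "nrm H \<bullet> (\<Sum>q\<in>W. t q *\<^sub>R w (f q)) = (\<Sum>q\<in>W. t q * val H (w (f q))) + sum t W * off H"
  unfolding val_def by (simp add: inner_sum_right right_diff_distrib sum_subtractf sum_distrib_right)

text \<open>
  The smallest vertex \<open>(F, C)\<close> of the carrier of a point of the Salvetti complex can be read off from the
  point: its real part lies in \<open>F\<close>, and its imaginary part is directed away from \<open>C\<close> across every
  hyperplane through \<open>F\<close>. Scaling by the total weight allows to split off this vertex.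
\<close>

lemma bottom_vertex:
  assumes t: "chain_weight t" "sum t W > 0"
  obtains F C where "(F, C) \<in> W" "t (F, C) > 0"
    "\<forall>H\<in>\<A>. sn F H = sgn (nrm H \<bullet> (\<Sum>q\<in>W. t q *\<^sub>R fst (vertex q)) - sum t W * off H)"
    "\<forall>H\<in>\<A>. sn F H = 0 \<longrightarrow> sn C H = - sgn (nrm H \<bullet> (\<Sum>q\<in>W. t q *\<^sub>R snd (vertex q)))"
proof -
  let ?S = "{x. t x \<noteq> 0}"
  have SW: "?S \<subseteq> W" and nn: "\<And>x. 0 \<le> t x" and ch: "\<And>x y. t x \<noteq> 0 \<Longrightarrow> t y \<noteq> 0 \<Longrightarrow> W_ge x y \<or> W_ge y x"
    using t(1) unfolding chain_weight_def by blast+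
  have "\<exists>p\<in>?S. \<forall>q\<in>?S. W_ge q p"
  proof (rule finite_chain_greatest[of ?S "\<lambda>x y. W_ge y x"])
    show "finite ?S" using SW finite_W finite_subset by blast
    have "\<exists>x\<in>W. t x \<noteq> 0" using t(2) by (metis less_irrefl sum.neutral)
    then show "?S \<noteq> {}" by blast
    show "W_ge y x \<or> W_ge x y" if "x \<in> ?S" "y \<in> ?S" for x y using ch that by blast
    show "W_ge z x" if "x \<in> ?S" "y \<in> ?S" "z \<in> ?S" "W_ge y x" "W_ge z y" for x y z
      using W_ge_trans[of z y x] that SW by blast
  qed
  then obtain p where p: "t p \<noteq> 0" "\<And>q. t q \<noteq> 0 \<Longrightarrow> W_ge q p" by blast
  obtain F C where FC: "p = (F, C)" by (cases p)
  have pW: "(F, C) \<in> W" using SW p(1) FC by blast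
  then have f: "F \<in> faces \<A>" "C \<in> chambers \<A>" unfolding W_def by auto
  have tp: "t (F, C) > 0" using nn[of p] p(1) FC by simp
  have q: "q \<in> W" "fst q \<in> faces \<A>" "snd q \<in> chambers \<A>" "vertex q = (w (fst q), w (fst q) - w (snd q))"
    "\<And>H. H \<in> \<A> \<Longrightarrow> sn (fst q) H = 0 \<or> sn (fst q) H = sn F H"
    "\<And>H. H \<in> \<A> \<Longrightarrow> sn F H = 0 \<Longrightarrow> sn C H = sn (snd q) H" if tq: "t q \<noteq> 0" for q
  proof -
    obtain G D where qq: "q = (G, D)" by (cases q)
    show "q \<in> W" using SW tq by blast
    then have gd: "G \<in> faces \<A>" "D \<in> chambers \<A>" "(G, D) \<in> W" unfolding W_def qq by auto
    show "fst q \<in> faces \<A>" "snd q \<in> chambers \<A>" "vertex q = (w (fst q), w (fst q) - w (snd q))"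
      using gd vertex_W unfolding qq by auto
    have ge: "face_ge G F" "C = chamber_at \<A> F D" using p(2)[OF tq] unfolding qq FC W_ge_def by auto
    show "sn (fst q) H = 0 \<or> sn (fst q) H = sn F H" if "H \<in> \<A>" for H
      using ge(1) that unfolding face_ge_iff[OF gd(1) f(1)] qq by simp
    show "sn C H = sn (snd q) H" if "H \<in> \<A>" "sn F H = 0" for H
      using chamber_at(2)[OF f(1) gd(2) that(1)] that(2) ge(2) qq by simp
  qed
  have pq: "w (fst (F, C)) = w F" by simp
  have re: "sn F H = sgn (nrm H \<bullet> (\<Sum>q\<in>W. t q *\<^sub>R fst (vertex q)) - sum t W * off H)" if H: "H \<in> \<A>" for H
  proof -
    have "(\<Sum>q\<in>W. t q *\<^sub>R fst (vertex q)) = (\<Sum>q\<in>W. t q *\<^sub>R w (fst q))"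
    proof (rule sum.cong[OF HOL.refl])
      fix q show "t q *\<^sub>R fst (vertex q) = t q *\<^sub>R w (fst q)"
        using q(4)[of q] by (cases "t q = 0") simp_all
    qed
    then have "nrm H \<bullet> (\<Sum>q\<in>W. t q *\<^sub>R fst (vertex q)) - sum t W * off H = (\<Sum>q\<in>W. t q * val H (w (fst q)))"
      by (simp add: nrm_sum)
    moreover have "sgn (\<Sum>q\<in>W. t q * val H (w (fst q))) = sn F H"
    proof (rule sgn_sum[OF finite_W, where t = t and p = "(F, C)"])
      show "sgn (val H (w (fst (F, C)))) = sn F H" unfolding sn_def by simp
      show "sgn (val H (w (fst q))) = 0 \<or> sgn (val H (w (fst q))) = sn F H" if "t q \<noteq> 0" for q
        using q(5)[OF that H] unfolding sn_def .
    qed (use nn pW tp in auto)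
    ultimately show ?thesis by simp
  qed
  have im: "sn C H = - sgn (nrm H \<bullet> (\<Sum>q\<in>W. t q *\<^sub>R snd (vertex q)))" if H: "H \<in> \<A>" and F0: "sn F H = 0" for H
  proof -
    have "nrm H \<bullet> (\<Sum>q\<in>W. t q *\<^sub>R snd (vertex q)) = (\<Sum>q\<in>W. t q * (nrm H \<bullet> snd (vertex q)))"
      by (simp add: inner_sum_right)
    also have "\<dots> = (\<Sum>q\<in>W. t q * - val H (w (snd q)))"
    proof (rule sum.cong[OF HOL.refl])
      fix q
      show "t q * (nrm H \<bullet> snd (vertex q)) = t q * - val H (w (snd q))"
      proof (cases "t q = 0")
        case False
        \<comment> \<open>If \<open>F\<close> lies on \<open>H\<close>, so does every larger face of
          the carrier. The real point of the vertex then contributes nothing to the imaginary part,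
          and only the chamber, which is on the same side of \<open>H\<close> as \<open>C\<close>,
          is seen.\<close>
        have "sn (fst q) H = 0" using q(5)[OF False H] F0 by auto
        then have "val H (w (fst q)) = 0" unfolding sn_def by (simp add: sgn_zero_iff)
        then show ?thesis unfolding q(4)[OF False] by (simp add: val_def inner_diff_right)
      qed simp
    qed
    also have "sgn \<dots> = - sn C H"
    proof (rule sgn_sum[OF finite_W, where t = t and p = "(F, C)"])
      show "sgn (- val H (w (snd (F, C)))) = - sn C H" unfolding sn_def by (simp add: sgn_minus)
      show "sgn (- val H (w (snd q))) = 0 \<or> sgn (- val H (w (snd q))) = - sn C H" if "t q \<noteq> 0" for q
        using q(6)[OF that H F0] unfolding sn_def by (simp add: sgn_minus)
    qed (use nn pW tp in auto)
    finally show ?thesis by simp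
  qed
  show thesis using that[OF pW tp] re im by blast
qed

text \<open>By \<open>bottom_vertex\<close> both carriers have the same lowest vertex. Subtracting
  the smaller of its two weights from both sides preserves the equations and removes the vertex from
  at least one carrier, so the total size of the carriers decreases.\<close>

lemma chain_weight_unique:
  assumes "chain_weight t" "chain_weight u" "sum t W = sum u W"
    and "(\<Sum>q\<in>W. t q *\<^sub>R vertex q) = (\<Sum>q\<in>W. u q *\<^sub>R vertex q)"
  shows "t = u"
  using assms
proof (induction "card {x. t x \<noteq> 0} + card {x. u x \<noteq> 0}" arbitrary: t u rule: less_induct)
  case less
  have nn: "\<And>x. 0 \<le> t x" "\<And>x. 0 \<le> u x" and sub: "{x. t x \<noteq> 0} \<subseteq> W" "{x. u x \<noteq> 0} \<subseteq> W"
    using less.prems(1,2) unfolding chain_weight_def by blast+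
  have fin: "finite {x. t x \<noteq> 0}" "finite {x. u x \<noteq> 0}" using sub finite_W finite_subset by blast+
  show ?case
  proof (cases "sum t W = 0")
    case True
    have "v x = 0" if "sum v W = 0" "\<And>x. 0 \<le> v x" "{x. v x \<noteq> 0} \<subseteq> W" for v :: "'a set \<times> 'a set \<Rightarrow> real" and x
      using sum_nonneg_eq_0_iff[OF finite_W, of v] that by blast
    then show ?thesis using True less.prems(3) nn sub by (intro ext) metis
  next
    case False
    then have pos: "sum t W > 0" "sum u W > 0" using sum_nonneg[of W t] nn less.prems(3) by (auto simp: less_le)
    have re: "(\<Sum>q\<in>W. t q *\<^sub>R fst (vertex q)) = (\<Sum>q\<in>W. u q *\<^sub>R fst (vertex q))"
      using arg_cong[OF less.prems(4), of fst] by (simp add: fst_sum)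
    have im: "(\<Sum>q\<in>W. t q *\<^sub>R snd (vertex q)) = (\<Sum>q\<in>W. u q *\<^sub>R snd (vertex q))"
      using arg_cong[OF less.prems(4), of snd] by (simp add: snd_sum)
    obtain F C where FC: "(F, C) \<in> W" "t (F, C) > 0"
      "\<forall>H\<in>\<A>. sn F H = sgn (nrm H \<bullet> (\<Sum>q\<in>W. t q *\<^sub>R fst (vertex q)) - sum t W * off H)"
      "\<forall>H\<in>\<A>. sn F H = 0 \<longrightarrow> sn C H = - sgn (nrm H \<bullet> (\<Sum>q\<in>W. t q *\<^sub>R snd (vertex q)))"
      using bottom_vertex[OF less.prems(1) pos(1)] by blast
    obtain G D where GD: "(G, D) \<in> W" "u (G, D) > 0"
      "\<forall>H\<in>\<A>. sn G H = sgn (nrm H \<bullet> (\<Sum>q\<in>W. u q *\<^sub>R fst (vertex q)) - sum u W * off H)"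
      "\<forall>H\<in>\<A>. sn G H = 0 \<longrightarrow> sn D H = - sgn (nrm H \<bullet> (\<Sum>q\<in>W. u q *\<^sub>R snd (vertex q)))"
      using bottom_vertex[OF less.prems(2) pos(2)] by blast
    have f: "F \<in> faces \<A>" "C \<in> faces \<A>" "G \<in> faces \<A>" "D \<in> faces \<A>" "face_ge F C" "face_ge G D"
      using FC(1) GD(1) chamber_face unfolding W_def by auto
    have FG: "F = G" by (rule face_eqI[OF f(1,3)]) (simp add: FC(3) GD(3) re less.prems(3))
    have "C = D"
    proof (rule face_eqI[OF f(2,4)])
      fix H assume H: "H \<in> \<A>"
      show "sn C H = sn D H"
      proof (cases "sn F H = 0")
        case True
        then show ?thesis using bspec[OF FC(4) H] bspec[OF GD(4) H] FG im by simp
      next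
        case False
        have "sn F H = sn C H" using f(5) False H unfolding face_ge_iff[OF f(1,2)] by blast
        moreover have "sn G H = sn D H" using f(6) False H FG unfolding face_ge_iff[OF f(3,4)] by blast
        ultimately show ?thesis using FG by simp
      qed
    qed
    define p where "p = (F, C)"
    have p: "p \<in> W" "t p > 0" "u p > 0" using FC(1,2) GD(2) FG \<open>C = D\<close> unfolding p_def by auto
    define m where "m = min (t p) (u p)"
    have m: "m > 0" "m \<le> t p" "m \<le> u p" using p unfolding m_def by auto
    define t' u' where "t' = t(p := t p - m)" and "u' = u(p := u p - m)"
    have cw: "chain_weight (v(p := v p - m))" if "chain_weight v" "m \<le> v p" "v p > 0" for v
      unfolding chain_weight_def
    proof (intro conjI allI impI)
      have "0 \<le> v x" for x using that(1) unfolding chain_weight_def by blast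
      then show "0 \<le> (v(p := v p - m)) x" for x using that(2) by simp
      show "{x. (v(p := v p - m)) x \<noteq> 0} \<subseteq> W" using that p(1) unfolding chain_weight_def by auto
      fix x y assume "(v(p := v p - m)) x \<noteq> 0" "(v(p := v p - m)) y \<noteq> 0"
      then have "v x \<noteq> 0" "v y \<noteq> 0" using that(3) by (auto split: if_splits)
      then show "W_ge x y \<or> W_ge y x" using that(1) unfolding chain_weight_def by blast
    qed
    have upd: "(v(p := v p - m)) q = v q - (if q = p then m else 0)" for v :: "'a set \<times> 'a set \<Rightarrow> real" and q by simp
    have s: "sum (v(p := v p - m)) W = sum v W - m" for v :: "'a set \<times> 'a set \<Rightarrow> real"
      unfolding upd using finite_W p(1) by (simp add: sum_subtractf)
    have vs: "(\<Sum>q\<in>W. (v(p := v p - m)) q *\<^sub>R vertex q) = (\<Sum>q\<in>W. v q *\<^sub>R vertex q) - m *\<^sub>R vertex p"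
      for v :: "'a set \<times> 'a set \<Rightarrow> real"
    proof -
      have "(\<Sum>q\<in>W. (if q = p then m else 0) *\<^sub>R vertex q) = (\<Sum>q\<in>W. if q = p then m *\<^sub>R vertex q else 0)"
        by (intro sum.cong) auto
      also have "\<dots> = m *\<^sub>R vertex p" using finite_W p(1) by simp
      finally show ?thesis unfolding upd by (simp add: scaleR_diff_left sum_subtractf)
    qed
    have smaller: "card {x. t' x \<noteq> 0} + card {x. u' x \<noteq> 0} < card {x. t x \<noteq> 0} + card {x. u x \<noteq> 0}"
    proof -
      have sub: "{x. t' x \<noteq> 0} \<subseteq> {x. t x \<noteq> 0}" "{x. u' x \<noteq> 0} \<subseteq> {x. u x \<noteq> 0}"
        using p unfolding t'_def u'_def by auto
      have "t' p = 0 \<or> u' p = 0" unfolding t'_def u'_def m_def by auto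
      then show ?thesis
      proof
        assume "t' p = 0"
        then have "{x. t' x \<noteq> 0} \<subset> {x. t x \<noteq> 0}" using sub p by auto
        then show ?thesis using psubset_card_mono[OF fin(1)] card_mono[OF fin(2) sub(2)] by (simp add: add_less_le_mono)
      next
        assume "u' p = 0"
        then have "{x. u' x \<noteq> 0} \<subset> {x. u x \<noteq> 0}" using sub p by auto
        then show ?thesis using psubset_card_mono[OF fin(2)] card_mono[OF fin(1) sub(1)] by (simp add: add_le_less_mono)
      qed
    qed
    have "t' = u'"
    proof (rule less.hyps[OF smaller])
      show "chain_weight t'" unfolding t'_def by (rule cw[OF less.prems(1) m(2) p(2)])
      show "chain_weight u'" unfolding u'_def by (rule cw[OF less.prems(2) m(3) p(3)])
      show "sum t' W = sum u' W" unfolding t'_def u'_def s less.prems(3) ..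
      show "(\<Sum>q\<in>W. t' q *\<^sub>R vertex q) = (\<Sum>q\<in>W. u' q *\<^sub>R vertex q)"
        unfolding t'_def u'_def vs less.prems(4) ..
    qed
    show "t = u"
    proof
      fix q
      have "t' q = u' q" using \<open>t' = u'\<close> by simp
      then show "t q = u q" unfolding t'_def u'_def upd by simp
    qed
  qed
qed

lemma simplex_weight:
  assumes "\<sigma> \<in> order_complex W W_ge" "t \<in> simplex_points \<sigma>"
  shows "chain_weight t" "sum t W = 1" "(\<Sum>x\<in>\<sigma>. t x *\<^sub>R vertex x) = (\<Sum>x\<in>W. t x *\<^sub>R vertex x)"
proof -
  note \<sigma> = order_complexD[OF assms(1)]
  have out: "t x = 0" if "x \<notin> \<sigma>" for x using assms(2) that unfolding simplex_points_def by blast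
  show "chain_weight t"
    unfolding chain_weight_def
  proof (intro conjI allI impI)
    show "0 \<le> t x" for x using assms(2) unfolding simplex_points_def by blast
    show "{x. t x \<noteq> 0} \<subseteq> W" using out \<sigma>(3) by blast
    show "W_ge x y \<or> W_ge y x" if "t x \<noteq> 0" "t y \<noteq> 0" for x y using out \<sigma>(4) that by blast
  qed
  have "sum t W = sum t \<sigma>" using out by (intro sum.mono_neutral_right[OF finite_W \<sigma>(3)]) simp
  then show "sum t W = 1" using assms(2) unfolding simplex_points_def by simp
  show "(\<Sum>x\<in>\<sigma>. t x *\<^sub>R vertex x) = (\<Sum>x\<in>W. t x *\<^sub>R vertex x)"
    using out by (intro sum.mono_neutral_left[OF finite_W \<sigma>(3)]) simp
qed

lemma vertex_embedded:
  assumes "\<sigma> \<in> order_complex W W_ge" "\<tau> \<in> order_complex W W_ge" "t \<in> simplex_points \<sigma>" "u \<in> simplex_points \<tau>"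
    and "(\<Sum>x\<in>\<sigma>. t x *\<^sub>R vertex x) = (\<Sum>x\<in>\<tau>. u x *\<^sub>R vertex x)"
  shows "t = u"
  by (rule chain_weight_unique)
    (use simplex_weight[OF assms(1,3)] simplex_weight[OF assms(2,4)] assms(5) in simp_all)

lemma vertex_inj:
  assumes "p \<in> W" "q \<in> W" "vertex p = vertex q"
  shows "p = q"
proof -
  have s: "{a} \<in> order_complex W W_ge" if "a \<in> W" for a
    using that W_ge_refl unfolding order_complex_def by auto
  have v: "(\<lambda>x. if x = a then 1 else 0) \<in> simplex_points {a}" for a :: "'a set \<times> 'a set"
    by (rule vertex_in_simplex_points) auto
  have "(\<lambda>x. if x = p then 1 else 0 :: real) = (\<lambda>x. if x = q then 1 else 0)"
    by (rule vertex_embedded[OF s[OF assms(1)] s[OF assms(2)] v v]) (simp add: assms(3))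
  from fun_cong[OF this, of p] show ?thesis by (auto split: if_splits)
qed

end

section \<open>The oriented system of a covering\<close>

locale salvetti_covering = arrangement \<A> w for \<A> :: "'a::euclidean_space set set" and w +
  fixes S' :: "'s::topological_space set" and r :: "'s \<Rightarrow> 'a \<times> 'a"
  assumes covering: "covering_space S' r (Sal \<A> w)"
begin

abbreviation "K \<equiv> order_complex W W_ge"

definition fibre :: "'a set \<times> 'a set \<Rightarrow> 's set" where
  "fibre p = {s\<in>S'. r s = vertex p}"

text \<open>Transport along the segment between two vertices, in either direction. By
  \<open>tr_section\<close> the chosen section may be replaced by one over any simplex containing
  both vertices.\<close>

definition tr :: "'a set \<times> 'a set \<Rightarrow> 'a set \<times> 'a set \<Rightarrow> 's \<Rightarrow> 's" where
  "tr p q s = (SOME g. is_section S' r (convex hull {vertex p, vertex q}) g \<and> g (vertex p) = s) (vertex q)"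

lemma section_at:
  assumes "\<sigma> \<in> K" "p \<in> \<sigma>" "s \<in> fibre p"
  shows "\<exists>g. is_section S' r (convex hull (vertex ` \<sigma>)) g \<and> g (vertex p) = s"
proof -
  have "convex hull (vertex ` \<sigma>) \<subseteq> Sal \<A> w" unfolding Sal_eq using assms(1) by blast
  moreover have "compact (convex hull (vertex ` \<sigma>))"
    using order_complexD(1)[OF assms(1)] by (simp add: compact_convex_hull finite_imp_compact)
  moreover have "s \<in> S'" "r s = vertex p" using assms(3) unfolding fibre_def by auto
  moreover have "vertex p \<in> convex hull (vertex ` \<sigma>)" using assms(2) by (auto intro: hull_inc)
  ultimately show ?thesis
    using section_exists[OF covering _ _ convex_convex_hull, of "vertex ` \<sigma>" s] by simp
qed

lemma tr_section:
  assumes "\<sigma> \<in> K" "is_section S' r (convex hull (vertex ` \<sigma>)) g" "p \<in> \<sigma>" "q \<in> \<sigma>"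
  shows "tr p q (g (vertex p)) = g (vertex q)"
proof -
  let ?H = "convex hull {vertex p, vertex q}"
  have "?H \<subseteq> convex hull (vertex ` \<sigma>)" using assms(3,4) by (intro hull_mono) auto
  then have g: "is_section S' r ?H g" using assms(2) is_section_subset by blast
  define g' where "g' = (SOME g'. is_section S' r ?H g' \<and> g' (vertex p) = g (vertex p))"
  have g': "is_section S' r ?H g' \<and> g' (vertex p) = g (vertex p)"
    unfolding g'_def by (rule someI[of _ g]) (simp add: g)
  have "g' (vertex q) = g (vertex q)"
    by (rule section_unique[OF covering conjunct1[OF g'] g convex_connected[OF convex_convex_hull] _ conjunct2[OF g']])
      (auto intro: hull_inc)
  then show ?thesis unfolding tr_def g'_def .
qed

lemma edge_K: "\<lbrakk>p \<in> W; q \<in> W; W_ge p q\<rbrakk> \<Longrightarrow> {p, q} \<in> K" "\<lbrakk>p \<in> W; q \<in> W; W_ge p q\<rbrakk> \<Longrightarrow> {q, p} \<in> K"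
  using W_ge_refl unfolding order_complex_def by auto

lemma tr_in:
  assumes "{p, q} \<in> K" "s \<in> fibre p"
  shows "tr p q s \<in> fibre q"
proof -
  obtain g where g: "is_section S' r (convex hull (vertex ` {p, q})) g" "g (vertex p) = s"
    using section_at[OF assms(1) _ assms(2)] by blast
  have "vertex q \<in> convex hull (vertex ` {p, q})" by (auto intro: hull_inc)
  then have "g (vertex q) \<in> fibre q" using is_section_in[OF g(1)] is_section_inv[OF g(1)] unfolding fibre_def by blast
  moreover have "tr p q s = g (vertex q)" using tr_section[OF assms(1) g(1), of p q] g(2) by simp
  ultimately show ?thesis by simp
qed

text \<open>All three transports are read off one section over the simplex.\<close>

lemma tr_comp:
  assumes "\<sigma> \<in> K" "p \<in> \<sigma>" "q \<in> \<sigma>" "x \<in> \<sigma>" "s \<in> fibre p"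
  shows "tr q x (tr p q s) = tr p x s"
proof -
  obtain g where g: "is_section S' r (convex hull (vertex ` \<sigma>)) g" "g (vertex p) = s"
    using section_at[OF assms(1,2,5)] by blast
  show ?thesis
    using tr_section[OF assms(1) g(1) assms(2,3)] tr_section[OF assms(1) g(1) assms(3,4)]
      tr_section[OF assms(1) g(1) assms(2,4)] g(2) by simp
qed

lemma tr_id:
  assumes "p \<in> W" "s \<in> fibre p"
  shows "tr p p s = s"
proof -
  have K: "{p} \<in> K" using edge_K(1)[OF assms(1,1) W_ge_refl[OF assms(1)]] by simp
  obtain g where g: "is_section S' r (convex hull (vertex ` {p})) g" "g (vertex p) = s"
    using section_at[OF K _ assms(2)] by blast
  show ?thesis using tr_section[OF K g(1), of p p] g(2) by simp
qed

lemma tr_inverse: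
  assumes "{p, q} \<in> K" "s \<in> fibre p"
  shows "tr q p (tr p q s) = s"
proof -
  have "p \<in> W" using order_complexD(3)[OF assms(1)] by blast
  then show ?thesis using tr_comp[OF assms(1) _ _ _ assms(2), of q p] tr_id assms(2) by simp
qed

text \<open>In the copy of the face poset attached to \<open>C\<close>, comparable faces span an
  edge and chains of three faces a simplex, over which transport composes. Going back along an edge
  supplies the inverse bijection.\<close>

lemma chamber_local_system:
  assumes C: "C \<in> chambers \<A>"
  shows "local_system \<A> w (\<lambda>F. fibre (F, chamber_at \<A> F C)) (\<lambda>F G. tr (F, chamber_at \<A> F C) (G, chamber_at \<A> G C))"
proof
  fix F G assume FG: "F \<in> faces \<A>" "G \<in> faces \<A>" "face_ge F G"
  let ?p = "(F, chamber_at \<A> F C)" and ?q = "(G, chamber_at \<A> G C)"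
  have K: "{?p, ?q} \<in> K" "{?q, ?p} \<in> K"
    using edge_K[OF W_I[OF FG(1) C] W_I[OF FG(2) C] W_ge_I[OF FG(1,2) C FG(3)]] by auto
  show "bij_betw (tr ?p ?q) (fibre ?p) (fibre ?q)"
    by (rule bij_betwI[of _ _ _ "tr ?q ?p"]) (auto intro: tr_in[OF K(1)] tr_in[OF K(2)] simp: tr_inverse[OF K(1)] tr_inverse[OF K(2)])
next
  fix F G E u assume f: "F \<in> faces \<A>" "G \<in> faces \<A>" "E \<in> faces \<A>" "face_ge F G" "face_ge G E"
    and u: "u \<in> fibre (F, chamber_at \<A> F C)"
  let ?p = "(F, chamber_at \<A> F C)" and ?q = "(G, chamber_at \<A> G C)" and ?x = "(E, chamber_at \<A> E C)"
  have W: "?p \<in> W" "?q \<in> W" "?x \<in> W" using f W_I[OF _ C] by auto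
  have ge: "W_ge ?p ?q" "W_ge ?q ?x" using f W_ge_I[OF _ _ C] by auto
  have "{?p, ?q, ?x} \<in> K"
    unfolding order_complex_def using W ge W_ge_trans[OF W ge] W_ge_refl by auto
  then show "tr ?q ?x (tr ?p ?q u) = tr ?p ?x u" by (rule tr_comp) (use u in auto)
qed

text \<open>The face \<open>F\<close> is sent to a point over the vertex \<open>(F, C\<^sub>F)\<close>.\<close>

definition parallel :: "'a set \<Rightarrow> ('a set \<Rightarrow> 's) \<Rightarrow> bool" where
  "parallel C s \<longleftrightarrow> (\<forall>F\<in>faces \<A>. s F \<in> fibre (F, chamber_at \<A> F C)) \<and>
     (\<forall>F\<in>faces \<A>. \<forall>G\<in>faces \<A>. face_ge F G \<longrightarrow> tr (F, chamber_at \<A> F C) (G, chamber_at \<A> G C) (s F) = s G)"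

lemma parallel_exists:
  assumes C: "C \<in> chambers \<A>" and u: "u \<in> fibre (C, C)"
  obtains s where "parallel C s" "s C = u"
proof -
  interpret L: local_system \<A> w "\<lambda>F. fibre (F, chamber_at \<A> F C)"
    "\<lambda>F G. tr (F, chamber_at \<A> F C) (G, chamber_at \<A> G C)"
    by (rule chamber_local_system[OF C])
  have "u \<in> fibre (C, chamber_at \<A> C C)" using u chamber_at_self[OF C C] by simp
  then obtain s where "L.flat s (faces \<A>)" "s C = u" using L.flat_section_exists[OF chamber_face[OF C]] by blast
  then show thesis using that unfolding parallel_def L.flat_def by blast
qed

lemma parallelD:
  assumes "parallel C s" "F \<in> faces \<A>"
  shows "s F \<in> fibre (F, chamber_at \<A> F C)"
    "G \<in> faces \<A> \<Longrightarrow> face_ge F G \<Longrightarrow> tr (F, chamber_at \<A> F C) (G, chamber_at \<A> G C) (s F) = s G"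
  using assms unfolding parallel_def by blast+

lemma W_chamber: "C \<in> chambers \<A> \<Longrightarrow> (C, C) \<in> W"
  unfolding W_def using face_ge_refl chamber_face by auto

lemma W_ge_chamber: "(F, C) \<in> W \<Longrightarrow> D \<in> chambers \<A> \<Longrightarrow> face_ge F D \<Longrightarrow> W_ge (F, C) (D, D)"
  unfolding W_def W_ge_def by (auto simp: chamber_at_self)

lemma edge_W_chamber:
  assumes "(F, C) \<in> W" "D \<in> chambers \<A>" "face_ge F D"
  shows "{(F, C), (D, D)} \<in> K" "{(D, D), (F, C)} \<in> K"
  using edge_K[OF assms(1) W_chamber[OF assms(2)] W_ge_chamber[OF assms]] by auto

section \<open>The graph over the chamber graph and the lifts of minimal paths\<close>

definition V\<Theta> :: "'s set" where
  "V\<Theta> = {s\<in>S'. \<exists>C\<in>chambers \<A>. r s = vertex (C, C)}"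

definition \<rho> :: "'s \<Rightarrow> 'a set" where
  "\<rho> s = (THE C. C \<in> chambers \<A> \<and> r s = vertex (C, C))"

lemma fibre_chamber:
  assumes "C \<in> chambers \<A>"
  shows "s \<in> fibre (C, C) \<longleftrightarrow> s \<in> V\<Theta> \<and> \<rho> s = C"
proof -
  have *: "\<rho> s = D" if "D \<in> chambers \<A>" "r s = vertex (D, D)" for D
    unfolding \<rho>_def
  proof (rule the_equality)
    show "D \<in> chambers \<A> \<and> r s = vertex (D, D)" using that by blast
    fix B assume B: "B \<in> chambers \<A> \<and> r s = vertex (B, B)"
    then have "(B, B) = (D, D)" using that(2) by (intro vertex_inj W_chamber that(1)) simp_all
    then show "B = D" by simp
  qed
  show ?thesis
  proof
    assume "s \<in> fibre (C, C)"
    then have "s \<in> S'" "r s = vertex (C, C)" unfolding fibre_def by auto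
    then show "s \<in> V\<Theta> \<and> \<rho> s = C" using *[OF assms] assms unfolding V\<Theta>_def by blast
  next
    assume s: "s \<in> V\<Theta> \<and> \<rho> s = C"
    then obtain D where D: "D \<in> chambers \<A>" "r s = vertex (D, D)" "s \<in> S'" unfolding V\<Theta>_def by auto
    have "D = C" using *[OF D(1,2)] s by simp
    then show "s \<in> fibre (C, C)" using D unfolding fibre_def by simp
  qed
qed

lemma V\<Theta>_chamber: "v \<in> V\<Theta> \<Longrightarrow> \<rho> v \<in> chambers \<A>"
proof -
  assume "v \<in> V\<Theta>"
  then obtain D where "D \<in> chambers \<A>" "v \<in> fibre (D, D)" unfolding V\<Theta>_def fibre_def by auto
  then show ?thesis using fibre_chamber by auto
qed

lemma V\<Theta>_fibre: "v \<in> V\<Theta> \<Longrightarrow> v \<in> fibre (\<rho> v, \<rho> v)"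
  using fibre_chamber V\<Theta>_chamber by blast

text \<open>The middle vertex carries the chamber of departure. Crossing from \<open>D\<close> to
  \<open>C\<close> uses the vertex with \<open>D\<close> instead, so it is in general not the
  inverse of this map; the two together go around the hyperplane.\<close>

definition cross :: "'a set \<Rightarrow> 'a set \<Rightarrow> 's \<Rightarrow> 's" where
  "cross C D u = tr (facet C D, C) (D, D) (tr (C, C) (facet C D, C) u)"

definition E\<Theta> :: "('s \<times> 's) set" where
  "E\<Theta> = {(u, v). u \<in> V\<Theta> \<and> v \<in> V\<Theta> \<and> (\<rho> u, \<rho> v) \<in> chamber_edges \<A> \<and> v = cross (\<rho> u) (\<rho> v) u}"

lemma facet_W:
  assumes "(C, D) \<in> chamber_edges \<A>"
  shows "(facet C D, C) \<in> W" "{(facet C D, C), (C, C)} \<in> K" "{(C, C), (facet C D, C)} \<in> K"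
    "{(facet C D, C), (D, D)} \<in> K" "{(D, D), (facet C D, C)} \<in> K"
proof -
  have CD: "C \<in> chambers \<A>" "D \<in> chambers \<A>" using assms edge_iff by auto
  show W: "(facet C D, C) \<in> W" unfolding W_def using facet(1)[OF assms] facet_ge(1)[OF assms] CD by simp
  show "{(facet C D, C), (C, C)} \<in> K" "{(C, C), (facet C D, C)} \<in> K"
    by (rule edge_W_chamber[OF W CD(1) facet_ge(1)[OF assms]])+
  show "{(facet C D, C), (D, D)} \<in> K" "{(D, D), (facet C D, C)} \<in> K"
    by (rule edge_W_chamber[OF W CD(2) facet_ge(2)[OF assms]])+
qed

lemma cross_in:
  assumes "(C, D) \<in> chamber_edges \<A>" "u \<in> fibre (C, C)"
  shows "cross C D u \<in> fibre (D, D)"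
  unfolding cross_def using facet_W[OF assms(1)] assms(2) tr_in by blast

lemma cross_inverse:
  assumes "(C, D) \<in> chamber_edges \<A>"
  shows "u \<in> fibre (C, C) \<Longrightarrow> tr (facet C D, C) (C, C) (tr (D, D) (facet C D, C) (cross C D u)) = u"
    and "v \<in> fibre (D, D) \<Longrightarrow> cross C D (tr (facet C D, C) (C, C) (tr (D, D) (facet C D, C) v)) = v"
  unfolding cross_def using facet_W[OF assms] tr_in tr_inverse by simp_all

sublocale graph_covering V\<Theta> E\<Theta> "chambers \<A>" "chamber_edges \<A>" \<rho>
proof
  show "E\<Theta> \<subseteq> V\<Theta> \<times> V\<Theta>" unfolding E\<Theta>_def by auto
  show "chamber_edges \<A> \<subseteq> chambers \<A> \<times> chambers \<A>" by (rule edges_sub)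
  show "v \<in> V\<Theta> \<Longrightarrow> \<rho> v \<in> chambers \<A>" for v by (rule V\<Theta>_chamber)
  show "(u, v) \<in> E\<Theta> \<Longrightarrow> (\<rho> u, \<rho> v) \<in> chamber_edges \<A>" for u v unfolding E\<Theta>_def by auto
next
  fix u d assume u: "u \<in> V\<Theta>" and e: "(\<rho> u, d) \<in> chamber_edges \<A>"
  have d: "d \<in> chambers \<A>" using e edge_iff by blast
  have "cross (\<rho> u) d u \<in> V\<Theta> \<and> \<rho> (cross (\<rho> u) d u) = d"
    using cross_in[OF e V\<Theta>_fibre[OF u]] fibre_chamber[OF d] by blast
  then show "\<exists>!v. (u, v) \<in> E\<Theta> \<and> \<rho> v = d"
    using u e unfolding E\<Theta>_def by (intro ex1I[of _ "cross (\<rho> u) d u"]) auto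
next
  fix v c assume v: "v \<in> V\<Theta>" and e: "(c, \<rho> v) \<in> chamber_edges \<A>"
  \<comment> \<open>The unique source of an edge into \<open>v\<close> is found by walking the same
    two segments backwards, still through the vertex with the chamber \<open>c\<close>.\<close>
  let ?u = "tr (facet c (\<rho> v), c) (c, c) (tr (\<rho> v, \<rho> v) (facet c (\<rho> v), c) v)"
  have c: "c \<in> chambers \<A>" using e edge_iff by blast
  have "?u \<in> fibre (c, c)" using facet_W[OF e] V\<Theta>_fibre[OF v] tr_in by blast
  then have u: "?u \<in> V\<Theta>" "\<rho> ?u = c" using fibre_chamber[OF c] by blast+
  show "\<exists>!u. (u, v) \<in> E\<Theta> \<and> \<rho> u = c"
  proof (rule ex1I[of _ ?u])
    show "(?u, v) \<in> E\<Theta> \<and> \<rho> ?u = c"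
      unfolding E\<Theta>_def using u v e cross_inverse(2)[OF e V\<Theta>_fibre[OF v]] by simp
    fix x assume x: "(x, v) \<in> E\<Theta> \<and> \<rho> x = c"
    then have "x \<in> V\<Theta>" "v = cross c (\<rho> v) x" unfolding E\<Theta>_def by auto
    then show "x = ?u" using cross_inverse(1)[OF e, of x] V\<Theta>_fibre[of x] x by auto
  qed
qed

text \<open>\<open>C\<close> is on the departure side, so \<open>chamber_at_facet\<close> puts the
  middle vertex of the crossing into the copy attached to \<open>C\<close>. Both halves of the
  crossing are then transports within the parallel family.\<close>

lemma parallel_cross:
  assumes C: "C \<in> chambers \<A>" and s: "parallel C s" and e: "(X, Y) \<in> chamber_edges \<A>"
    and H: "\<And>H. H \<in> Sep X Y \<Longrightarrow> sn C H = sn X H"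
  shows "cross X Y (s X) = s Y"
proof -
  let ?G = "facet X Y"
  have XY: "X \<in> chambers \<A>" "Y \<in> chambers \<A>" using e unfolding edge_iff by blast+
  note f = facet(1)[OF e] chamber_face[OF XY(1)] chamber_face[OF XY(2)]
  have at: "chamber_at \<A> ?G C = X" "chamber_at \<A> X C = X" "chamber_at \<A> Y C = Y"
    by (rule chamber_at_facet[OF e C H], assumption, rule chamber_at_self[OF C XY(1)], rule chamber_at_self[OF C XY(2)])
  have G: "s ?G \<in> fibre (?G, X)" using parallelD(1)[OF s f(1)] at by simp
  have "tr (?G, X) (X, X) (s ?G) = s X" "tr (?G, X) (Y, Y) (s ?G) = s Y"
    using parallelD(2)[OF s f(1,2) facet_ge(1)[OF e]] parallelD(2)[OF s f(1,3) facet_ge(2)[OF e]] at by auto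
  moreover have "tr (X, X) (?G, X) (tr (?G, X) (X, X) (s ?G)) = s ?G"
    by (rule tr_inverse[OF facet_W(2)[OF e] G])
  ultimately show ?thesis unfolding cross_def by simp
qed

text \<open>The equation of lengths says that every step leads one hyperplane farther away from
  \<open>C\<close>. Each crossing then starts on the side of \<open>C\<close>, where
  \<open>parallel_cross\<close> applies. It is stated for a path starting anywhere in the family so
  that the induction can drop the first step.\<close>

lemma parallel_minimal_path:
  assumes C: "C \<in> chambers \<A>" and s: "parallel C s"
    and "(v, ss) \<in> paths V\<Theta> E\<Theta>" "positive (v, ss)" "v = s (\<rho> v)"
    and "card (Sep C (\<rho> v)) + length ss = card (Sep C (\<rho> (p_end (v, ss))))"
  shows "p_end (v, ss) = s (\<rho> (p_end (v, ss)))"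
  using assms(3-6)
proof (induction ss arbitrary: v)
  case (Cons st ss)
  obtain a b c where st: "st = ((a, b), c)" by (cases st rule: step_src.cases)
  have p: "(v, b) \<in> E\<Theta>" "a = v" "c" "(b, ss) \<in> paths V\<Theta> E\<Theta>"
    using Cons.prems(1,2) unfolding st positive_def by (auto simp: paths_Cons[OF E\<Theta>])
  have pos: "positive (b, ss)" using Cons.prems(2) unfolding positive_def by simp
  have end_eq: "p_end (v, st # ss) = p_end (b, ss)" using p unfolding st by simp
  let ?X = "\<rho> v" and ?Y = "\<rho> b" and ?D = "\<rho> (p_end (b, ss))"
  have e: "(?X, ?Y) \<in> chamber_edges \<A>" and b: "b = cross ?X ?Y v" using p(1) unfolding E\<Theta>_def by auto
  have ch: "?X \<in> chambers \<A>" "?Y \<in> chambers \<A>" "card (Sep ?X ?Y) = 1" using e edge_iff by auto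
  obtain H where H: "Sep ?X ?Y = {H}" using ch(3) card_1_singletonE by blast
  have HA: "H \<in> \<A>" "sn ?X H \<noteq> sn ?Y H" using H unfolding Sep_def by auto
  have XY: "sn ?X H' = sn ?Y H'" if "H' \<in> \<A>" "H' \<noteq> H" for H' using H that unfolding Sep_def by blast
  have "(?Y, map (step_map \<rho>) ss) \<in> paths (chambers \<A>) (chamber_edges \<A>)"
    using p_map_paths[OF p(4)] by (simp add: p_map_eq)
  moreover have "positive (?Y, map (step_map \<rho>) ss)" using pos unfolding positive_def step_map_def by simp
  moreover have "p_end (?Y, map (step_map \<rho>) ss) = ?D" using p_end_map[of \<rho> "(b, ss)"] by (simp add: p_map_eq)
  ultimately have "card (Sep ?Y ?D) \<le> length ss" using positive_path_length[of ?Y "map (step_map \<rho>) ss"] by simp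
  \<comment> \<open>The rest of the path is at least as long as the distance from \<open>?Y\<close>
    to its end, so the first step already has to increase the distance from
    \<open>C\<close>.\<close>
  then have low: "card (Sep C ?X) + 1 \<le> card (Sep C ?Y)"
    using card_Sep_triangle[of C ?D ?Y] Cons.prems(4) end_eq by simp
  \<comment> \<open>Otherwise the step would cross \<open>H\<close> towards \<open>C\<close>, and
    \<open>?Y\<close> would be no farther from \<open>C\<close> than \<open>?X\<close>.\<close>
  have CX: "sn C H = sn ?X H"
  proof (rule ccontr)
    assume ne: "sn C H \<noteq> sn ?X H"
    then have "sn C H = sn ?Y H" using chamber_sn_flip[OF ch(1) C ch(2) HA(1)] HA(2) by simp
    then have "H \<notin> Sep C ?Y" unfolding Sep_def by simp
    have "Sep C ?Y \<subseteq> Sep C ?X"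
    proof
      fix H' assume H': "H' \<in> Sep C ?Y"
      then have "H' \<noteq> H" using \<open>H \<notin> Sep C ?Y\<close> by blast
      then show "H' \<in> Sep C ?X" using H' XY[of H'] unfolding Sep_def by simp
    qed
    then show False using low card_mono[OF finite_Sep, of "Sep C ?Y" C ?X] by simp
  qed
  have "Sep C ?Y \<subseteq> insert H (Sep C ?X)"
  proof
    fix H' assume "H' \<in> Sep C ?Y"
    then show "H' \<in> insert H (Sep C ?X)" using XY[of H'] unfolding Sep_def by (cases "H' = H") simp_all
  qed
  then have "card (Sep C ?Y) \<le> card (insert H (Sep C ?X))" by (intro card_mono) (simp_all add: finite_Sep)
  also have "\<dots> \<le> Suc (card (Sep C ?X))" using finite_Sep by (simp add: card_insert_if)
  finally have eq: "card (Sep C ?Y) + length ss = card (Sep C ?D)" using low Cons.prems(4) end_eq by simp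
  have "b = s ?Y"
  proof -
    have "sn C H' = sn ?X H'" if "H' \<in> Sep ?X ?Y" for H' using that CX unfolding H by simp
    then have "cross ?X ?Y (s ?X) = s ?Y" by (rule parallel_cross[OF C s e])
    then show ?thesis using b Cons.prems(3) by metis
  qed
  then show ?case unfolding end_eq using Cons.IH[OF p(4) pos _ eq] by blast
qed simp

lemma parallel_lift_end:
  assumes C: "C \<in> chambers \<A>" and s: "parallel C s" and D: "D \<in> chambers \<A>"
    and \<gamma>: "\<gamma> \<in> min_positive_paths (chambers \<A>) (chamber_edges \<A>) C D" and l: "lifts (s C) \<gamma> \<gamma>'"
  shows "p_end \<gamma>' = s D"
proof -
  obtain ss where g: "\<gamma>' = (s C, ss)" using l unfolding lifts_def p_begin_def by (cases \<gamma>') auto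
  have \<gamma>p: "positive \<gamma>" "p_end \<gamma> = D" "p_length \<gamma> = card (Sep C D)" "p_begin \<gamma> = C"
    using \<gamma> unfolding min_positive_paths_eq[OF C D] by auto
  have path: "(s C, ss) \<in> paths V\<Theta> E\<Theta>" and map: "p_map \<rho> (s C, ss) = \<gamma>" using l unfolding lifts_def g by auto
  have "positive (s C, ss)" using \<gamma>p(1) unfolding map[symmetric] p_map_eq positive_def step_map_def by auto
  moreover have "length ss = card (Sep C D)" using \<gamma>p(3) unfolding map[symmetric] p_map_eq p_length_def by simp
  moreover have C': "\<rho> (s C) = C" using lifts_begin[OF l] \<gamma>p(4) by simp
  moreover have D': "\<rho> (p_end (s C, ss)) = D" using p_end_map[of \<rho> "(s C, ss)"] map \<gamma>p(2) by simp
  ultimately show ?thesis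
    using parallel_minimal_path[OF C s path] unfolding g by simp
qed

text \<open>
  The coarsest relation is admissible: a cover only needs equivalent paths to have lifts with a
  common end.
\<close>

definition \<Theta> :: "'s osys" where
  "\<Theta> = \<lparr>verts = V\<Theta>, edges = E\<Theta>,
    prel = {(\<alpha>, \<beta>). \<alpha> \<in> paths V\<Theta> E\<Theta> \<and> \<beta> \<in> paths V\<Theta> E\<Theta> \<and> p_begin \<alpha> = p_begin \<beta> \<and> p_end \<alpha> = p_end \<beta>}\<rparr>"

lemma is_lift_iff: "is_lift \<Theta> \<rho> v \<alpha> \<alpha>' \<longleftrightarrow> lifts v \<alpha> \<alpha>'"
  unfolding is_lift_def lifts_def \<Theta>_def by simp

lemma lift_lifts:
  assumes "v \<in> V\<Theta>" "\<alpha> \<in> paths (chambers \<A>) (chamber_edges \<A>)" "p_begin \<alpha> = \<rho> v"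
  shows "lifts v \<alpha> (lift \<Theta> \<rho> v \<alpha>)"
  unfolding lift_def is_lift_iff by (rule theI'[OF unique_lift[OF assms]])

lemma transport_lift:
  assumes v: "v \<in> V\<Theta>" and F: "F \<in> faces \<A>"
  obtains \<gamma> \<gamma>' where "\<gamma> \<in> min_positive_paths (chambers \<A>) (chamber_edges \<A>) (\<rho> v) (chamber_at \<A> F (\<rho> v))"
    "lifts v \<gamma> \<gamma>'" "p_end \<gamma>' = transport \<A> \<Theta> \<rho> F v"
proof -
  let ?C = "\<rho> v" and ?D = "chamber_at \<A> F (\<rho> v)"
  have C: "?C \<in> chambers \<A>" by (rule V\<Theta>_chamber[OF v])
  have D: "?D \<in> chambers \<A>" by (rule chamber_at(1)[OF F C])
  define \<gamma> where "\<gamma> = (SOME \<gamma>. \<gamma> \<in> min_positive_paths (chambers \<A>) (chamber_edges \<A>) ?C ?D)"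
  have \<gamma>: "\<gamma> \<in> min_positive_paths (chambers \<A>) (chamber_edges \<A>) ?C ?D"
    unfolding \<gamma>_def using min_positive_paths_nonempty[OF C D] by (rule some_in_eq[THEN iffD2])
  then have "\<gamma> \<in> paths (chambers \<A>) (chamber_edges \<A>)" "p_begin \<gamma> = \<rho> v"
    unfolding min_positive_paths_eq[OF C D] by auto
  then have "lifts v \<gamma> (lift \<Theta> \<rho> v \<gamma>)" by (rule lift_lifts[OF v])
  then show thesis using that \<gamma> unfolding transport_def \<gamma>_def by blast
qed

text \<open>Whatever minimal path the choice in \<open>transport\<close> selects, its lift ends in
  the parallel family through \<open>v\<close>. Transport is thereby computed without paths.\<close>

lemma transport_parallel:
  assumes v: "v \<in> V\<Theta>" and s: "parallel (\<rho> v) s" "s (\<rho> v) = v" and F: "F \<in> faces \<A>"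
  shows "transport \<A> \<Theta> \<rho> F v = s (chamber_at \<A> F (\<rho> v))"
proof -
  have C: "\<rho> v \<in> chambers \<A>" by (rule V\<Theta>_chamber[OF v])
  obtain \<gamma> \<gamma>' where "\<gamma> \<in> min_positive_paths (chambers \<A>) (chamber_edges \<A>) (\<rho> v) (chamber_at \<A> F (\<rho> v))"
    "lifts v \<gamma> \<gamma>'" "p_end \<gamma>' = transport \<A> \<Theta> \<rho> F v"
    by (rule transport_lift[OF v F])
  then show ?thesis using parallel_lift_end[OF C s(1) chamber_at(1)[OF F C]] s(2) by simp
qed

lemma transport_path:
  assumes "v \<in> V\<Theta>" "F \<in> faces \<A>"
  shows "\<exists>\<alpha>\<in>paths V\<Theta> E\<Theta>. p_begin \<alpha> = v \<and> p_end \<alpha> = transport \<A> \<Theta> \<rho> F v"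
  using transport_lift[OF assms] unfolding lifts_def by metis

text \<open>The generators of the path relation: both lifts start in one parallel family and end at
  its value at \<open>D\<close>.\<close>

lemma same_lifts_minimal:
  assumes "\<alpha> \<in> min_positive_paths (chambers \<A>) (chamber_edges \<A>) C D"
    and "\<beta> \<in> min_positive_paths (chambers \<A>) (chamber_edges \<A>) C D"
  shows "same_lifts \<alpha> \<beta>"
proof -
  have a: "\<alpha> \<in> paths (chambers \<A>) (chamber_edges \<A>)" "p_begin \<alpha> = C" "p_end \<alpha> = D"
    and b: "\<beta> \<in> paths (chambers \<A>) (chamber_edges \<A>)" "p_begin \<beta> = C" "p_end \<beta> = D"
    using assms unfolding min_positive_paths_def Let_def by blast+
  have C: "C \<in> chambers \<A>" using paths_begin[OF a(1)] a(2) by simp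
  have D: "D \<in> chambers \<A>" using paths_end[OF edges_sub a(1)] a(3) by simp
  show ?thesis
  proof (rule same_liftsI)
    fix v \<alpha>' \<beta>' assume v: "v \<in> V\<Theta>" and l: "lifts v \<alpha> \<alpha>'" "lifts v \<beta> \<beta>'"
    have "\<rho> v = C" using lifts_begin[OF l(1)] a(2) by simp
    then have "v \<in> fibre (C, C)" using V\<Theta>_fibre[OF v] by simp
    then obtain s where s: "parallel C s" "s C = v" using parallel_exists[OF C] by blast
    show "p_end \<alpha>' = p_end \<beta>'"
      using parallel_lift_end[OF C s(1) D assms(1)] parallel_lift_end[OF C s(1) D assms(2)] l s(2) by simp
  qed (use a b in simp_all)
qed

section \<open>The poset limit as the poset of points over the vertices\<close>

definition pr :: "'a set \<times> 's \<Rightarrow> 'a set \<times> 'a set" where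
  "pr = (\<lambda>(F, v). (F, \<rho> v))"

definition pt :: "'a set \<times> 's \<Rightarrow> 's" where
  "pt = (\<lambda>(F, v). tr (\<rho> v, \<rho> v) (F, \<rho> v) v)"

abbreviation "PL \<equiv> Plim \<A> \<Theta> \<rho>"
abbreviation "PL_ge \<equiv> Plim_ge \<A> \<Theta> \<rho>"

lemma Plim_iff: "(F, v) \<in> PL \<longleftrightarrow> F \<in> faces \<A> \<and> v \<in> V\<Theta> \<and> face_ge F (\<rho> v)"
  unfolding Plim_def diagram_space_def \<Theta>_def by auto

lemma Plim_W: "(F, v) \<in> PL \<Longrightarrow> (F, \<rho> v) \<in> W"
  unfolding Plim_iff W_def using V\<Theta>_chamber by auto

lemma pr_W: "e \<in> PL \<Longrightarrow> pr e \<in> W"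
  using Plim_W unfolding pr_def by (cases e) auto

lemma pt_parallel:
  assumes v: "v \<in> V\<Theta>" and s: "parallel (\<rho> v) s" and F: "F \<in> faces \<A>"
  shows "tr (chamber_at \<A> F (\<rho> v), chamber_at \<A> F (\<rho> v)) (F, chamber_at \<A> F (\<rho> v)) (s (chamber_at \<A> F (\<rho> v))) = s F"
proof -
  let ?C = "\<rho> v" and ?D = "chamber_at \<A> F (\<rho> v)"
  have C: "?C \<in> chambers \<A>" by (rule V\<Theta>_chamber[OF v])
  have D: "?D \<in> chambers \<A>" by (rule chamber_at(1)[OF F C])
  have ge: "face_ge F ?D" by (rule chamber_at_ge[OF F C])
  have "tr (F, ?D) (?D, ?D) (s F) = s ?D"
    using parallelD(2)[OF s F chamber_face[OF D] ge] chamber_at_self[OF C D] by simp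
  moreover have "tr (?D, ?D) (F, ?D) (tr (F, ?D) (?D, ?D) (s F)) = s F"
    by (rule tr_inverse[OF edge_W_chamber(1)[OF W_I[OF F C] D ge] parallelD(1)[OF s F]])
  ultimately show ?thesis by simp
qed

text \<open>Everything is read off the parallel family \<open>s\<close> through \<open>v\<close>:
  \<open>pt\<close> sends \<open>(F, v)\<close> to \<open>s F\<close> and the transported element to
  \<open>s G\<close>, and parallelism relates these two points.\<close>

lemma transport_pt:
  assumes e: "(F, v) \<in> PL" and G: "G \<in> faces \<A>" "face_ge F G"
  shows "(G, transport \<A> \<Theta> \<rho> G v) \<in> PL" "\<rho> (transport \<A> \<Theta> \<rho> G v) = chamber_at \<A> G (\<rho> v)"
    "pt (G, transport \<A> \<Theta> \<rho> G v) = tr (pr (F, v)) (pr (G, transport \<A> \<Theta> \<rho> G v)) (pt (F, v))"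
    "pt (F, v) \<in> fibre (F, \<rho> v)"
proof -
  have F: "F \<in> faces \<A>" and v: "v \<in> V\<Theta>" and Fv: "face_ge F (\<rho> v)" using e Plim_iff by auto
  let ?C = "\<rho> v" and ?D = "chamber_at \<A> G (\<rho> v)" and ?v = "transport \<A> \<Theta> \<rho> G v"
  have C: "?C \<in> chambers \<A>" by (rule V\<Theta>_chamber[OF v])
  have D: "?D \<in> chambers \<A>" by (rule chamber_at(1)[OF G(1) C])
  obtain s where s: "parallel ?C s" "s ?C = v" using parallel_exists[OF C V\<Theta>_fibre[OF v]] by blast
  have tv: "?v = s ?D" by (rule transport_parallel[OF v s G(1)])
  have "s ?D \<in> fibre (?D, ?D)" using parallelD(1)[OF s(1) chamber_face[OF D]] chamber_at_self[OF C D] by simp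
  then have vD: "?v \<in> V\<Theta>" "\<rho> ?v = ?D" using fibre_chamber[OF D] tv by auto
  show "\<rho> ?v = ?D" by (rule vD(2))
  show "(G, ?v) \<in> PL" unfolding Plim_iff using G(1) vD chamber_at_ge[OF G(1) C] by simp
  have at: "chamber_at \<A> F ?C = ?C" by (rule chamber_at_id[OF F C Fv])
  have ptF: "pt (F, v) = s F" using pt_parallel[OF v s(1) F] at s(2) unfolding pt_def by simp
  have ptG: "pt (G, ?v) = s G" using pt_parallel[OF v s(1) G(1)] vD(2) tv unfolding pt_def by simp
  show "pt (G, ?v) = tr (pr (F, v)) (pr (G, ?v)) (pt (F, v))"
    using parallelD(2)[OF s(1) F G] at vD(2) unfolding ptF ptG pr_def by simp
  show "pt (F, v) \<in> fibre (F, ?C)" using parallelD(1)[OF s(1) F] at ptF by simp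
qed

lemma pt_in: "e \<in> PL \<Longrightarrow> pt e \<in> fibre (pr e)"
  using transport_pt(4)[OF _ _ face_ge_refl] unfolding pr_def by (cases e) (auto simp: Plim_iff)

lemma pt_determines:
  assumes "e \<in> PL" "e' \<in> PL" "pr e = pr e'" "pt e = pt e'"
  shows "e = e'"
proof -
  obtain F v F' v' where e: "e = (F, v)" "e' = (F', v')" by (metis surj_pair)
  have eq: "F' = F" "\<rho> v' = \<rho> v" using assms(3) unfolding e pr_def by auto
  have v: "v \<in> V\<Theta>" "v' \<in> V\<Theta>" "face_ge F (\<rho> v)" using assms(1,2) unfolding e Plim_iff by auto
  have K: "{(\<rho> v, \<rho> v), (F, \<rho> v)} \<in> K"
    by (rule edge_W_chamber(2)[OF _ V\<Theta>_chamber[OF v(1)] v(3)]) (use Plim_W assms(1) e in blast)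
  have "tr (F, \<rho> v) (\<rho> v, \<rho> v) (pt (F, v)) = v"
    unfolding pt_def by (simp add: tr_inverse[OF K V\<Theta>_fibre[OF v(1)]])
  moreover have "tr (F, \<rho> v) (\<rho> v, \<rho> v) (pt (F, v')) = v'"
    using tr_inverse[OF K, of v'] V\<Theta>_fibre[OF v(2)] eq(2) unfolding pt_def by simp
  moreover have "pt (F, v) = pt (F, v')" using assms(4) unfolding e eq(1) .
  ultimately have "v = v'" by metis
  then show ?thesis unfolding e eq(1) by simp
qed

text \<open>The path-theoretic order is the order of \<open>W\<close> together with transport in
  \<open>S'\<close>. For the converse, the element transported from \<open>e\<close> to the face of
  \<open>e'\<close> has the same \<open>pr\<close> and \<open>pt\<close> as \<open>e'\<close>, so it
  is \<open>e'\<close>.\<close>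

lemma PL_ge_iff:
  assumes "e \<in> PL" "e' \<in> PL"
  shows "PL_ge e e' \<longleftrightarrow> W_ge (pr e) (pr e') \<and> pt e' = tr (pr e) (pr e') (pt e)"
proof -
  obtain F v G u where e: "e = (F, v)" "e' = (G, u)" by (metis surj_pair)
  have Fv: "(F, v) \<in> PL" and G: "G \<in> faces \<A>" and Gu: "(G, u) \<in> PL" using assms unfolding e Plim_iff by auto
  show ?thesis
  proof
    assume "PL_ge e e'"
    then have ge: "face_ge F G" "u = transport \<A> \<Theta> \<rho> G v" unfolding e Plim_ge_def by auto
    show "W_ge (pr e) (pr e') \<and> pt e' = tr (pr e) (pr e') (pt e)"
      using transport_pt(2,3)[OF Fv G ge(1)] ge unfolding e by (simp add: pr_def W_ge_def)
  next
    assume R: "W_ge (pr e) (pr e') \<and> pt e' = tr (pr e) (pr e') (pt e)"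
    then have ge: "face_ge F G" "\<rho> u = chamber_at \<A> G (\<rho> v)" unfolding e pr_def W_ge_def by auto
    have same: "pr (G, transport \<A> \<Theta> \<rho> G v) = pr (G, u)"
      using transport_pt(2)[OF Fv G ge(1)] ge(2) unfolding pr_def by simp
    have "(G, transport \<A> \<Theta> \<rho> G v) = (G, u)"
      by (rule pt_determines[OF transport_pt(1)[OF Fv G ge(1)] Gu same])
        (use transport_pt(3)[OF Fv G ge(1)] R same in \<open>simp add: e\<close>)
    then show "PL_ge e e'" using ge(1) unfolding e Plim_ge_def by simp
  qed
qed

lemma PL_ge_trans:
  assumes "a \<in> PL" "b \<in> PL" "c \<in> PL" "PL_ge a b" "PL_ge b c"
  shows "PL_ge a c"
proof -
  note W = pr_W[OF assms(1)] pr_W[OF assms(2)] pr_W[OF assms(3)]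
  have ab: "W_ge (pr a) (pr b)" "pt b = tr (pr a) (pr b) (pt a)"
    and bc: "W_ge (pr b) (pr c)" "pt c = tr (pr b) (pr c) (pt b)"
    using assms(4)[unfolded PL_ge_iff[OF assms(1,2)]] assms(5)[unfolded PL_ge_iff[OF assms(2,3)]] by blast+
  have ac: "W_ge (pr a) (pr c)" by (rule W_ge_trans[OF W ab(1) bc(1)])
  have "{pr a, pr b, pr c} \<in> K" unfolding order_complex_def using W ab(1) bc(1) ac W_ge_refl by auto
  then have "pt c = tr (pr a) (pr c) (pt a)"
    unfolding bc(2) ab(2) by (rule tr_comp) (use pt_in[OF assms(1)] in auto)
  then show ?thesis using ac PL_ge_iff[OF assms(1,3)] by blast
qed

lemma lifted_complex_Plim:
  "lifted_complex S' r (Sal \<A> w) K vertex (order_complex PL PL_ge) pr pt"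
proof
  let ?L = "order_complex PL PL_ge"
  show "covering_space S' r (Sal \<A> w)" by (rule covering)
  show "finite K"
    by (rule finite_subset[of _ "Pow W"]) (auto simp: order_complex_def finite_W)
  show "finite \<sigma>" if "\<sigma> \<in> K" for \<sigma> by (rule order_complexD(1)[OF that])
  show "Sal \<A> w = (\<Union>\<sigma>\<in>K. convex hull (vertex ` \<sigma>))" by (rule Sal_eq)
  show "t = u" if "\<sigma> \<in> K" "\<tau> \<in> K" "t \<in> simplex_points \<sigma>" "u \<in> simplex_points \<tau>"
    "(\<Sum>x\<in>\<sigma>. t x *\<^sub>R vertex x) = (\<Sum>x\<in>\<tau>. u x *\<^sub>R vertex x)" for \<sigma> \<tau> t u
    by (rule vertex_embedded[OF that])
  show "finite \<upsilon>" if "\<upsilon> \<in> ?L" for \<upsilon> by (rule order_complexD(1)[OF that])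
  show prL: "pr ` \<upsilon> \<in> K" if "\<upsilon> \<in> ?L" for \<upsilon>
  proof -
    note \<upsilon> = order_complexD[OF that]
    have "W_ge (pr a) (pr b) \<or> W_ge (pr b) (pr a)" if "a \<in> \<upsilon>" "b \<in> \<upsilon>" for a b
      using \<upsilon>(4)[OF that] PL_ge_iff[of a b] PL_ge_iff[of b a] subsetD[OF \<upsilon>(3) that(1)] subsetD[OF \<upsilon>(3) that(2)] by blast
    then show ?thesis unfolding order_complex_def using \<upsilon>(1,2,3) pr_W by auto
  qed
  show "\<exists>g. is_section S' r (convex hull (vertex ` pr ` \<upsilon>)) g \<and> (\<forall>e\<in>\<upsilon>. g (vertex (pr e)) = pt e)"
    if L: "\<upsilon> \<in> ?L" for \<upsilon>
  proof -
    note \<upsilon> = order_complexD[OF L] and p = order_complexD[OF prL[OF L]]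
    have "\<exists>x\<in>pr ` \<upsilon>. \<forall>y\<in>pr ` \<upsilon>. W_ge x y"
    proof (rule finite_chain_greatest[OF p(1,2,4)])
      show "W_ge x z" if "x \<in> pr ` \<upsilon>" "y \<in> pr ` \<upsilon>" "z \<in> pr ` \<upsilon>" "W_ge x y" "W_ge y z" for x y z
        by (rule W_ge_trans[OF _ _ _ that(4,5)]) (use that(1-3) p(3) in blast)+
    qed
    then obtain e0 where e0: "e0 \<in> \<upsilon>" "\<forall>e\<in>\<upsilon>. W_ge (pr e0) (pr e)" by blast
    have e0P: "e0 \<in> PL" using e0(1) \<upsilon>(3) by blast
    obtain g where g: "is_section S' r (convex hull (vertex ` pr ` \<upsilon>)) g" "g (vertex (pr e0)) = pt e0"
      using section_at[OF prL[OF L] imageI[OF e0(1)] pt_in[OF e0P]] by blast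
    have "g (vertex (pr e)) = pt e" if e: "e \<in> \<upsilon>" for e
    proof -
      have eP: "e \<in> PL" using e \<upsilon>(3) by blast
      have tr: "tr (pr e0) (pr e) (pt e0) = g (vertex (pr e))"
        using tr_section[OF prL[OF L] g(1) imageI[OF e0(1)] imageI[OF e]] g(2) by simp
      consider "PL_ge e0 e" | "PL_ge e e0" using \<upsilon>(4)[OF e0(1) e] by blast
      then show ?thesis
      proof cases
        case 1
        then show ?thesis using tr PL_ge_iff[OF e0P eP] by simp
      next
        case 2
        then have *: "W_ge (pr e) (pr e0)" "pt e0 = tr (pr e) (pr e0) (pt e)" using PL_ge_iff[OF eP e0P] by blast+
        \<comment> \<open>\<open>e0\<close> has the greatest image, so the reverse comparison is
          possible only between equal images, where transport is the identity.\<close>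
        have same: "pr e0 = pr e" by (rule W_ge_antisym[OF pr_W[OF e0P] pr_W[OF eP] _ *(1)]) (use e0(2) e in blast)
        have "pt e0 = pt e" using *(2) tr_id[OF pr_W[OF eP] pt_in[OF eP]] unfolding same by simp
        then show ?thesis using g(2) unfolding same by simp
      qed
    qed
    then show ?thesis using g(1) by blast
  qed
  show "\<exists>\<upsilon>\<in>?L. pr ` \<upsilon> = \<tau> \<and> (\<forall>e\<in>\<upsilon>. pt e = g (vertex (pr e)))"
    if \<tau>: "\<tau> \<in> K" and g: "is_section S' r (convex hull (vertex ` \<tau>)) g" for \<tau> g
  proof -
    note t = order_complexD[OF \<tau>]
    \<comment> \<open>The element of the poset limit over \<open>p\<close> whose \<open>pt\<close>
      is the value of \<open>g\<close> there: this value is transported to the vertex of its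
      chamber, which inverts the transport in \<open>pt\<close>.\<close>
    define e where "e p = (fst p, tr p (snd p, snd p) (g (vertex p)))" for p
    have e: "e p \<in> PL \<and> pr (e p) = p \<and> pt (e p) = g (vertex p)" if p: "p \<in> \<tau>" for p
    proof -
      obtain F C where FC: "p = (F, C)" by (cases p)
      have W: "(F, C) \<in> W" using p t(3) FC by blast
      then have f: "F \<in> faces \<A>" "C \<in> chambers \<A>" "face_ge F C" unfolding W_def by auto
      have "vertex (F, C) \<in> convex hull (vertex ` \<tau>)" using p FC by (auto intro: hull_inc)
      then have gf: "g (vertex (F, C)) \<in> fibre (F, C)"
        using is_section_in[OF g] is_section_inv[OF g] unfolding fibre_def by blast
      let ?v = "tr (F, C) (C, C) (g (vertex (F, C)))"
      note E = edge_W_chamber[OF W f(2,3)]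
      have v: "?v \<in> V\<Theta>" "\<rho> ?v = C" using tr_in[OF E(1) gf] fibre_chamber[OF f(2)] by auto
      have "pt (F, ?v) = g (vertex (F, C))" unfolding pt_def using tr_inverse[OF E(1) gf] v(2) by simp
      then show ?thesis unfolding e_def FC pr_def using v f Plim_iff by simp
    qed
    have ge: "PL_ge (e p) (e q)" if "p \<in> \<tau>" "q \<in> \<tau>" "W_ge p q" for p q
      using PL_ge_iff[of "e p" "e q"] e[OF that(1)] e[OF that(2)] that(3) tr_section[OF \<tau> g that(1,2)] by simp
    have "e ` \<tau> \<in> ?L"
      unfolding order_complex_def
    proof (intro CollectI conjI ballI)
      show "e ` \<tau> \<subseteq> PL" using e by blast
      fix a b assume "a \<in> e ` \<tau>" "b \<in> e ` \<tau>"
      then obtain p q where "a = e p" "b = e q" "p \<in> \<tau>" "q \<in> \<tau>" by blast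
      then show "PL_ge a b \<or> PL_ge b a" using ge t(4)[of p q] by blast
    qed (use t(1,2) in auto)
    moreover have "pr ` e ` \<tau> = \<tau>" using e by (force simp: image_image)
    moreover have "pt x = g (vertex (pr x))" if "x \<in> e ` \<tau>" for x using that e by auto
    ultimately show ?thesis by blast
  qed
  show "\<phi> \<in> ?L" if "\<upsilon> \<in> ?L" "\<phi> \<subseteq> \<upsilon>" "\<phi> \<noteq> {}" for \<upsilon> \<phi>
    using that finite_subset unfolding order_complex_def by blast
  show "e = e'" if "e \<in> \<Union>?L" "e' \<in> \<Union>?L" "pr e = pr e'" "pt e = pt e'" for e e'
    by (rule pt_determines[OF _ _ that(3,4)]) (use that(1,2) order_complexD(3) in blast)+
qed

text \<open>The simplicial map adds up the weights over each image vertex; regrouping the sum by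
  image vertices undoes this.\<close>

lemma W_to_Sal_\<Lambda>:
  assumes "finite {e. t e \<noteq> 0}"
  shows "W_to_Sal \<A> w (\<Lambda>_map \<rho> t) = (\<Sum>e | t e \<noteq> 0. t e *\<^sub>R vertex (pr e))"
proof -
  let ?S = "{e. t e \<noteq> 0}"
  define T where "T = \<Lambda>_map \<rho> t"
  have T: "T x = (\<Sum>e | e \<in> ?S \<and> pr e = x. t e)" for x
    unfolding T_def \<Lambda>_map_def simplicial_map_def pr_def by simp
  have sub: "{x. T x \<noteq> 0} \<subseteq> pr ` ?S"
  proof
    fix x assume "x \<in> {x. T x \<noteq> 0}"
    then have "{e. e \<in> ?S \<and> pr e = x} \<noteq> {}" unfolding T by (metis (mono_tags, lifting) mem_Collect_eq sum.empty)
    then show "x \<in> pr ` ?S" by blast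
  qed
  have "W_to_Sal \<A> w T = (\<Sum>x | T x \<noteq> 0. T x *\<^sub>R vertex x)" unfolding W_to_Sal_def vertex_def ..
  also have "\<dots> = (\<Sum>x\<in>pr ` ?S. T x *\<^sub>R vertex x)"
    using assms sub by (intro sum.mono_neutral_left) auto
  also have "\<dots> = (\<Sum>x\<in>pr ` ?S. \<Sum>e | e \<in> ?S \<and> pr e = x. t e *\<^sub>R vertex (pr e))"
  proof (rule sum.cong[OF HOL.refl])
    fix x
    have "(\<Sum>e | e \<in> ?S \<and> pr e = x. t e *\<^sub>R vertex (pr e)) = (\<Sum>e | e \<in> ?S \<and> pr e = x. t e *\<^sub>R vertex x)"
      by (rule sum.cong) auto
    then show "T x *\<^sub>R vertex x = (\<Sum>e | e \<in> ?S \<and> pr e = x. t e *\<^sub>R vertex (pr e))"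
      unfolding T by (simp only: scaleR_sum_left)
  qed
  also have "\<dots> = (\<Sum>e\<in>?S. t e *\<^sub>R vertex (pr e))"
    by (rule sum.image_gen[OF assms, symmetric])
  finally show ?thesis unfolding T_def .
qed

lemma realization_homeomorphic:
  obtains h where "homeomorphic_map (W_cover \<A> \<Theta> \<rho>) (top_of_set S') h"
    "\<And>t. t \<in> topspace (W_cover \<A> \<Theta> \<rho>) \<Longrightarrow> r (h t) = (W_to_Sal \<A> w \<circ> \<Lambda>_map \<rho>) t"
proof -
  interpret C: lifted_complex S' r "Sal \<A> w" K vertex "order_complex PL PL_ge" pr pt
    by (rule lifted_complex_Plim)
  show thesis
  proof (rule that[of C.lifted_point])
    show "homeomorphic_map (W_cover \<A> \<Theta> \<rho>) (top_of_set S') C.lifted_point"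
      unfolding W_cover_def by (rule C.lifted_point_homeomorphic)
    fix t assume "t \<in> topspace (W_cover \<A> \<Theta> \<rho>)"
    then obtain \<upsilon> where \<upsilon>: "\<upsilon> \<in> order_complex PL PL_ge" "t \<in> simplex_points \<upsilon>"
      unfolding W_cover_def topspace_realization by blast
    have "finite {e. t e \<noteq> 0}"
      using simplex_points_carrier(1)[OF \<upsilon>(2)] C.finite_lifted[OF \<upsilon>(1)] finite_subset by blast
    then show "r (C.lifted_point t) = (W_to_Sal \<A> w \<circ> \<Lambda>_map \<rho>) t"
      using C.r_lifted_point(2)[OF \<upsilon>] W_to_Sal_\<Lambda> unfolding C.base_point_def by simp
  qed
qed

section \<open>Functoriality of the diagram and connectedness of the graph\<close>

lemma transport_id:
  assumes "F \<in> faces \<A>" "v \<in> V\<Theta>" "face_ge F (\<rho> v)"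
  shows "transport \<A> \<Theta> \<rho> F v = v"
proof -
  have C: "\<rho> v \<in> chambers \<A>" by (rule V\<Theta>_chamber[OF assms(2)])
  obtain s where s: "parallel (\<rho> v) s" "s (\<rho> v) = v" using parallel_exists[OF C V\<Theta>_fibre[OF assms(2)]] by blast
  show ?thesis
    using transport_parallel[OF assms(2) s assms(1)] chamber_at_id[OF assms(1) C assms(3)] s(2) by simp
qed

lemma hocolim_homeomorphic_W: "hocolim_diagram \<A> \<Theta> \<rho> homeomorphic_space W_cover \<A> \<Theta> \<rho>"
proof -
  define D where "D F = {v\<in>V\<Theta>. face_ge F (\<rho> v)}" for F
  define f where "f F G = transport \<A> \<Theta> \<rho> G" for F G :: "'a set"
  have PL: "(F, v) \<in> PL \<longleftrightarrow> F \<in> faces \<A> \<and> v \<in> D F" for F v unfolding Plim_iff D_def by simp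
  interpret H: discrete_diagram "faces \<A>" face_ge D f
  proof
    show "face_ge p p" for p by (rule face_ge_refl)
    show "p = q" if "p \<in> faces \<A>" "q \<in> faces \<A>" "face_ge p q" "face_ge q p" for p q
      by (rule face_ge_antisym[OF that])
    show "face_ge p s" if "face_ge p q" "face_ge q s" for p q s by (rule face_ge_trans[OF that])
    show in_D: "f p q x \<in> D q" if "p \<in> faces \<A>" "q \<in> faces \<A>" "face_ge p q" "x \<in> D p" for p q x
      using transport_pt(1)[of p x q] that unfolding f_def PL by blast
    show "f p p x = x" if "p \<in> faces \<A>" "x \<in> D p" for p x
      using transport_id[of p x] that unfolding f_def D_def by blast
    show "f q s (f p q x) = f p s x"
      if "p \<in> faces \<A>" "q \<in> faces \<A>" "s \<in> faces \<A>" "face_ge p q" "face_ge q s" "x \<in> D p" for p q s x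
    proof -
      have a: "(p, x) \<in> PL" using that PL by blast
      have b: "(q, f p q x) \<in> PL" using in_D[OF that(1,2,4,6)] that(2) PL by blast
      have c: "(s, f q s (f p q x)) \<in> PL"
        using in_D[OF that(2,3,5) in_D[OF that(1,2,4,6)]] that(3) PL by blast
      have "PL_ge (p, x) (q, f p q x)" "PL_ge (q, f p q x) (s, f q s (f p q x))"
        using that unfolding Plim_ge_def f_def by auto
      \<comment> \<open>An element below \<open>(p, x)\<close> is determined by its face, so
        transitivity of the order is exactly the composition law.\<close>
      from PL_ge_trans[OF a b c this] show ?thesis unfolding Plim_ge_def f_def by simp
    qed
  qed
  have "H.limit_poset = PL" unfolding H.limit_poset_def using PL by auto
  moreover have "H.limit_ge = PL_ge" unfolding H.limit_ge_def Plim_ge_def f_def ..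
  moreover have "diagram_space \<Theta> \<rho> = (\<lambda>F. discrete_topology (D F))"
    unfolding diagram_space_def D_def \<Theta>_def by auto
  moreover have "diagram_map \<A> \<Theta> \<rho> = f" unfolding diagram_map_def f_def by auto
  ultimately show ?thesis
    using H.hocolim_homeomorphic unfolding hocolim_diagram_def W_cover_def by simp
qed

lemma fibre_nonempty:
  assumes "C \<in> chambers \<A>"
  shows "fibre (C, C) \<noteq> {}"
proof -
  have "{(C, C)} \<in> K" using edge_K(1)[OF W_chamber[OF assms] W_chamber[OF assms]] W_ge_refl[OF W_chamber[OF assms]] by simp
  then have "vertex (C, C) \<in> Sal \<A> w" unfolding Sal_eq by (intro UN_I[of "{(C, C)}"]) simp_all
  then obtain s where "s \<in> S'" "r s = vertex (C, C)"
    using covering_space_imp_surjective[OF covering] by (metis imageE)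
  then show ?thesis unfolding fibre_def by blast
qed

text \<open>A disconnected graph would split the realization: comparable elements of the poset limit
  have vertices joined by a path, so the vertices of one simplex all lie in one component of the
  graph.\<close>

lemma connected_\<Theta>:
  assumes "connected S'"
  shows "connected_graph V\<Theta> E\<Theta>"
proof -
  define linked where "linked u v \<longleftrightarrow> (\<exists>\<alpha>\<in>paths V\<Theta> E\<Theta>. p_begin \<alpha> = u \<and> p_end \<alpha> = v)" for u v
  have linked_sym: "linked v u" if "linked u v" for u v
    using that paths_inv[OF E\<Theta>] p_end_inv[OF E\<Theta>] unfolding linked_def by (metis p_begin_simps(3))
  have linked_trans: "linked u x" if "linked u v" "linked v x" for u v x
    using that paths_comp[OF E\<Theta>] p_end_comp unfolding linked_def by (metis p_begin_simps(2))
  let ?L = "order_complex PL PL_ge"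
  have simplex: "linked (snd a) (snd b)" if "\<upsilon> \<in> ?L" "a \<in> \<upsilon>" "b \<in> \<upsilon>" for \<upsilon> a b
  proof -
    have ge: "linked (snd a) (snd b)" if "a \<in> PL" "b \<in> PL" "PL_ge a b" for a b
    proof -
      obtain F v G u where e: "a = (F, v)" "b = (G, u)" by (metis surj_pair)
      have "v \<in> V\<Theta>" "G \<in> faces \<A>" "u = transport \<A> \<Theta> \<rho> G v" using that unfolding e Plim_iff Plim_ge_def by auto
      then show ?thesis using transport_path unfolding linked_def e by simp
    qed
    have "a \<in> PL" "b \<in> PL" "PL_ge a b \<or> PL_ge b a" using order_complexD(3,4)[OF that(1)] that(2,3) by blast+
    then show ?thesis using ge linked_sym by blast
  qed
  have conn: "connected_space (realization ?L)"
  proof -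
    obtain h where "homeomorphic_map (W_cover \<A> \<Theta> \<rho>) (top_of_set S') h"
      using realization_homeomorphic by blast
    then have "W_cover \<A> \<Theta> \<rho> homeomorphic_space top_of_set S'" by (rule homeomorphic_map_imp_homeomorphic_space)
    then show ?thesis
      using homeomorphic_connected_space connected_space_subtopology assms unfolding W_cover_def
      by (metis connectedin_def connectedin_iff_connected)
  qed
  have "linked u v" if u: "u \<in> V\<Theta>" and v: "v \<in> V\<Theta>" for u v
  proof (rule ccontr)
    assume no: "\<not> linked u v"
    \<comment> \<open>If \<open>Q\<close> is invariant under \<open>linked\<close>, every closed
      simplex is either contained in \<open>part Q\<close> or disjoint from it, so
      \<open>part Q\<close> is open in the weak topology.\<close>
    define part where "part Q = {t \<in> topspace (realization ?L). \<forall>e. t e \<noteq> 0 \<longrightarrow> Q (snd e)}" for Q :: "'s \<Rightarrow> bool"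
    have op: "openin (realization ?L) (part Q)" if Q: "\<And>a b. linked a b \<Longrightarrow> Q a \<Longrightarrow> Q b" for Q
      unfolding openin_realization_iff
    proof (intro conjI ballI)
      show "part Q \<subseteq> \<Union>(simplex_points ` ?L)" unfolding part_def topspace_realization by blast
      fix \<upsilon> assume \<upsilon>: "\<upsilon> \<in> ?L"
      show "openin (top_of_set (simplex_points \<upsilon>)) (part Q \<inter> simplex_points \<upsilon>)"
      proof (cases "\<forall>e\<in>\<upsilon>. Q (snd e)")
        case True
        then have "simplex_points \<upsilon> \<subseteq> part Q"
          using \<upsilon> unfolding part_def topspace_realization simplex_points_def by blast
        then have "part Q \<inter> simplex_points \<upsilon> = simplex_points \<upsilon>" by blast
        then show ?thesis by simp
      next
        case False
        have "t \<notin> part Q" if t: "t \<in> simplex_points \<upsilon>" for t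
        proof
          assume "t \<in> part Q"
          note c = simplex_points_carrier[OF t order_complexD(1)[OF \<upsilon>]]
          obtain e where e: "t e \<noteq> 0" using c(2) by blast
          then have "Q (snd e)" using \<open>t \<in> part Q\<close> unfolding part_def by blast
          moreover have "e \<in> \<upsilon>" using e c(1) by blast
          ultimately have "\<forall>e'\<in>\<upsilon>. Q (snd e')" using Q simplex[OF \<upsilon>] by blast
          then show False using False by blast
        qed
        then have "part Q \<inter> simplex_points \<upsilon> = {}" by blast
        then show ?thesis by simp
      qed
    qed
    have cov: "topspace (realization ?L) \<subseteq> part (linked u) \<union> part (\<lambda>x. \<not> linked u x)"
    proof
      fix t assume t: "t \<in> topspace (realization ?L)"
      then obtain \<upsilon> where \<upsilon>: "\<upsilon> \<in> ?L" "t \<in> simplex_points \<upsilon>" unfolding topspace_realization by blast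
      have sub: "e \<in> \<upsilon>" if "t e \<noteq> 0" for e using \<upsilon>(2) that unfolding simplex_points_def by blast
      show "t \<in> part (linked u) \<union> part (\<lambda>x. \<not> linked u x)"
      proof (cases "\<exists>e\<in>\<upsilon>. linked u (snd e)")
        case True
        then have "\<forall>e\<in>\<upsilon>. linked u (snd e)" using linked_trans simplex[OF \<upsilon>(1)] by blast
        then show ?thesis using t sub unfolding part_def by blast
      next
        case False
        then show ?thesis using t sub unfolding part_def by blast
      qed
    qed
    have dis: "part (linked u) \<inter> part (\<lambda>x. \<not> linked u x) = {}"
    proof -
      have False if t: "t \<in> part (linked u)" "t \<in> part (\<lambda>x. \<not> linked u x)" for t
      proof -
        obtain \<upsilon> where \<upsilon>: "\<upsilon> \<in> ?L" "t \<in> simplex_points \<upsilon>"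
          using t(1) unfolding part_def topspace_realization by blast
        obtain e where "t e \<noteq> 0" using simplex_points_carrier(2)[OF \<upsilon>(2) order_complexD(1)[OF \<upsilon>(1)]] by blast
        then show False using t unfolding part_def by blast
      qed
      then show ?thesis by blast
    qed
    have pt: "(\<lambda>e. if e = (\<rho> x, x) then 1 else 0) \<in> part Q" if "x \<in> V\<Theta>" "Q x" for x Q
    proof -
      have f: "\<rho> x \<in> faces \<A>" by (rule chamber_face[OF V\<Theta>_chamber[OF that(1)]])
      then have PL: "(\<rho> x, x) \<in> PL" unfolding Plim_iff using that(1) face_ge_refl by blast
      have "transport \<A> \<Theta> \<rho> (\<rho> x) x = x" by (rule transport_id[OF f that(1) face_ge_refl])
      then have "PL_ge (\<rho> x, x) (\<rho> x, x)" unfolding Plim_ge_def by (simp add: face_ge_refl)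
      then have "{(\<rho> x, x)} \<in> ?L" unfolding order_complex_def using PL by simp
      moreover have "(\<lambda>e. if e = (\<rho> x, x) then 1 else 0) \<in> simplex_points {(\<rho> x, x)}"
        by (rule vertex_in_simplex_points) simp_all
      ultimately have "(\<lambda>e. if e = (\<rho> x, x) then 1 else 0) \<in> topspace (realization ?L)"
        unfolding topspace_realization by blast
      then show ?thesis unfolding part_def using that(2) by simp
    qed
    have uu: "linked u u" unfolding linked_def using u by (intro bexI[of _ "(u, [])"]) simp_all
    have o1: "openin (realization ?L) (part (linked u))" by (rule op) (rule linked_trans)
    have o2: "openin (realization ?L) (part (\<lambda>x. \<not> linked u x))"
      by (rule op) (use linked_trans linked_sym in blast)
    have "part (linked u) \<noteq> {}" using pt[OF u, of "linked u", OF uu] by blast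
    moreover have "part (\<lambda>x. \<not> linked u x) \<noteq> {}" using pt[OF v, of "\<lambda>x. \<not> linked u x", OF no] by blast
    ultimately show False using conn o1 o2 cov dis unfolding connected_space_def by blast
  qed
  moreover have "V\<Theta> \<noteq> {}" using chambers_nonempty fibre_nonempty fibre_chamber by blast
  ultimately show ?thesis unfolding connected_graph_def linked_def by blast
qed

lemma os_cover_\<Theta>:
  assumes "connected S'"
  shows "os_cover \<Theta> (arrangement_system \<A>) \<rho>"
proof -
  let ?V = "chambers \<A>" and ?E = "chamber_edges \<A>"
  let ?B = "\<Union>C D. min_positive_paths ?V ?E C D \<times> min_positive_paths ?V ?E C D"
  have B: "same_lifts \<alpha> \<beta>" if "(\<alpha>, \<beta>) \<in> ?B" for \<alpha> \<beta> using that same_lifts_minimal by blast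
  have \<Gamma>: "oriented_system (arrangement_system \<A>)"
    unfolding arrangement_system_def
    by (rule oriented_system_generated[OF edges_sub connected_chambers]) (intro conjI same_liftsD[OF B]; assumption)
  have \<Theta>: "oriented_system \<Theta>"
    unfolding \<Theta>_def by (rule oriented_system_same_ends[OF E\<Theta> connected_\<Theta>[OF assms]])
  have mor: "graph_morphism \<Theta> (arrangement_system \<A>) \<rho>"
    unfolding graph_morphism_def \<Theta>_def arrangement_system_def using vertex_map edge_map by auto
  have lift: "\<exists>!\<alpha>'. is_lift \<Theta> \<rho> v \<alpha> \<alpha>'" if "v \<in> V\<Theta>" "\<alpha> \<in> paths ?V ?E" "p_begin \<alpha> = \<rho> v" for v \<alpha>
    unfolding is_lift_iff by (rule unique_lift[OF that])
  have rel: "(lift \<Theta> \<rho> v \<alpha>, lift \<Theta> \<rho> v \<beta>) \<in> prel \<Theta>"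
    if v: "v \<in> V\<Theta>" and ab: "(\<alpha>, \<beta>) \<in> generated_rel ?V ?E ?B" and b: "p_begin \<alpha> = \<rho> v" for v \<alpha> \<beta>
  proof -
    have "same_lifts \<alpha> \<beta>" by (rule same_lifts_generated[OF B ab])
    note s = same_liftsD[OF this]
    have l: "lifts v \<alpha> (lift \<Theta> \<rho> v \<alpha>)" "lifts v \<beta> (lift \<Theta> \<rho> v \<beta>)"
      by (rule lift_lifts[OF v s(1) b], rule lift_lifts[OF v s(2)]) (use b s(3) in simp)
    then show ?thesis using s(5)[OF v l] unfolding \<Theta>_def lifts_def by simp
  qed
  show ?thesis
    unfolding os_cover_def
  proof (intro conjI \<Gamma> \<Theta> mor ballI impI)
    fix v \<alpha> assume "v \<in> verts \<Theta>" "\<alpha> \<in> os_paths (arrangement_system \<A>)" "p_begin \<alpha> = \<rho> v"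
    then show "\<exists>!\<alpha>'. is_lift \<Theta> \<rho> v \<alpha> \<alpha>'"
      by (intro lift) (simp_all add: \<Theta>_def arrangement_system_def)
  next
    fix v x assume v: "v \<in> verts \<Theta>" and x: "x \<in> prel (arrangement_system \<A>)"
    obtain \<alpha> \<beta> where ab: "x = (\<alpha>, \<beta>)" by (cases x)
    have "v \<in> V\<Theta>" "(\<alpha>, \<beta>) \<in> generated_rel ?V ?E ?B"
      using v x unfolding ab by (simp_all add: \<Theta>_def arrangement_system_def)
    then show "case x of (\<alpha>, \<beta>) \<Rightarrow> p_begin \<alpha> = \<rho> v \<and> p_begin \<beta> = \<rho> v \<longrightarrow>
        (lift \<Theta> \<rho> v \<alpha>, lift \<Theta> \<rho> v \<beta>) \<in> prel \<Theta>"
      unfolding ab using rel by simp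
  qed
qed

end

theorem theorem7p1:
  fixes \<A> :: "'a::euclidean_space set set"
    and w :: "'a set \<Rightarrow> 'a"
    and S' :: "'s::topological_space set"
    and r :: "'s \<Rightarrow> 'a \<times> 'a"
  assumes "hyperplane_arrangement \<A>"
    and "\<And>F. F \<in> faces \<A> \<Longrightarrow> w F \<in> F"
    and "covering_space S' r (Sal \<A> w)"
    and "connected S'"
  shows "\<exists>(\<Theta> :: 's osys) (\<rho> :: 's \<Rightarrow> 'a set).
    os_cover \<Theta> (arrangement_system \<A>) \<rho> \<and>
    hocolim_diagram \<A> \<Theta> \<rho> homotopy_equivalent_space top_of_set S' \<and>
    isomorphic_over (W_cover \<A> \<Theta> \<rho>) (W_to_Sal \<A> w \<circ> \<Lambda>_map \<rho>) (top_of_set S') r"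
proof -
  interpret salvetti_covering \<A> w S' r
    by unfold_locales (use assms in auto)
  obtain h where h: "homeomorphic_map (W_cover \<A> \<Theta> \<rho>) (top_of_set S') h"
    "\<And>t. t \<in> topspace (W_cover \<A> \<Theta> \<rho>) \<Longrightarrow> r (h t) = (W_to_Sal \<A> w \<circ> \<Lambda>_map \<rho>) t"
    using realization_homeomorphic by blast
  have "hocolim_diagram \<A> \<Theta> \<rho> homeomorphic_space top_of_set S'"
    using hocolim_homeomorphic_W homeomorphic_map_imp_homeomorphic_space[OF h(1)]
    by (rule homeomorphic_space_trans)
  then have "hocolim_diagram \<A> \<Theta> \<rho> homotopy_equivalent_space top_of_set S'"
    by (rule homeomorphic_imp_homotopy_equivalent_space)
  moreover have "isomorphic_over (W_cover \<A> \<Theta> \<rho>) (W_to_Sal \<A> w \<circ> \<Lambda>_map \<rho>) (top_of_set S') r"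
    unfolding isomorphic_over_def using h by blast
  ultimately show ?thesis using os_cover_\<Theta>[OF assms(4)] by blast
qed

end
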